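(* Let $\mathcal I$ be a nominal model for the simply-typed $\lambda$-calculus with holes. Suppose $\Gamma,X{:}\chi\vdash r:\phi$ and $\Gamma\vdash t:\chi$, and suppose $\Gamma\models\varsigma$. Then $[\![r[X:=t]]\!]_{\varsigma;\Gamma}=[\![r]\!]_{\varsigma[X:=[\![t]\!]_{\varsigma;\Gamma}];\Gamma}$, where $\varsigma[X:=y]$ is the valuation mapping $X$ to $y$ and agreeing with $\varsigma$ elsewhere.
   Context: Atoms and nominal sets: a countably infinite set $\mathbb A$ of atoms partitioned into disjoint countably infinite sets $\mathbb A=\mathbb A_{\mathrm d}\uplus\mathbb A_{\mathrm u}$; permutations are bijections of $\mathbb A$ moving finitely many atoms, acting on ZFA sets by $\pi\cdot a=\pi(a)$, $\pi\cdot X=\{\pi\cdot x\mid x\in X\}$; $\mathrm{supp}(x)$ is the least finite set $A$ such that every permutation fixing $A$ pointwise fixes $x$; $a\#x$ means $a\notin\mathrm{supp}(x)$; $(a\ b)$ is a swapping. Syntax: unknowns $X,Y$; types $\phi::=\tau\mid\phi\to\phi$; constants $C$ with types $\mathrm{type}(C)$; terms $r::=a\mid C\mid X[b_i{:=}s_i]_{i=1}^n\mid\lambda c{:}\phi.s\mid rs$ with $\{b_i\}\subseteq\mathbb A_{\mathrm d}$ distinct, $c\in\mathbb A_{\mathrm u}$, up to $\alpha$-equivalence. Level 1 substitution $r[b_i{:=}s_i]_{i\in B}$: $b_j[b_i{:=}s_i]=s_j$; $a[b_i{:=}s_i]=a$ for $a\notin\{b_i\}$; $C[\dots]=C$; distributes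 over application; $(\lambda c{:}\phi.r)[b_i{:=}s_i]=\lambda c{:}\phi.(r[b_i{:=}s_i])$ for $c\in\mathbb A_{\mathrm u}$ not among the $b_i$ nor free in the $s_i$; $X[b_i{:=}s_i]_{i\in A}[b_i{:=}s_i]_{i\in B}=X[(b_i{:=}s_i)_{i\in B\setminus A,\ b_i\in\mathbb A_{\mathrm d}},(b_i{:=}s_i[b_j{:=}s_j]_{j\in B})_{i\in A}]$. Level 2 substitution $r[X:=t]$: $a[X:=t]=a$, $C[X:=t]=C$, $(rs)[X:=t]=(r[X:=t])(s[X:=t])$, $(\lambda a{:}\phi.s)[X:=t]=\lambda a{:}\phi.(s[X:=t])$ with $a\in\mathbb A_{\mathrm u}$ not free in $t$, $(X[b_i{:=}s_i]_1^n)[X:=t]=t[b_i{:=}s_i[X:=t]]_1^n$, $(Y[b_i{:=}s_i])[X:=t]=Y[b_i{:=}s_i[X:=t]]$ for $Y\neq X$. Type environments $\Gamma$: functional sets of typings $a{:}\phi$, $X{:}\phi$; $\mathrm{dom}(\Gamma)$. Typing rules: $\Gamma\vdash a:\phi$ if $a{:}\phi\in\Gamma$; $\Gamma\vdash C:\mathrm{type}(C)$; from $\Gamma,a{:}\phi\vdash r:\psi$ with $a\in\mathbb A_{\mathrm u}$ infer $\Gamma\vdash\lambda a{:}\phi.r:\phi\to\psi$; application rule; (Meta) if $X{:}\phi\in\Gamma$, $b_i{:}\psi_i\in\Gamma$, $\Gamma\vdash s_i:\psi_i$ then $\Gamma\vdash X[b_i{:=}s_i]_1^n:\phi$. Model: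 $\mathcal I$ assigns to each $\Gamma,\phi$ a finitely-supported set $\mathcal I_\Gamma(\phi)$, with $a^{\mathcal I}_\phi\in\mathcal I_\Gamma(\phi)$ for $a{:}\phi\in\Gamma$, $C^{\mathcal I}\in\mathcal I_\Gamma(\mathrm{type}(C))$, abstraction $[a{:}\phi]x\in\mathcal I_\Gamma(\phi\to\psi)$ for $x\in\mathcal I_{\Gamma,a:\phi}(\psi)$, application $x\bullet y\in\mathcal I_\Gamma(\psi)$; satisfying $\mathcal I_{\Gamma\cap\Gamma'}(\phi)=\mathcal I_\Gamma(\phi)\cap\mathcal I_{\Gamma'}(\phi)$; $\mathrm{supp}(x)\subseteq\mathrm{dom}(\Gamma)$ for $x\in\mathcal I_\Gamma(\phi)$; $\mathcal I_\Gamma(\phi)=\mathcal I_{\Gamma'}(\phi)$ whenever $\Gamma,\Gamma'$ agree on the typing of atoms (so typings of unknowns are ignored); equivariance for all permutations of the sets and data; and with $x[a\mapsto y]:=([a{:}\phi]x)\bullet y$: $a^{\mathcal I}_\phi[a\mapsto x]=x$; $a\#z\Rightarrow z[a\mapsto x]=z$; $(z'\bullet z)[a\mapsto x]=(z'[a\mapsto x])\bullet(z[a\mapsto x])$; $c\#x\Rightarrow([c{:}\chi]z)[a\mapsto x]=[c{:}\chi](z[a\mapsto x])$. Simultaneous substitution $x[b_i\mapsto y_i]_1^n:=\bigl(((c_1\ b_1)\circ\dots\circ(c_n\ b_n))\cdot x\bigr)[c_1\mapsto y_1]\cdots[c_n\mapsto y_n]$ for fresh distinct $c_i$. Valuations: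 $\varsigma$ maps unknowns to elements with $\mathrm{supp}(\varsigma(X))\subseteq\mathbb A_{\mathrm d}$; $\Gamma\models\varsigma$ means $X{:}\phi\in\Gamma$ implies $\varsigma(X)\in\mathcal I_\Gamma(\phi)$. Interpretation (for a typed term, in a valuation and environment typing its unknowns): $[\![a]\!]_{\varsigma;\Gamma}=a^{\mathcal I}_\phi$; $[\![C]\!]_{\varsigma;\Gamma}=C^{\mathcal I}$; $[\![\lambda a{:}\phi.r]\!]_{\varsigma;\Gamma}=[a{:}\phi][\![r]\!]_{\varsigma;\Gamma,a:\phi}$ ($a\in\mathbb A_{\mathrm u}\setminus\mathrm{dom}(\Gamma)$); $[\![rs]\!]_{\varsigma;\Gamma}=[\![r]\!]_{\varsigma;\Gamma}\bullet[\![s]\!]_{\varsigma;\Gamma}$; $[\![X[b_i{:=}s_i]_i]\!]_{\varsigma;\Gamma}=\varsigma(X)[b_i\mapsto[\![s_i]\!]_{\varsigma;\Gamma}]_i$.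
   Formalization: Type environments are assumed to type only finitely many atoms (unknowns unrestricted); otherwise fresh atoms for interpreting λ-abstractions may not exist, and finite support of the sets I_Γ(φ) would force every model to be trivial. *)

theory Defs
  imports "HOL-Library.Finite_Map" "HOL-Combinatorics.Perm"
begin

section \<open>Atoms, permutations and support\<close>

text \<open>
  The two infinite classes of atoms: \<open>D\<close> embeds the atoms that level 1 substitutions attached to
  unknowns act on, \<open>U\<close> the atoms that can be bound by \<open>\<lambda>\<close>.
\<close>

datatype datom = DAtom nat
datatype uatom = UAtom nat
datatype atom = D datom | U uatom

text \<open>
  An action of the finite permutations \<^typ>\<open>atom perm\<close> on a type \<open>'e\<close> is a function
  \<open>act :: atom perm \<Rightarrow> 'e \<Rightarrow> 'e\<close>.
\<close>

definition perm_action :: "(atom perm \<Rightarrow> 'e \<Rightarrow> 'e) \<Rightarrow> bool" where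
  "perm_action act \<longleftrightarrow> (\<forall>x. act 1 x = x) \<and> (\<forall>\<pi> \<pi>' x. act (\<pi> * \<pi>') x = act \<pi> (act \<pi>' x))"

definition supports :: "(atom perm \<Rightarrow> 'e \<Rightarrow> 'e) \<Rightarrow> atom set \<Rightarrow> 'e \<Rightarrow> bool" where
  "supports act A x \<longleftrightarrow> (\<forall>\<pi>. (\<forall>a\<in>A. apply \<pi> a = a) \<longrightarrow> act \<pi> x = x)"

definition finitely_supported :: "(atom perm \<Rightarrow> 'e \<Rightarrow> 'e) \<Rightarrow> 'e \<Rightarrow> bool" where
  "finitely_supported act x \<longleftrightarrow> (\<exists>A. finite A \<and> supports act A x)"

text \<open>
  For a finitely supported \<open>x\<close> this is the least finite supporting set (\<open>supp_least\<close> below);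
  otherwise it is \<^const>\<open>UNIV\<close>, so that nothing is fresh for \<open>x\<close>.
\<close>

definition supp :: "(atom perm \<Rightarrow> 'e \<Rightarrow> 'e) \<Rightarrow> 'e \<Rightarrow> atom set" where
  "supp act x = \<Inter>{A. finite A \<and> supports act A x}"

lemma infinite_UNIV_uatom: "infinite (UNIV :: uatom set)"
proof -
  have "inj UAtom" by (simp add: inj_def)
  then show ?thesis using finite_imageD infinite_UNIV_nat by (metis finite_subset subset_UNIV)
qed

lemma infinite_UNIV_datom: "infinite (UNIV :: datom set)"
proof -
  have "inj DAtom" by (simp add: inj_def)
  then show ?thesis using finite_imageD infinite_UNIV_nat by (metis finite_subset subset_UNIV)
qed

lemma infinite_UNIV_atom: "infinite (UNIV :: atom set)"
proof -
  have "inj U" by (simp add: inj_def)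
  then show ?thesis using finite_imageD infinite_UNIV_uatom by (metis finite_subset subset_UNIV)
qed

lemma swap_fixes_supports:
  assumes act: "perm_action act" and fin: "finite A" "finite B"
    and sup: "supports act A x" "supports act B x" and ab: "a \<notin> A \<inter> B" "b \<notin> A \<inter> B"
  shows "act (Perm.swap a b) x = x"
proof (cases "a = b")
  case True
  then show ?thesis using act by (simp add: perm_action_def)
next
  case False
  have "finite (A \<union> B \<union> {a, b})" using fin by simp
  then obtain c where c: "c \<notin> A \<union> B \<union> {a, b}"
    using infinite_UNIV_atom by (metis ex_new_if_finite)
  have fresh: "act (Perm.swap d c) x = x" if "d \<notin> A \<inter> B" for d
  proof (cases "d \<in> A")
    case True
    then have "\<forall>e\<in>B. apply (Perm.swap d c) e = e"
      using that c by (auto simp: apply_swap_eq_iff Perm.swap.rep_eq transpose_def)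
    then show ?thesis using sup by (simp add: supports_def)
  next
    case False
    then have "\<forall>e\<in>A. apply (Perm.swap d c) e = e"
      using that c by (auto simp: apply_swap_eq_iff Perm.swap.rep_eq transpose_def)
    then show ?thesis using sup by (simp add: supports_def)
  qed
  have "Perm.swap a b = Perm.swap a c * (Perm.swap b c * Perm.swap a c)"
    using False c by (intro perm_eqI) (auto simp: Perm.swap.rep_eq apply_times transpose_def)
  then show ?thesis using fresh[OF ab(1)] fresh[OF ab(2)] act by (simp add: perm_action_def)
qed

lemma supports_Int:
  assumes act: "perm_action act" and fin: "finite A" "finite B"
    and sup: "supports act A x" "supports act B x"
  shows "supports act (A \<inter> B) x"
  unfolding supports_def
proof (intro allI impI)
  fix \<pi> :: "atom perm"
  show "\<forall>a\<in>A \<inter> B. apply \<pi> a = a \<Longrightarrow> act \<pi> x = x"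
  proof (induction "card (affected \<pi>)" arbitrary: \<pi> rule: less_induct)
    case less
    show ?case
    proof (cases "affected \<pi> = {}")
      case True
      then show ?thesis using act by (simp add: perm_action_def)
    next
      case False
      then obtain a where a: "a \<in> affected \<pi>" by blast
      define b where "b = apply \<pi> a"
      define \<rho> where "\<rho> = Perm.swap a b * \<pi>"
      have ab: "a \<noteq> b" using a by (auto simp: b_def in_affected)
      have fixb: "apply \<pi> b \<noteq> b" using ab by (metis b_def apply_inj)
      have nin: "a \<notin> A \<inter> B" "b \<notin> A \<inter> B" using less.prems ab fixb b_def by metis+
      have "affected \<rho> \<subseteq> affected \<pi> - {a}"
      proof
        fix c assume c: "c \<in> affected \<rho>"
        have "c \<noteq> a" using c by (auto simp: \<rho>_def in_affected apply_times b_def Perm.swap.rep_eq)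
        moreover have "apply \<pi> c \<noteq> c"
        proof
          assume *: "apply \<pi> c = c"
          then have "c \<noteq> b" using fixb by auto
          then show False using c * \<open>c \<noteq> a\<close>
            by (auto simp: \<rho>_def in_affected apply_times Perm.swap.rep_eq transpose_def)
        qed
        ultimately show "c \<in> affected \<pi> - {a}" by (simp add: in_affected)
      qed
      then have "card (affected \<rho>) < card (affected \<pi>)"
        using a by (intro psubset_card_mono) auto
      moreover have "\<forall>c\<in>A \<inter> B. apply \<rho> c = c"
        using less.prems nin by (auto simp: \<rho>_def apply_times Perm.swap.rep_eq transpose_def)
      ultimately have "act \<rho> x = x" using less.hyps by blast
      moreover have "\<pi> = Perm.swap a b * \<rho>"
        by (intro perm_eqI) (simp add: \<rho>_def apply_times Perm.swap.rep_eq)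
      moreover have "act (Perm.swap a b) x = x"
        using swap_fixes_supports[OF act fin sup nin] .
      ultimately show ?thesis using act by (simp add: perm_action_def)
    qed
  qed
qed

lemma supp_least:
  assumes act: "perm_action act" and fs: "finitely_supported act x"
  shows "finite (supp act x)" "supports act (supp act x) x"
    and "\<And>A. finite A \<Longrightarrow> supports act A x \<Longrightarrow> supp act x \<subseteq> A"
proof -
  let ?P = "\<lambda>A. finite A \<and> supports act A x"
  obtain A where A: "?P A" and min: "\<And>B. ?P B \<Longrightarrow> card A \<le> card B"
    using fs ex_has_least_nat[of ?P _ card] unfolding finitely_supported_def by blast
  have "A \<subseteq> B" if "?P B" for B
  proof -
    have "?P (A \<inter> B)" using supports_Int[OF act] A that by blast
    then have "card A \<le> card (A \<inter> B)" by (rule min)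
    then have "A \<inter> B = A" using A by (meson card_seteq inf_le1)
    then show ?thesis by blast
  qed
  then have eq: "supp act x = A" using A by (auto simp: supp_def)
  show "finite (supp act x)" "supports act (supp act x) x" using eq A by auto
  show "\<And>A. finite A \<Longrightarrow> supports act A x \<Longrightarrow> supp act x \<subseteq> A" by (auto simp: supp_def)
qed

section \<open>Types and terms\<close>

datatype 'b ty = Base 'b | Fun "'b ty" "'b ty"  (infixr \<open>\<rightarrow>\<^sub>t\<close> 65)

text \<open>
  Raw terms, with base types \<open>'b\<close>, constants \<open>'c\<close> and unknowns \<open>'v\<close>.  \<open>RUnk X m\<close> is the unknown \<open>X\<close>
  with the level 1 substitution \<open>m\<close> attached, a finite map from \<^typ>\<open>datom\<close> to terms.
\<close>

datatype ('b, 'c, 'v) raw =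
    RAtm atom
  | RCst 'c
  | RUnk 'v "(datom, ('b, 'c, 'v) raw) fmap"
  | RLam uatom "'b ty" "('b, 'c, 'v) raw"
  | RApp "('b, 'c, 'v) raw" "('b, 'c, 'v) raw"

primrec aperm :: "uatom perm \<Rightarrow> atom \<Rightarrow> atom" where
  "aperm \<pi> (D b) = D b"
| "aperm \<pi> (U c) = U (apply \<pi> c)"

primrec rperm :: "uatom perm \<Rightarrow> ('b, 'c, 'v) raw \<Rightarrow> ('b, 'c, 'v) raw" where
  "rperm \<pi> (RAtm a) = RAtm (aperm \<pi> a)"
| "rperm \<pi> (RCst C) = RCst C"
| "rperm \<pi> (RUnk X m) = RUnk X (fmmap (rperm \<pi>) m)"
| "rperm \<pi> (RLam c \<phi> r) = RLam (apply \<pi> c) \<phi> (rperm \<pi> r)"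
| "rperm \<pi> (RApp r s) = RApp (rperm \<pi> r) (rperm \<pi> s)"

text \<open>Only the atoms that can be bound are recorded.\<close>

primrec rfree :: "('b, 'c, 'v) raw \<Rightarrow> uatom set" where
  "rfree (RAtm a) = {c. a = U c}"
| "rfree (RCst C) = {}"
| "rfree (RUnk X m) = \<Union> (fmran' (fmmap rfree m))"
| "rfree (RLam c \<phi> r) = rfree r - {c}"
| "rfree (RApp r s) = rfree r \<union> rfree s"

text \<open>
  \<open>\<alpha>\<close>-equivalence: two abstractions are identified if their bodies are, after swapping the bound
  atoms for \<open>e\<close>, for all but finitely many \<open>e\<close>.
\<close>

inductive alpha :: "('b, 'c, 'v) raw \<Rightarrow> ('b, 'c, 'v) raw \<Rightarrow> bool" where
  alpha_Atm: "alpha (RAtm a) (RAtm a)"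
| alpha_Cst: "alpha (RCst C) (RCst C)"
| alpha_Unk: "fmrel alpha m m' \<Longrightarrow> alpha (RUnk X m) (RUnk X m')"
| alpha_Lam: "\<lbrakk>finite L; \<And>e. e \<notin> L \<Longrightarrow> alpha (rperm (Perm.swap e c) r) (rperm (Perm.swap e d) s)\<rbrakk>
    \<Longrightarrow> alpha (RLam c \<phi> r) (RLam d \<phi> s)"
| alpha_App: "\<lbrakk>alpha r r'; alpha s s'\<rbrakk> \<Longrightarrow> alpha (RApp r s) (RApp r' s')"

inductive_cases alpha_AtmE: "alpha (RAtm a) t"
inductive_cases alpha_CstE: "alpha (RCst C) t"
inductive_cases alpha_UnkE: "alpha (RUnk X m) t"
inductive_cases alpha_LamE: "alpha (RLam c \<phi> r) t"
inductive_cases alpha_AppE: "alpha (RApp r s) t"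

lemma aperm_1 [simp]: "aperm 1 a = a"
  by (cases a) auto

lemma aperm_times: "aperm (\<pi> * \<pi>') a = aperm \<pi> (aperm \<pi>' a)"
  by (cases a) (auto simp: apply_times)

lemma rperm_1 [simp]: "rperm 1 r = r"
  by (induction r) (auto simp: fmap.map_ident_strong)

lemma rperm_times: "rperm (\<pi> * \<pi>') r = rperm \<pi> (rperm \<pi>' r)"
  by (induction r) (auto simp: aperm_times apply_times fmap.map_comp intro!: fmap.map_cong)

lemma swap_conj: "Perm.swap (apply \<pi> a) (apply \<pi> b) * \<pi> = \<pi> * Perm.swap a b"
  by (intro perm_eqI) (auto simp: apply_times Perm.swap.rep_eq transpose_def apply_inj)

lemma fmrel_map_cong: "(\<And>x. x \<in> fmran' m \<Longrightarrow> R (f x) (g x)) \<Longrightarrow> fmrel R (fmmap f m) (fmmap g m)"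
  by (auto simp: fmrel_iff option.rel_map intro!: option.rel_refl_strong fmran'I)

lemma alpha_refl_perm: "alpha (rperm \<pi> r) (rperm \<pi> r)"
proof (induction r arbitrary: \<pi>)
  case (RLam c \<phi> r)
  have "alpha (rperm (Perm.swap e (apply \<pi> c)) (rperm \<pi> r)) (rperm (Perm.swap e (apply \<pi> c)) (rperm \<pi> r))" for e
    using RLam by (simp add: rperm_times[symmetric])
  then show ?case by (auto intro: alpha_Lam[of "{}"])
qed (auto intro!: alpha.intros fmrel_map_cong)

lemma alpha_refl: "alpha r r"
  using alpha_refl_perm[of 1 r] by simp

lemma alpha_sym: "alpha r s \<Longrightarrow> alpha s r"
proof (induction rule: alpha.induct)
  case (alpha_Unk m m' X)
  then have "fmrel alpha m' m"
    by (subst fmap.rel_flip[symmetric]) (auto elim!: fmap.rel_mono_strong)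
  then show ?case by (rule alpha.alpha_Unk)
qed (auto intro: alpha.intros)

lemma alpha_trans: "alpha r s \<Longrightarrow> alpha s t \<Longrightarrow> alpha r t"
proof (induction arbitrary: t rule: alpha.induct)
  case (alpha_Unk m m' X)
  from alpha_Unk.prems obtain m'' where t: "t = RUnk X m''" "fmrel alpha m' m''"
    by (rule alpha_UnkE)
  have "fmrel alpha m m''"
    unfolding fmrel_iff
  proof
    fix b
    show "rel_option alpha (fmlookup m b) (fmlookup m'' b)"
      using alpha_Unk.IH[unfolded fmrel_iff, rule_format, of b] t(2)[unfolded fmrel_iff, rule_format, of b]
      by (auto simp: option.rel_sel)
  qed
  then show ?case using t by (auto intro: alpha.alpha_Unk)
next
  case (alpha_Lam L c r d s \<phi>)
  from alpha_Lam.prems obtain L' e u where t: "t = RLam e \<phi> u" "finite L'"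
    "\<And>f. f \<notin> L' \<Longrightarrow> alpha (rperm (Perm.swap f d) s) (rperm (Perm.swap f e) u)"
    by (rule alpha_LamE) blast
  show ?case unfolding t(1)
    by (rule alpha.alpha_Lam[of "L \<union> L'"]) (use alpha_Lam t in auto)
qed (auto elim!: alpha_AtmE alpha_CstE alpha_AppE intro: alpha.intros)

lemma alpha_perm: "alpha r s \<Longrightarrow> alpha (rperm \<pi> r) (rperm \<pi> s)"
proof (induction rule: alpha.induct)
  case (alpha_Unk m m' X)
  then show ?case by (auto simp: fmap.rel_map intro!: alpha.alpha_Unk elim!: fmap.rel_mono_strong)
next
  case (alpha_Lam L c r d s \<phi>)
  have "alpha (rperm (Perm.swap e (apply \<pi> c)) (rperm \<pi> r)) (rperm (Perm.swap e (apply \<pi> d)) (rperm \<pi> s))"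
    if "e \<notin> apply \<pi> ` L" for e
  proof -
    obtain e0 where e: "e = apply \<pi> e0" using bij_apply[of \<pi>] by (metis bij_pointE)
    then have "e0 \<notin> L" using that by auto
    from alpha_Lam.IH[OF this] show ?thesis
      unfolding e rperm_times[symmetric] swap_conj by (simp add: rperm_times)
  qed
  then show ?case using alpha_Lam(1) by (auto intro: alpha.alpha_Lam[of "apply \<pi> ` L"])
qed (auto intro: alpha.intros)

lemma finite_rfree: "finite (rfree r)"
proof (induction r)
  case (RAtm a)
  then show ?case by (cases a) auto
qed (auto simp: fmran'_alt_def)

lemma rfree_perm: "rfree (rperm \<pi> r) = apply \<pi> ` rfree r"
proof (induction r)
  case (RAtm a)
  then show ?case by (cases a) auto
next
  case (RLam c \<phi> r)
  then show ?case by (simp add: image_set_diff[OF bij_is_inj[OF bij_apply]])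
qed (auto simp: fmran'_fmmap)

lemma alpha_rfree: "alpha r s \<Longrightarrow> rfree r = rfree s"
proof (induction rule: alpha.induct)
  case (alpha_Unk m m' X)
  then have "fmmap rfree m = fmmap rfree m'"
    by (subst fmap.rel_eq[symmetric]) (auto simp: fmap.rel_map elim: fmap.rel_mono_strong)
  then show ?case by simp
next
  case (alpha_Lam L c r d s \<phi>)
  obtain e where e: "e \<notin> L \<union> rfree r \<union> rfree s \<union> {c, d}"
    using ex_new_if_finite[OF infinite_UNIV_uatom] alpha_Lam(1) finite_rfree
    by (metis finite.emptyI finite_Un finite_insert)
  have "apply (Perm.swap e c) ` rfree r = apply (Perm.swap e d) ` rfree s"
    using alpha_Lam.IH[of e] e by (simp add: rfree_perm)
  moreover have "apply (Perm.swap e c) ` rfree r - {e} = rfree r - {c}" if "e \<notin> rfree r" "e \<noteq> c" for c r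
  proof -
    have "apply (Perm.swap e c) ` rfree r - {e} = apply (Perm.swap e c) ` (rfree r - {c})"
      by (subst image_set_diff[OF bij_is_inj[OF bij_apply]]) (simp add: Perm.swap.rep_eq)
    also have "\<dots> = id ` (rfree r - {c})"
      using that by (intro image_cong) (auto simp: Perm.swap.rep_eq transpose_def)
    finally show ?thesis by simp
  qed
  ultimately have "rfree r - {c} = rfree s - {d}" using e by (metis UnCI insertCI)
  then show ?case by simp
qed auto

lemma alpha_perm_agree:
  "(\<And>c. c \<in> rfree r \<Longrightarrow> apply \<pi> c = apply \<pi>' c) \<Longrightarrow> alpha (rperm \<pi> r) (rperm \<pi>' r)"
proof (induction r arbitrary: \<pi> \<pi>')
  case (RAtm a)
  then show ?case by (cases a) (auto intro: alpha.intros)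
next
  case (RUnk X m)
  have "alpha (rperm \<pi> r) (rperm \<pi>' r)" if "r \<in> fmran' m" for r
    by (rule RUnk.IH[OF that], rule RUnk.prems) (use that in auto)
  then show ?case by (auto intro!: alpha_Unk fmrel_map_cong)
next
  case (RLam c \<phi> r)
  have "alpha (rperm (Perm.swap e (apply \<pi> c)) (rperm \<pi> r)) (rperm (Perm.swap e (apply \<pi>' c)) (rperm \<pi>' r))"
    if e: "e \<notin> apply \<pi> ` rfree r" for e
    unfolding rperm_times[symmetric]
  proof (rule RLam.IH)
    fix d assume d: "d \<in> rfree r"
    show "apply (Perm.swap e (apply \<pi> c) * \<pi>) d = apply (Perm.swap e (apply \<pi>' c) * \<pi>') d"
    proof (cases "d = c")
      case True
      then show ?thesis by (simp add: apply_times Perm.swap.rep_eq)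
    next
      case False
      then have "apply \<pi> d = apply \<pi>' d" using RLam.prems d by auto
      moreover have "apply \<pi> d \<noteq> apply \<pi> c" "apply \<pi>' d \<noteq> apply \<pi>' c"
        using False by (simp_all add: apply_inj)
      moreover have "apply \<pi> d \<noteq> e" using e d by auto
      ultimately show ?thesis by (simp add: apply_times Perm.swap.rep_eq transpose_def)
    qed
  qed
  then show ?case
    unfolding rperm.simps by (intro alpha_Lam[of "apply \<pi> ` rfree r"] finite_imageI finite_rfree)
qed (auto intro!: alpha.intros)

primrec rheight :: "('b, 'c, 'v) raw \<Rightarrow> nat" where
  "rheight (RAtm a) = 0"
| "rheight (RCst C) = 0"
| "rheight (RUnk X m) = Suc (Max (insert 0 (fmran' (fmmap rheight m))))"
| "rheight (RLam c \<phi> r) = Suc (rheight r)"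
| "rheight (RApp r s) = Suc (max (rheight r) (rheight s))"

lemma rheight_perm [simp]: "rheight (rperm \<pi> r) = rheight r"
proof (induction r arbitrary: \<pi>)
  case (RUnk X m)
  then have "fmmap (\<lambda>r. rheight (rperm \<pi> r)) m = fmmap rheight m"
    by (intro fmap.map_cong0) auto
  then show ?case by (simp add: fmap.map_comp comp_def del: fmran'_fmmap)
qed auto

lemma alpha_rheight: "alpha r s \<Longrightarrow> rheight r = rheight s"
proof (induction rule: alpha.induct)
  case (alpha_Unk m m' X)
  then have "fmmap rheight m = fmmap rheight m'"
    by (subst fmap.rel_eq[symmetric]) (auto simp: fmap.rel_map elim: fmap.rel_mono_strong)
  then show ?case by simp
next
  case (alpha_Lam L c r d s \<phi>)
  obtain e where "e \<notin> L"
    using ex_new_if_finite[OF infinite_UNIV_uatom alpha_Lam(1)] by blast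
  then show ?case using alpha_Lam.IH by simp
qed auto

quotient_type ('b, 'c, 'v) trm = "('b, 'c, 'v) raw" / alpha
  by (intro equivpI reflpI sympI transpI) (fact alpha_refl, erule alpha_sym, erule (1) alpha_trans)

lift_definition Atm :: "atom \<Rightarrow> ('b, 'c, 'v) trm" is RAtm .
lift_definition Cst :: "'c \<Rightarrow> ('b, 'c, 'v) trm" is RCst .
lift_definition Unk :: "'v \<Rightarrow> (datom, ('b, 'c, 'v) trm) fmap \<Rightarrow> ('b, 'c, 'v) trm" is RUnk
  by (rule alpha_Unk)
lift_definition Lam :: "uatom \<Rightarrow> 'b ty \<Rightarrow> ('b, 'c, 'v) trm \<Rightarrow> ('b, 'c, 'v) trm" is RLam
  by (rule alpha_Lam[of "{}"]) (simp_all add: alpha_perm)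
lift_definition App :: "('b, 'c, 'v) trm \<Rightarrow> ('b, 'c, 'v) trm \<Rightarrow> ('b, 'c, 'v) trm" is RApp
  by (rule alpha_App)

lift_definition tperm :: "uatom perm \<Rightarrow> ('b, 'c, 'v) trm \<Rightarrow> ('b, 'c, 'v) trm" is rperm
  by (rule alpha_perm)
lift_definition free :: "('b, 'c, 'v) trm \<Rightarrow> uatom set" is rfree
  by (rule alpha_rfree)
lift_definition height :: "('b, 'c, 'v) trm \<Rightarrow> nat" is rheight
  by (rule alpha_rheight)

lemma abs_fmap_exhaust:
  fixes m :: "(datom, ('b, 'c, 'v) trm) fmap"
  obtains n where "m = fmmap abs_trm n"
proof
  show "m = fmmap abs_trm (fmmap rep_trm m)"
    by (simp add: fmap.map_comp comp_def Quotient3_abs_rep[OF Quotient3_trm] fmap.map_ident)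
qed

lemma Unk_abs: "Unk X (fmmap abs_trm n) = abs_trm (RUnk X n)"
  by (rule Unk.abs_eq) (auto intro: fmap.rel_refl alpha_refl)

lemmas trm_abs = Atm.abs_eq Cst.abs_eq Unk_abs Lam.abs_eq App.abs_eq

lemma trm_distinct [simp]:
  "Atm a \<noteq> Cst C" "Atm a \<noteq> Unk X m" "Atm a \<noteq> Lam c \<phi> r" "Atm a \<noteq> App r s"
  "Cst C \<noteq> Unk X m" "Cst C \<noteq> Lam c \<phi> r" "Cst C \<noteq> App r s"
  "Unk X m \<noteq> Lam c \<phi> r" "Unk X m \<noteq> App r s" "Lam c \<phi> r \<noteq> App s s'"
proof -
  have ex: "\<exists>u. t = abs_trm u" for t :: "('x, 'y, 'z) trm"
    by (metis Quotient3_abs_rep[OF Quotient3_trm])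
  obtain n u v v' where "m = fmmap abs_trm n" "r = abs_trm u" "s = abs_trm v" "s' = abs_trm v'"
    using ex by (metis abs_fmap_exhaust)
  note * = this trm_abs trm.abs_eq_iff
  show "Atm a \<noteq> Cst C" unfolding * by (auto elim: alpha_AtmE)
  show "Atm a \<noteq> Unk X m" unfolding * by (auto elim: alpha_AtmE)
  show "Atm a \<noteq> Lam c \<phi> r" unfolding * by (auto elim: alpha_AtmE)
  show "Atm a \<noteq> App r s" unfolding * by (auto elim: alpha_AtmE)
  show "Cst C \<noteq> Unk X m" unfolding * by (auto elim: alpha_CstE)
  show "Cst C \<noteq> Lam c \<phi> r" unfolding * by (auto elim: alpha_CstE)
  show "Cst C \<noteq> App r s" unfolding * by (auto elim: alpha_CstE)
  show "Unk X m \<noteq> Lam c \<phi> r" unfolding * by (auto elim: alpha_UnkE)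
  show "Unk X m \<noteq> App r s" unfolding * by (auto elim: alpha_UnkE)
  show "Lam c \<phi> r \<noteq> App s s'" unfolding * by (auto elim: alpha_LamE)
qed

lemmas trm_distinct' [simp] = trm_distinct[symmetric]

lemma Unk_inject: "Unk X m = Unk Y m' \<longleftrightarrow> X = Y \<and> m = m'"
proof -
  obtain n n' where m: "m = fmmap abs_trm n" "m' = fmmap abs_trm n'"
    by (metis abs_fmap_exhaust)
  have "fmmap abs_trm n = fmmap abs_trm n' \<longleftrightarrow> fmrel alpha n n'"
    by (subst fmap.rel_eq[symmetric]) (simp add: fmap.rel_map trm.abs_eq_iff)
  then show ?thesis
    unfolding m Unk_abs trm.abs_eq_iff by (auto elim: alpha_UnkE intro: alpha_Unk)
qed

lemma trm_inject [simp]: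
  "Atm a = Atm b \<longleftrightarrow> a = b"
  "Cst C = Cst C' \<longleftrightarrow> C = C'"
  "Unk X m = Unk Y m' \<longleftrightarrow> X = Y \<and> m = m'"
  "App r s = App r' s' \<longleftrightarrow> r = r' \<and> s = s'"
proof -
  show "Atm a = Atm b \<longleftrightarrow> a = b"
    by transfer (auto elim: alpha_AtmE intro: alpha_Atm)
  show "Cst C = Cst C' \<longleftrightarrow> C = C'"
    by transfer (auto elim: alpha_CstE intro: alpha_Cst)
  show "Unk X m = Unk Y m' \<longleftrightarrow> X = Y \<and> m = m'"
    by (rule Unk_inject)
  show "App r s = App r' s' \<longleftrightarrow> r = r' \<and> s = s'"
    by transfer (auto elim: alpha_AppE intro: alpha_App)
qed

lemma trm_exhaust:
  obtains (Atm) a where "t = Atm a" | (Cst) C where "t = Cst C" | (Unk) X m where "t = Unk X m"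
    | (Lam) c \<phi> r where "t = Lam c \<phi> r" | (App) r s where "t = App r s"
proof -
  have "t = abs_trm (rep_trm t)"
    by (simp add: Quotient3_abs_rep[OF Quotient3_trm])
  then show thesis
    using that
    by (cases "rep_trm t") (metis trm_abs)+
qed

lemma free_simps [simp]:
  "free (Atm a) = {c. a = U c}"
  "free (Cst C) = {}"
  "free (Unk X m) = \<Union> (free ` fmran' m)"
  "free (Lam c \<phi> r) = free r - {c}"
  "free (App r s) = free r \<union> free s"
proof -
  obtain n where m: "m = fmmap abs_trm n" by (rule abs_fmap_exhaust)
  show "free (Unk X m) = \<Union> (free ` fmran' m)"
    unfolding m Unk_abs free.abs_eq by (simp add: free.abs_eq)
qed (transfer; simp)+

lemma tperm_simps [simp]:
  "tperm \<pi> (Atm a) = Atm (aperm \<pi> a)"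
  "tperm \<pi> (Cst C) = Cst C"
  "tperm \<pi> (Unk X m) = Unk X (fmmap (tperm \<pi>) m)"
  "tperm \<pi> (Lam c \<phi> r) = Lam (apply \<pi> c) \<phi> (tperm \<pi> r)"
  "tperm \<pi> (App r s) = App (tperm \<pi> r) (tperm \<pi> s)"
proof -
  obtain n where m: "m = fmmap abs_trm n" by (rule abs_fmap_exhaust)
  show "tperm \<pi> (Unk X m) = Unk X (fmmap (tperm \<pi>) m)"
    unfolding m Unk_abs tperm.abs_eq
    by (simp add: fmap.map_comp comp_def tperm.abs_eq Unk_abs[symmetric])
qed (transfer; simp only: rperm.simps; rule alpha_refl)+

lemma tperm_1 [simp]: "tperm 1 t = t"
  by transfer (simp add: alpha_refl)

lemma tperm_times: "tperm (\<pi> * \<pi>') t = tperm \<pi> (tperm \<pi>' t)"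
  by transfer (simp add: rperm_times alpha_refl)

lemma free_tperm: "free (tperm \<pi> t) = apply \<pi> ` free t"
  by transfer (rule rfree_perm)

lemma finite_free [simp]: "finite (free t)"
  by transfer (rule finite_rfree)

lemma tperm_agree: "(\<And>c. c \<in> free t \<Longrightarrow> apply \<pi> c = apply \<pi>' c) \<Longrightarrow> tperm \<pi> t = tperm \<pi>' t"
  by transfer (rule alpha_perm_agree)

lemma height_tperm [simp]: "height (tperm \<pi> t) = height t"
  by transfer (rule rheight_perm)

lemma height_simps:
  "height (Lam c \<phi> r) = Suc (height r)"
  "height (App r s) = Suc (max (height r) (height s))"
  by (transfer; simp)+

lemma height_Unk: "s \<in> fmran' m \<Longrightarrow> height s < height (Unk X m)"
proof -
  assume s: "s \<in> fmran' m"
  obtain n where m: "m = fmmap abs_trm n" by (rule abs_fmap_exhaust)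
  have "height (Unk X m) = Suc (Max (insert 0 (fmran' (fmmap height m))))"
    unfolding m Unk_abs height.abs_eq by (simp add: height.abs_eq image_image)
  moreover have "height s \<le> Max (insert 0 (fmran' (fmmap height m)))"
    using s by (intro Max_ge) (auto simp: fmran'_alt_def)
  ultimately show ?thesis by simp
qed

lemma Lam_eq_fresh:
  assumes "finite L" and eq: "\<And>e. e \<notin> L \<Longrightarrow> tperm (Perm.swap e c) r = tperm (Perm.swap e d) s"
  shows "Lam c \<phi> r = Lam d \<phi> s"
proof -
  obtain u v where uv: "r = abs_trm u" "s = abs_trm v"
    by (metis Quotient3_abs_rep[OF Quotient3_trm])
  have "alpha (RLam c \<phi> u) (RLam d \<phi> v)"
    using \<open>finite L\<close> eq[unfolded uv tperm.abs_eq trm.abs_eq_iff] by (rule alpha_Lam)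
  then show ?thesis unfolding uv Lam.abs_eq trm.abs_eq_iff .
qed

lemma Lam_rename:
  assumes "d \<notin> free r"
  shows "Lam c \<phi> r = Lam d \<phi> (tperm (Perm.swap d c) r)"
proof (rule Lam_eq_fresh[of "{c, d} \<union> free r"])
  fix e assume "e \<notin> {c, d} \<union> free r"
  then show "tperm (Perm.swap e c) r = tperm (Perm.swap e d) (tperm (Perm.swap d c) r)"
    unfolding tperm_times[symmetric] using assms
    by (intro tperm_agree) (auto simp: apply_times Perm.swap.rep_eq transpose_def)
qed simp

lemma Lam_eqD:
  assumes "Lam c \<phi> r = Lam d \<psi> s"
  shows "\<phi> = \<psi>" "s = tperm (Perm.swap d c) r"
proof -
  have "\<phi> = \<psi> \<and> (\<exists>L. finite L \<and> (\<forall>e. e \<notin> L \<longrightarrow> tperm (Perm.swap e c) r = tperm (Perm.swap e d) s))"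
  proof -
    obtain u v where uv: "r = abs_trm u" "s = abs_trm v"
      by (metis Quotient3_abs_rep[OF Quotient3_trm])
    from assms have "alpha (RLam c \<phi> u) (RLam d \<psi> v)"
      unfolding uv Lam.abs_eq trm.abs_eq_iff .
    then show ?thesis
      unfolding uv tperm.abs_eq trm.abs_eq_iff
    proof (rule alpha_LamE)
      fix L d' s'
      assume "RLam d \<psi> v = RLam d' \<phi> s'" "finite L"
        "\<And>e. e \<notin> L \<Longrightarrow> alpha (rperm (Perm.swap e c) u) (rperm (Perm.swap e d') s')"
      then show "\<phi> = \<psi> \<and> (\<exists>L. finite L \<and>
        (\<forall>e. e \<notin> L \<longrightarrow> alpha (rperm (Perm.swap e c) u) (rperm (Perm.swap e d) v)))"
        by (intro conjI exI[of _ L]) simp_all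
    qed
  qed
  then obtain L where eq: "\<phi> = \<psi>" and L: "finite L"
    "\<And>e. e \<notin> L \<Longrightarrow> tperm (Perm.swap e c) r = tperm (Perm.swap e d) s" by auto
  have fr: "free r - {c} = free s - {d}" using arg_cong[OF assms, of free] by simp
  have "finite (L \<union> {c, d} \<union> free r \<union> free s)" using L by simp
  then obtain e where e: "e \<notin> L \<union> {c, d} \<union> free r \<union> free s"
    using ex_new_if_finite[OF infinite_UNIV_uatom, of "L \<union> {c, d} \<union> free r \<union> free s"] by auto
  then have "tperm (Perm.swap e d) (tperm (Perm.swap e c) r)
    = tperm (Perm.swap e d) (tperm (Perm.swap e d) s)" using L by simp
  also have "\<dots> = tperm 1 s"
    unfolding tperm_times[symmetric] by (rule tperm_agree) (simp add: apply_times Perm.swap.rep_eq)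
  also have "tperm (Perm.swap e d) (tperm (Perm.swap e c) r) = tperm (Perm.swap d c) r"
    unfolding tperm_times[symmetric]
  proof (rule tperm_agree)
    fix x assume "x \<in> free r"
    then have "x \<noteq> e" "x \<noteq> c \<longrightarrow> x \<noteq> d" using e fr by blast+
    then show "apply (Perm.swap e d * Perm.swap e c) x = apply (Perm.swap d c) x"
      by (simp add: apply_times Perm.swap.rep_eq transpose_def)
  qed
  finally show "s = tperm (Perm.swap d c) r" by simp
  show "\<phi> = \<psi>" by (fact eq)
qed

lemma Lam_inject [simp]: "Lam c \<phi> r = Lam c \<psi> s \<longleftrightarrow> \<phi> = \<psi> \<and> r = s"
  using Lam_eqD[of c \<phi> r c \<psi> s] by auto

text \<open>
  The outermost constructor of a term, as used in the recursive definitions below.  If the term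
  is an abstraction, \<open>layer_of A t\<close> presents it with an arbitrary bound atom outside the finite
  set \<open>A\<close>.
\<close>

datatype ('b, 'c, 'v) layer =
    LAtm atom
  | LCst 'c
  | LUnk 'v "(datom, ('b, 'c, 'v) trm) fmap"
  | LLam uatom "'b ty" "('b, 'c, 'v) trm"
  | LApp "('b, 'c, 'v) trm" "('b, 'c, 'v) trm"

primrec build :: "('b, 'c, 'v) layer \<Rightarrow> ('b, 'c, 'v) trm" where
  "build (LAtm a) = Atm a"
| "build (LCst C) = Cst C"
| "build (LUnk X m) = Unk X m"
| "build (LLam c \<phi> r) = Lam c \<phi> r"
| "build (LApp r s) = App r s"

definition layer_of :: "uatom set \<Rightarrow> ('b, 'c, 'v) trm \<Rightarrow> ('b, 'c, 'v) layer" where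
  "layer_of A t = (SOME l. build l = t \<and> (finite A \<longrightarrow> (\<forall>c \<phi> r. l = LLam c \<phi> r \<longrightarrow> c \<notin> A)))"

lemma layer_of_prop:
  "build (layer_of A t) = t \<and> (finite A \<longrightarrow> (\<forall>c \<phi> r. layer_of A t = LLam c \<phi> r \<longrightarrow> c \<notin> A))"
  unfolding layer_of_def
proof (rule someI_ex)
  show "\<exists>l. build l = t \<and> (finite A \<longrightarrow> (\<forall>c \<phi> r. l = LLam c \<phi> r \<longrightarrow> c \<notin> A))"
  proof (cases t rule: trm_exhaust)
    case (Lam c \<phi> r)
    show ?thesis
    proof (cases "finite A")
      case True
      then have "finite (A \<union> free r)" by simp
      then obtain d where d: "d \<notin> A \<union> free r"
        using ex_new_if_finite[OF infinite_UNIV_uatom] by blast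
      then have "build (LLam d \<phi> (tperm (Perm.swap d c) r)) = t"
        using Lam Lam_rename[of d r c \<phi>] by simp
      then show ?thesis using d by blast
    next
      case False
      then show ?thesis using Lam by (intro exI[of _ "LLam c \<phi> r"]) simp
    qed
  next
    case (Atm a) then show ?thesis by (auto intro!: exI[of _ "LAtm a"])
  next
    case (Cst C) then show ?thesis by (auto intro!: exI[of _ "LCst C"])
  next
    case (Unk X m) then show ?thesis by (auto intro!: exI[of _ "LUnk X m"])
  next
    case (App r s) then show ?thesis by (auto intro!: exI[of _ "LApp r s"])
  qed
qed

lemmas build_layer_of = layer_of_prop[THEN conjunct1]

lemma layer_of_simps [simp]:
  "layer_of A (Atm a) = LAtm a"
  "layer_of A (Cst C) = LCst C"
  "layer_of A (Unk X m) = LUnk X m"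
  "layer_of A (App r s) = LApp r s"
proof -
  show "layer_of A (Atm a) = LAtm a" (is "layer_of A ?t = _")
    using build_layer_of[of A ?t] by (cases "layer_of A ?t") simp_all
  show "layer_of A (Cst C) = LCst C" (is "layer_of A ?t = _")
    using build_layer_of[of A ?t] by (cases "layer_of A ?t") simp_all
  show "layer_of A (Unk X m) = LUnk X m" (is "layer_of A ?t = _")
    using build_layer_of[of A ?t] by (cases "layer_of A ?t") simp_all
  show "layer_of A (App r s) = LApp r s" (is "layer_of A ?t = _")
    using build_layer_of[of A ?t] by (cases "layer_of A ?t") simp_all
qed

lemma layer_of_Lam:
  assumes "finite A"
  obtains d s where "layer_of A (Lam c \<phi> r) = LLam d \<phi> s" "Lam c \<phi> r = Lam d \<phi> s" "d \<notin> A"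
proof -
  have "build (layer_of A (Lam c \<phi> r)) = Lam c \<phi> r" by (rule build_layer_of)
  then obtain d \<psi> s where l: "layer_of A (Lam c \<phi> r) = LLam d \<psi> s" "Lam d \<psi> s = Lam c \<phi> r"
    by (cases "layer_of A (Lam c \<phi> r)") auto
  moreover have "\<psi> = \<phi>" using Lam_eqD(1)[OF l(2)] .
  moreover have "d \<notin> A" using layer_of_prop[of A "Lam c \<phi> r"] l(1) assms by blast
  ultimately show thesis using that[of d s] by metis
qed

lemma height_layer:
  "layer_of A t = LUnk X m \<Longrightarrow> s \<in> fmran' m \<Longrightarrow> height s < height t"
  "layer_of A t = LLam c \<phi> r \<Longrightarrow> height r < height t"
  "layer_of A t = LApp r s \<Longrightarrow> height r < height t"
  "layer_of A t = LApp r s \<Longrightarrow> height s < height t"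
  using build_layer_of[of A t] by (auto simp: height_simps height_Unk)

section \<open>Substitution\<close>

lemma fmmap_fundef_cong [fundef_cong]:
  "m = n \<Longrightarrow> (\<And>x. x \<in> fmran' n \<Longrightarrow> f x = g x) \<Longrightarrow> fmmap f m = fmmap g n"
  by (rule fmap.map_cong)

definition dpart :: "(atom, 't) fmap \<Rightarrow> (datom, 't) fmap" where
  "dpart \<sigma> = Abs_fmap (\<lambda>b. fmlookup \<sigma> (D b))"

definition demb :: "(datom, 't) fmap \<Rightarrow> (atom, 't) fmap" where
  "demb m = Abs_fmap (\<lambda>a. case a of D b \<Rightarrow> fmlookup m b | U c \<Rightarrow> None)"

lemma fmlookup_dpart [simp]: "fmlookup (dpart \<sigma>) b = fmlookup \<sigma> (D b)"
proof -
  have "dom (\<lambda>b. fmlookup \<sigma> (D b)) = D -` dom (fmlookup \<sigma>)" by (auto simp: fmlookup_dom'_iff)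
  moreover have "finite (D -` dom (fmlookup \<sigma>))"
    by (rule finite_vimageI) (auto simp: inj_def)
  ultimately show ?thesis
    unfolding dpart_def by (subst Abs_fmap_inverse) simp_all
qed

lemma fmlookup_demb [simp]:
  "fmlookup (demb m) a = (case a of D b \<Rightarrow> fmlookup m b | U c \<Rightarrow> None)"
proof -
  have "dom (\<lambda>a. case a of D b \<Rightarrow> fmlookup m b | U c \<Rightarrow> None) \<subseteq> D ` dom (fmlookup m)"
    by (auto split: atom.splits intro!: imageI fmdom'I)
  then have "finite (dom (\<lambda>a. case a of D b \<Rightarrow> fmlookup m b | U c \<Rightarrow> None))"
    by (rule finite_subset) simp
  then show ?thesis
    unfolding demb_def by (subst Abs_fmap_inverse) simp_all
qed

text \<open>
  \<open>subst1 \<sigma> r\<close> is the level 1 substitution \<open>r[\<sigma>]\<close>, \<open>subst2 X t r\<close> the level 2 substitution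
  \<open>r[X := t]\<close>.  They go below an abstraction after choosing a fresh bound atom; \<open>subst1_Lam\<close> and
  \<open>subst2_Lam\<close> below show that the choice is immaterial.  In the clause of \<open>subst1\<close> for unknowns the
  right argument of \<open>++\<^sub>f\<close> takes precedence, and \<open>dpart\<close> discards the part of \<open>\<sigma>\<close> that is not on
  \<^typ>\<open>datom\<close>.
\<close>

definition subst1_atoms :: "(atom, ('b, 'c, 'v) trm) fmap \<Rightarrow> uatom set" where
  "subst1_atoms \<sigma> = {c. U c \<in> fmdom' \<sigma>} \<union> \<Union> (free ` fmran' \<sigma>)"

function subst1 :: "(atom, ('b, 'c, 'v) trm) fmap \<Rightarrow> ('b, 'c, 'v) trm \<Rightarrow> ('b, 'c, 'v) trm" where
  "subst1 \<sigma> t = (case layer_of (subst1_atoms \<sigma>) t of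
      LAtm a \<Rightarrow> (case fmlookup \<sigma> a of Some s \<Rightarrow> s | None \<Rightarrow> Atm a)
    | LCst C \<Rightarrow> Cst C
    | LUnk X m \<Rightarrow> Unk X (dpart \<sigma> ++\<^sub>f fmmap (subst1 \<sigma>) m)
    | LLam c \<phi> r \<Rightarrow> Lam c \<phi> (subst1 \<sigma> r)
    | LApp r s \<Rightarrow> App (subst1 \<sigma> r) (subst1 \<sigma> s))"
  by auto
termination
  by (relation "measure (\<lambda>(\<sigma>, t). height t)") (auto simp: height_layer)

declare subst1.simps [simp del]

function subst2 :: "'v \<Rightarrow> ('b, 'c, 'v) trm \<Rightarrow> ('b, 'c, 'v) trm \<Rightarrow> ('b, 'c, 'v) trm" where
  "subst2 X t r = (case layer_of (free t) r of
      LAtm a \<Rightarrow> Atm a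
    | LCst C \<Rightarrow> Cst C
    | LUnk Y m \<Rightarrow>
        if Y = X then subst1 (demb (fmmap (subst2 X t) m)) t else Unk Y (fmmap (subst2 X t) m)
    | LLam c \<phi> s \<Rightarrow> Lam c \<phi> (subst2 X t s)
    | LApp s s' \<Rightarrow> App (subst2 X t s) (subst2 X t s'))"
  by auto
termination
  by (relation "measure (\<lambda>(X, t, r). height r)") (auto simp: height_layer)

declare subst2.simps [simp del]

lemma finite_subst1_atoms: "finite (subst1_atoms \<sigma>)"
proof -
  have "finite (U -` fmdom' \<sigma>)"
    by (rule finite_vimageI) (auto simp: inj_def)
  then show ?thesis
    by (auto simp: subst1_atoms_def vimage_def fmran'_alt_def)
qed

lemma subst1_simps [simp]:
  "subst1 \<sigma> (Atm a) = (case fmlookup \<sigma> a of Some s \<Rightarrow> s | None \<Rightarrow> Atm a)"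
  "subst1 \<sigma> (Cst C) = Cst C"
  "subst1 \<sigma> (Unk X m) = Unk X (dpart \<sigma> ++\<^sub>f fmmap (subst1 \<sigma>) m)"
  "subst1 \<sigma> (App r s) = App (subst1 \<sigma> r) (subst1 \<sigma> s)"
  by (subst subst1.simps, simp)+

lemma subst2_simps [simp]:
  "subst2 X t (Atm a) = Atm a"
  "subst2 X t (Cst C) = Cst C"
  "subst2 X t (Unk X m) = subst1 (demb (fmmap (subst2 X t) m)) t"
  "Y \<noteq> X \<Longrightarrow> subst2 X t (Unk Y m) = Unk Y (fmmap (subst2 X t) m)"
  "subst2 X t (App r s) = App (subst2 X t r) (subst2 X t s)"
  by (subst subst2.simps, simp)+

lemma fmran'_add: "fmran' (m ++\<^sub>f n) \<subseteq> fmran' m \<union> fmran' n"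
  by (auto simp: fmlookup_ran'_iff split: if_splits)

lemma free_subst1: "free (subst1 \<sigma> t) \<subseteq> free t \<union> \<Union> (free ` fmran' \<sigma>)"
proof (induction "height t" arbitrary: t rule: less_induct)
  case less
  show ?case
  proof (cases t rule: trm_exhaust)
    case (Atm a)
    then show ?thesis by (auto split: option.splits intro: fmran'I)
  next
    case (Cst C)
    then show ?thesis by simp
  next
    case (Unk X m)
    show ?thesis
    proof
      fix c assume "c \<in> free (subst1 \<sigma> t)"
      then obtain s where s: "s \<in> fmran' (dpart \<sigma> ++\<^sub>f fmmap (subst1 \<sigma>) m)" "c \<in> free s"
        using Unk by auto
      from s(1) fmran'_add consider "s \<in> fmran' (dpart \<sigma>)" | "s \<in> fmran' (fmmap (subst1 \<sigma>) m)"
        by fastforce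
      then show "c \<in> free t \<union> \<Union> (free ` fmran' \<sigma>)"
      proof cases
        case 1
        then have "s \<in> fmran' \<sigma>" by (auto simp: fmlookup_ran'_iff)
        then show ?thesis using s(2) by blast
      next
        case 2
        then obtain u where u: "u \<in> fmran' m" "s = subst1 \<sigma> u" by auto
        then have "free s \<subseteq> free u \<union> \<Union> (free ` fmran' \<sigma>)"
          using less.hyps[of u] height_Unk[of u m X] Unk by simp
        then show ?thesis using s(2) u(1) Unk by auto
      qed
    qed
  next
    case (Lam c \<phi> r)
    obtain d s where l: "layer_of (subst1_atoms \<sigma>) t = LLam d \<phi> s" "t = Lam d \<phi> s"
      using layer_of_Lam[OF finite_subst1_atoms] Lam by metis
    then have "free (subst1 \<sigma> s) \<subseteq> free s \<union> \<Union> (free ` fmran' \<sigma>)"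
      using less.hyps[of s] by (simp add: height_simps)
    then show ?thesis using l by (subst subst1.simps) auto
  next
    case (App r s)
    then show ?thesis using less.hyps[of r] less.hyps[of s] by (fastforce simp: height_simps)
  qed
qed

lemma subst1_tperm:
  assumes "\<And>a. fmlookup \<sigma>' (aperm \<pi> a) = map_option (tperm \<pi>) (fmlookup \<sigma> a)"
  shows "subst1 \<sigma>' (tperm \<pi> t) = tperm \<pi> (subst1 \<sigma> t)"
  using assms
proof (induction "height t" arbitrary: t \<pi> rule: less_induct)
  case less
  show ?case
  proof (cases t rule: trm_exhaust)
    case (Atm a)
    then show ?thesis using less.prems[of a] by (auto split: option.splits)
  next
    case (Cst C)
    then show ?thesis by simp
  next
    case (Unk X m)
    have "fmmap (\<lambda>s. subst1 \<sigma>' (tperm \<pi> s)) m = fmmap (\<lambda>s. tperm \<pi> (subst1 \<sigma> s)) m"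
    proof (rule fmap.map_cong0)
      fix z assume "z \<in> fmran' m"
      then have "height z < height t" using height_Unk Unk by simp
      then show "subst1 \<sigma>' (tperm \<pi> z) = tperm \<pi> (subst1 \<sigma> z)"
        using less.prems by (rule less.hyps)
    qed
    moreover have "dpart \<sigma>' = fmmap (tperm \<pi>) (dpart \<sigma>)"
      using less.prems[of "D _"] by (intro fmap_ext) simp
    ultimately show ?thesis using Unk by (simp add: fmap.map_comp comp_def)
  next
    case (Lam c0 \<phi> r0)
    obtain c r where l: "layer_of (subst1_atoms \<sigma>) t = LLam c \<phi> r" "t = Lam c \<phi> r"
      and c: "c \<notin> subst1_atoms \<sigma>"
      using layer_of_Lam[OF finite_subst1_atoms] Lam by metis
    have pt: "tperm \<pi> t = Lam (apply \<pi> c) \<phi> (tperm \<pi> r)" using l by simp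
    obtain d s where l': "layer_of (subst1_atoms \<sigma>') (tperm \<pi> t) = LLam d \<phi> s"
      "tperm \<pi> t = Lam d \<phi> s" and d: "d \<notin> subst1_atoms \<sigma>'"
      using layer_of_Lam[OF finite_subst1_atoms] pt by metis
    let ?\<rho> = "Perm.swap d (apply \<pi> c) * \<pi>"
    have s: "s = tperm ?\<rho> r"
      using Lam_eqD(2)[of "apply \<pi> c" \<phi> "tperm \<pi> r" d \<phi> s] pt l' by (simp add: tperm_times)
    have ran: "tperm \<pi> u \<in> fmran' \<sigma>'" if "u \<in> fmran' \<sigma>" for u
      using that less.prems by (auto simp: fmlookup_ran'_iff) (metis option.simps(9))
    have agree: "tperm ?\<rho> u = tperm \<pi> u" if u: "u \<in> fmran' \<sigma>" for u
    proof (rule tperm_agree)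
      fix x assume x: "x \<in> free u"
      have "x \<noteq> c" using c x u by (auto simp: subst1_atoms_def)
      moreover have "apply \<pi> x \<in> free (tperm \<pi> u)" using x by (simp add: free_tperm)
      then have "apply \<pi> x \<noteq> d" using d ran[OF u] by (auto simp: subst1_atoms_def)
      ultimately show "apply ?\<rho> x = apply \<pi> x"
        by (simp add: apply_times Perm.swap.rep_eq transpose_def apply_inj)
    qed
    have "fmlookup \<sigma>' (aperm ?\<rho> a) = map_option (tperm ?\<rho>) (fmlookup \<sigma> a)" for a
    proof -
      have "fmlookup \<sigma>' (aperm ?\<rho> a) = fmlookup \<sigma>' (aperm \<pi> a)"
      proof (cases a)
        case (U x)
        have "fmlookup \<sigma> (U c) = None" "fmlookup \<sigma>' (U d) = None"
          using c d by (auto simp: subst1_atoms_def fmlookup_dom'_iff)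
        moreover from this have "fmlookup \<sigma>' (U (apply \<pi> c)) = None"
          using less.prems[of "U c"] by simp
        ultimately show ?thesis
          using U by (simp add: apply_times Perm.swap.rep_eq transpose_def)
      qed simp
      also have "\<dots> = map_option (tperm ?\<rho>) (fmlookup \<sigma> a)"
        unfolding less.prems
        by (cases "fmlookup \<sigma> a") (simp_all add: agree fmran'I)
      finally show ?thesis .
    qed
    then have IH: "subst1 \<sigma>' s = tperm ?\<rho> (subst1 \<sigma> r)"
      unfolding s using l by (intro less.hyps) (simp_all add: height_simps)
    have "Lam d \<phi> (subst1 \<sigma>' s) = Lam (apply \<pi> c) \<phi> (tperm \<pi> (subst1 \<sigma> r))"
    proof (cases "d = apply \<pi> c")
      case True
      then show ?thesis using IH by simp
    next
      case False
      have "free (tperm \<pi> r) - {apply \<pi> c} = free s - {d}"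
        using arg_cong[of _ _ free, OF pt] l' by simp
      then have "d \<notin> free (tperm \<pi> r)" using False by blast
      moreover have "d \<notin> free (tperm \<pi> u)" if "u \<in> fmran' \<sigma>" for u
        using ran[OF that] d by (auto simp: subst1_atoms_def)
      ultimately have "d \<notin> free (tperm \<pi> (subst1 \<sigma> r))"
        using image_mono[OF free_subst1[of \<sigma> r], of "apply \<pi>"]
        by (simp add: free_tperm image_Un image_UN) blast
      from Lam_rename[OF this, of "apply \<pi> c" \<phi>] show ?thesis
        using IH by (simp add: tperm_times)
    qed
    then show ?thesis
      using l l' by (subst (1 2) subst1.simps) simp
  next
    case (App r s)
    then show ?thesis using less by (simp add: height_simps)
  qed
qed

lemma tperm_fixes: "(\<And>c. c \<in> free t \<Longrightarrow> apply \<pi> c = c) \<Longrightarrow> tperm \<pi> t = t"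
  using tperm_agree[of t \<pi> 1] by simp

lemma subst1_Lam:
  assumes c: "U c \<notin> fmdom' \<sigma>" "\<And>s. s \<in> fmran' \<sigma> \<Longrightarrow> c \<notin> free s"
  shows "subst1 \<sigma> (Lam c \<phi> r) = Lam c \<phi> (subst1 \<sigma> r)"
proof -
  obtain d s where l: "layer_of (subst1_atoms \<sigma>) (Lam c \<phi> r) = LLam d \<phi> s"
    "Lam c \<phi> r = Lam d \<phi> s" and d: "d \<notin> subst1_atoms \<sigma>"
    using layer_of_Lam[OF finite_subst1_atoms] by metis
  have c': "c \<notin> subst1_atoms \<sigma>" using c by (auto simp: subst1_atoms_def)
  have s: "s = tperm (Perm.swap d c) r" using Lam_eqD(2)[OF l(2)] .
  have "subst1 \<sigma> s = tperm (Perm.swap d c) (subst1 \<sigma> r)"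
    unfolding s
  proof (rule subst1_tperm)
    fix a
    have "aperm (Perm.swap d c) a = a" if "a \<in> fmdom' \<sigma> \<or> aperm (Perm.swap d c) a \<in> fmdom' \<sigma>"
      using that c' d by (cases a) (auto simp: subst1_atoms_def Perm.swap.rep_eq transpose_def split: if_splits)
    then have same: "fmlookup \<sigma> (aperm (Perm.swap d c) a) = fmlookup \<sigma> a"
      by (metis fmdom'_notD)
    have "tperm (Perm.swap d c) u = u" if "u \<in> fmran' \<sigma>" for u
      using that c' d
      by (intro tperm_fixes) (auto simp: subst1_atoms_def Perm.swap.rep_eq transpose_def)
    then show "fmlookup \<sigma> (aperm (Perm.swap d c) a)
        = map_option (tperm (Perm.swap d c)) (fmlookup \<sigma> a)"
      unfolding same by (cases "fmlookup \<sigma> a") (simp_all add: fmran'I)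
  qed
  then have "subst1 \<sigma> (Lam c \<phi> r) = Lam d \<phi> (tperm (Perm.swap d c) (subst1 \<sigma> r))"
    using l(1) by (subst subst1.simps) simp
  also have "\<dots> = Lam c \<phi> (subst1 \<sigma> r)"
  proof (cases "d = c")
    case False
    have "free r - {c} = free s - {d}" using arg_cong[OF l(2), of free] by simp
    then have "d \<notin> free r" using False by blast
    then have "d \<notin> free (subst1 \<sigma> r)"
      using free_subst1[of \<sigma> r] d by (auto simp: subst1_atoms_def)
    then show ?thesis using Lam_rename by metis
  qed simp
  finally show ?thesis .
qed

lemma free_subst2: "free (subst2 X t r) \<subseteq> free r \<union> free t"
proof (induction "height r" arbitrary: r rule: less_induct)
  case less
  show ?case
  proof (cases r rule: trm_exhaust)
    case (Unk Y m)
    have IH: "free (subst2 X t s) \<subseteq> free r \<union> free t" if "s \<in> fmran' m" for s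
      using less.hyps[of s] height_Unk[OF that] Unk that by fastforce
    show ?thesis
    proof (cases "Y = X")
      case True
      let ?\<sigma> = "demb (fmmap (subst2 X t) m)"
      have "free u \<subseteq> free r \<union> free t" if "u \<in> fmran' ?\<sigma>" for u
      proof -
        obtain a where "fmlookup ?\<sigma> a = Some u" using \<open>u \<in> fmran' ?\<sigma>\<close> by (auto simp: fmlookup_ran'_iff)
        then obtain b where "fmlookup (fmmap (subst2 X t) m) b = Some u" by (cases a) simp_all
        then have "u \<in> subst2 X t ` fmran' m" by (metis fmran'I fmran'_fmmap)
        then show ?thesis using IH by blast
      qed
      then have "\<Union> (free ` fmran' ?\<sigma>) \<subseteq> free r \<union> free t" by (rule UN_least)
      then have "free t \<union> \<Union> (free ` fmran' ?\<sigma>) \<subseteq> free r \<union> free t" by simp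
      with free_subst1[of ?\<sigma> t] have "free (subst1 ?\<sigma> t) \<subseteq> free r \<union> free t" by (rule subset_trans)
      moreover have "subst2 X t r = subst1 ?\<sigma> t" using Unk True by simp
      ultimately show ?thesis by simp
    next
      case False
      then show ?thesis using Unk IH by auto
    qed
  next
    case (Lam c \<phi> s)
    obtain d u where l: "layer_of (free t) r = LLam d \<phi> u" "r = Lam d \<phi> u"
      using layer_of_Lam[OF finite_free] Lam by metis
    then have "free (subst2 X t u) \<subseteq> free u \<union> free t"
      using less.hyps[of u] by (simp add: height_simps)
    then show ?thesis using l by (subst subst2.simps) auto
  next
    case (App s s')
    then show ?thesis using less.hyps[of s] less.hyps[of s'] by (fastforce simp: height_simps)
  qed simp_all
qed

lemma subst2_tperm:
  assumes "\<And>c. c \<in> free t \<Longrightarrow> apply \<pi> c = c"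
  shows "subst2 X t (tperm \<pi> r) = tperm \<pi> (subst2 X t r)"
  using assms
proof (induction "height r" arbitrary: r \<pi> rule: less_induct)
  case less
  show ?case
  proof (cases r rule: trm_exhaust)
    case (Unk Y m)
    have eq: "fmmap (\<lambda>s. subst2 X t (tperm \<pi> s)) m = fmmap (\<lambda>s. tperm \<pi> (subst2 X t s)) m"
    proof (rule fmap.map_cong0)
      fix z assume "z \<in> fmran' m"
      then have "height z < height r" using height_Unk Unk by simp
      then show "subst2 X t (tperm \<pi> z) = tperm \<pi> (subst2 X t z)"
        using less.prems by (rule less.hyps)
    qed
    show ?thesis
    proof (cases "Y = X")
      case True
      have "subst1 (demb (fmmap (\<lambda>s. tperm \<pi> (subst2 X t s)) m)) (tperm \<pi> t)
          = tperm \<pi> (subst1 (demb (fmmap (subst2 X t) m)) t)"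
      proof (rule subst1_tperm)
        fix a
        show "fmlookup (demb (fmmap (\<lambda>s. tperm \<pi> (subst2 X t s)) m)) (aperm \<pi> a)
            = map_option (tperm \<pi>) (fmlookup (demb (fmmap (subst2 X t) m)) a)"
          by (cases a) (simp_all add: option.map_comp comp_def)
      qed
      moreover have "tperm \<pi> t = t" using less.prems by (rule tperm_fixes)
      ultimately show ?thesis
        using Unk True eq by (simp add: fmap.map_comp comp_def)
    next
      case False
      then show ?thesis using Unk eq by (simp add: fmap.map_comp comp_def)
    qed
  next
    case (Lam c0 \<phi> r0)
    obtain c s where l: "layer_of (free t) r = LLam c \<phi> s" "r = Lam c \<phi> s" and c: "c \<notin> free t"
      using layer_of_Lam[OF finite_free] Lam by metis
    have pr: "tperm \<pi> r = Lam (apply \<pi> c) \<phi> (tperm \<pi> s)" using l by simp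
    obtain d u where l': "layer_of (free t) (tperm \<pi> r) = LLam d \<phi> u"
      "tperm \<pi> r = Lam d \<phi> u" and d: "d \<notin> free t"
      using layer_of_Lam[OF finite_free] pr by metis
    let ?\<rho> = "Perm.swap d (apply \<pi> c) * \<pi>"
    have u: "u = tperm ?\<rho> s"
      using Lam_eqD(2)[of "apply \<pi> c" \<phi> "tperm \<pi> s" d \<phi> u] pr l' by (simp add: tperm_times)
    have "apply ?\<rho> x = x" if x: "x \<in> free t" for x
    proof -
      have "apply \<pi> x = x" using less.prems x .
      moreover have "apply \<pi> x \<noteq> apply \<pi> c" using x c by (auto simp: apply_inj)
      moreover have "x \<noteq> d" using x d by auto
      ultimately show ?thesis by (simp add: apply_times Perm.swap.rep_eq transpose_def)
    qed
    then have IH: "subst2 X t u = tperm ?\<rho> (subst2 X t s)"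
      unfolding u using l by (intro less.hyps) (simp_all add: height_simps)
    have "Lam d \<phi> (subst2 X t u) = Lam (apply \<pi> c) \<phi> (tperm \<pi> (subst2 X t s))"
    proof (cases "d = apply \<pi> c")
      case True
      then show ?thesis using IH by simp
    next
      case False
      have "free (tperm \<pi> s) - {apply \<pi> c} = free u - {d}"
        using arg_cong[of _ _ free, OF pr] l' by simp
      then have "d \<notin> free (tperm \<pi> s)" using False by blast
      moreover have "d \<notin> apply \<pi> ` free t" using d less.prems by auto
      ultimately have "d \<notin> free (tperm \<pi> (subst2 X t s))"
        using free_subst2[of X t s] by (auto simp: free_tperm)
      from Lam_rename[OF this, of "apply \<pi> c" \<phi>] show ?thesis
        using IH by (simp add: tperm_times)
    qed
    then show ?thesis
      using l l' by (subst (1 2) subst2.simps) simp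
  next
    case (App s s')
    then show ?thesis using less by (simp add: height_simps)
  qed simp_all
qed

lemma subst2_Lam:
  assumes c: "c \<notin> free t"
  shows "subst2 X t (Lam c \<phi> r) = Lam c \<phi> (subst2 X t r)"
proof -
  obtain d s where l: "layer_of (free t) (Lam c \<phi> r) = LLam d \<phi> s"
    "Lam c \<phi> r = Lam d \<phi> s" and d: "d \<notin> free t"
    using layer_of_Lam[OF finite_free] by metis
  have s: "s = tperm (Perm.swap d c) r" using Lam_eqD(2)[OF l(2)] .
  have "subst2 X t s = tperm (Perm.swap d c) (subst2 X t r)"
    unfolding s using c d
    by (intro subst2_tperm) (auto simp: Perm.swap.rep_eq transpose_def)
  then have "subst2 X t (Lam c \<phi> r) = Lam d \<phi> (tperm (Perm.swap d c) (subst2 X t r))"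
    using l(1) by (subst subst2.simps) simp
  also have "\<dots> = Lam c \<phi> (subst2 X t r)"
  proof (cases "d = c")
    case False
    have "free r - {c} = free s - {d}" using arg_cong[OF l(2), of free] by simp
    then have "d \<notin> free r" using False by blast
    then have "d \<notin> free (subst2 X t r)"
      using free_subst2[of X t r] d by auto
    then show ?thesis using Lam_rename by metis
  qed simp
  finally show ?thesis .
qed

section \<open>Type environments and typing\<close>

datatype 'v name = Atom atom | Unknown 'v

type_synonym ('b, 'v) env = "('v name \<times> 'b ty) set"

text \<open>
  A type environment is a functional set of typings.  Only finitely many atoms may be typed, so
  that fresh atoms are always available; no finiteness is required of the typed unknowns.
  The extension of \<open>\<Gamma>\<close> by a typing is the set \<open>insert _ \<Gamma>\<close>, wherever this is again a type
  environment.
\<close>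

definition tenv :: "('b, 'v) env \<Rightarrow> bool" where
  "tenv \<Gamma> \<longleftrightarrow> single_valued \<Gamma> \<and> finite {a. Atom a \<in> Domain \<Gamma>}"

definition atom_type :: "('b, 'v) env \<Rightarrow> atom \<Rightarrow> 'b ty" where
  "atom_type \<Gamma> a = (THE \<phi>. (Atom a, \<phi>) \<in> \<Gamma>)"

text \<open>
  Derivable judgements only involve type environments.  In particular the premise of
  \<open>typing_Lam\<close> entails that \<open>insert (Atom (U c), \<phi>) \<Gamma>\<close> is functional.
\<close>

inductive typing :: "('c \<Rightarrow> 'b ty) \<Rightarrow> ('b, 'v) env \<Rightarrow> ('b, 'c, 'v) trm \<Rightarrow> 'b ty \<Rightarrow> bool"
  for ctype :: "'c \<Rightarrow> 'b ty" where
  typing_Atm: "\<lbrakk>tenv \<Gamma>; (Atom a, \<phi>) \<in> \<Gamma>\<rbrakk> \<Longrightarrow> typing ctype \<Gamma> (Atm a) \<phi>"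
| typing_Cst: "tenv \<Gamma> \<Longrightarrow> typing ctype \<Gamma> (Cst C) (ctype C)"
| typing_Lam: "typing ctype (insert (Atom (U c), \<phi>) \<Gamma>) r \<psi> \<Longrightarrow> typing ctype \<Gamma> (Lam c \<phi> r) (\<phi> \<rightarrow>\<^sub>t \<psi>)"
| typing_App: "\<lbrakk>typing ctype \<Gamma> r (\<phi> \<rightarrow>\<^sub>t \<psi>); typing ctype \<Gamma> s \<phi>\<rbrakk> \<Longrightarrow> typing ctype \<Gamma> (App r s) \<psi>"
| typing_Unk: "\<lbrakk>tenv \<Gamma>; (Unknown X, \<phi>) \<in> \<Gamma>;
    \<And>b s. fmlookup m b = Some s \<Longrightarrow> \<exists>\<psi>. (Atom (D b), \<psi>) \<in> \<Gamma> \<and> typing ctype \<Gamma> s \<psi>\<rbrakk>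
    \<Longrightarrow> typing ctype \<Gamma> (Unk X m) \<phi>"

section \<open>Models\<close>

primrec name_perm :: "atom perm \<Rightarrow> 'v name \<Rightarrow> 'v name" where
  "name_perm \<pi> (Atom a) = Atom (apply \<pi> a)"
| "name_perm \<pi> (Unknown X) = Unknown X"

definition env_perm :: "atom perm \<Rightarrow> ('b, 'v) env \<Rightarrow> ('b, 'v) env" where
  "env_perm \<pi> \<Gamma> = (\<lambda>(x, \<phi>). (name_perm \<pi> x, \<phi>)) ` \<Gamma>"

text \<open>
  The elements of a model are taken from a type \<open>'e\<close> with a permutation action.  Abstraction and
  application are total functions on \<open>'e\<close>, constrained on the sets \<open>\<I>\<^sub>\<Gamma>(\<phi>)\<close> only.
\<close>

record ('b, 'c, 'v, 'e) model =
  action :: "atom perm \<Rightarrow> 'e \<Rightarrow> 'e"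
  carrier :: "('b, 'v) env \<Rightarrow> 'b ty \<Rightarrow> 'e set"
  atom_elt :: "atom \<Rightarrow> 'b ty \<Rightarrow> 'e"
  const_elt :: "'c \<Rightarrow> 'e"
  abstr :: "atom \<Rightarrow> 'b ty \<Rightarrow> 'e \<Rightarrow> 'e"
  applic :: "'e \<Rightarrow> 'e \<Rightarrow> 'e"

definition fresh :: "('b, 'c, 'v, 'e) model \<Rightarrow> atom \<Rightarrow> 'e \<Rightarrow> bool" where
  "fresh M a x \<longleftrightarrow> a \<notin> supp (action M) x"

text \<open>\<open>esubst M a \<phi> x y\<close> is \<open>x[a \<mapsto> y]\<close>, for an atom \<open>a\<close> of type \<open>\<phi>\<close>.\<close>

definition esubst :: "('b, 'c, 'v, 'e) model \<Rightarrow> atom \<Rightarrow> 'b ty \<Rightarrow> 'e \<Rightarrow> 'e \<Rightarrow> 'e" where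
  "esubst M a \<phi> x y = applic M (abstr M a \<phi> x) y"

locale nominal_model =
  fixes ctype :: "'c \<Rightarrow> 'b ty" and M :: "('b, 'c, 'v, 'e) model"
  assumes action: "perm_action (action M)"
    and carrier_finitely_supported:
      "tenv \<Gamma> \<Longrightarrow> finitely_supported (\<lambda>\<pi> S. action M \<pi> ` S) (carrier M \<Gamma> \<phi>)"
    and atom_elt_in: "\<lbrakk>tenv \<Gamma>; (Atom a, \<phi>) \<in> \<Gamma>\<rbrakk> \<Longrightarrow> atom_elt M a \<phi> \<in> carrier M \<Gamma> \<phi>"
    and const_elt_in: "tenv \<Gamma> \<Longrightarrow> const_elt M C \<in> carrier M \<Gamma> (ctype C)"
    and abstr_in: "\<lbrakk>tenv (insert (Atom a, \<phi>) \<Gamma>); x \<in> carrier M (insert (Atom a, \<phi>) \<Gamma>) \<psi>\<rbrakk>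
      \<Longrightarrow> abstr M a \<phi> x \<in> carrier M \<Gamma> (\<phi> \<rightarrow>\<^sub>t \<psi>)"
    and applic_in: "\<lbrakk>tenv \<Gamma>; x \<in> carrier M \<Gamma> (\<phi> \<rightarrow>\<^sub>t \<psi>); y \<in> carrier M \<Gamma> \<phi>\<rbrakk>
      \<Longrightarrow> applic M x y \<in> carrier M \<Gamma> \<psi>"
    and carrier_Int: "\<lbrakk>tenv \<Gamma>; tenv \<Gamma>'\<rbrakk>
      \<Longrightarrow> carrier M (\<Gamma> \<inter> \<Gamma>') \<phi> = carrier M \<Gamma> \<phi> \<inter> carrier M \<Gamma>' \<phi>"
    and supp_carrier: "\<lbrakk>tenv \<Gamma>; x \<in> carrier M \<Gamma> \<phi>\<rbrakk> \<Longrightarrow> supp (action M) x \<subseteq> {a. Atom a \<in> Domain \<Gamma>}"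
    and carrier_atoms: "\<lbrakk>tenv \<Gamma>; tenv \<Gamma>'; \<And>a \<psi>. (Atom a, \<psi>) \<in> \<Gamma> \<longleftrightarrow> (Atom a, \<psi>) \<in> \<Gamma>'\<rbrakk>
      \<Longrightarrow> carrier M \<Gamma> \<phi> = carrier M \<Gamma>' \<phi>"
    and carrier_eqvt: "tenv \<Gamma> \<Longrightarrow> action M \<pi> ` carrier M \<Gamma> \<phi> = carrier M (env_perm \<pi> \<Gamma>) \<phi>"
    and atom_elt_eqvt: "action M \<pi> (atom_elt M a \<phi>) = atom_elt M (apply \<pi> a) \<phi>"
    and const_elt_eqvt: "action M \<pi> (const_elt M C) = const_elt M C"
    and abstr_eqvt: "\<lbrakk>tenv (insert (Atom a, \<phi>) \<Gamma>); x \<in> carrier M (insert (Atom a, \<phi>) \<Gamma>) \<psi>\<rbrakk>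
      \<Longrightarrow> action M \<pi> (abstr M a \<phi> x) = abstr M (apply \<pi> a) \<phi> (action M \<pi> x)"
    and applic_eqvt: "\<lbrakk>tenv \<Gamma>; x \<in> carrier M \<Gamma> (\<phi> \<rightarrow>\<^sub>t \<psi>); y \<in> carrier M \<Gamma> \<phi>\<rbrakk>
      \<Longrightarrow> action M \<pi> (applic M x y) = applic M (action M \<pi> x) (action M \<pi> y)"
    and esubst_atom: "\<lbrakk>tenv (insert (Atom a, \<phi>) \<Gamma>); x \<in> carrier M \<Gamma> \<phi>\<rbrakk>
      \<Longrightarrow> esubst M a \<phi> (atom_elt M a \<phi>) x = x"
    and esubst_fresh: "\<lbrakk>tenv (insert (Atom a, \<phi>) \<Gamma>); z \<in> carrier M (insert (Atom a, \<phi>) \<Gamma>) \<psi>;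
        x \<in> carrier M \<Gamma> \<phi>; fresh M a z\<rbrakk>
      \<Longrightarrow> esubst M a \<phi> z x = z"
    and esubst_applic: "\<lbrakk>tenv (insert (Atom a, \<phi>) \<Gamma>);
        z' \<in> carrier M (insert (Atom a, \<phi>) \<Gamma>) (\<psi> \<rightarrow>\<^sub>t \<psi>'); z \<in> carrier M (insert (Atom a, \<phi>) \<Gamma>) \<psi>;
        x \<in> carrier M \<Gamma> \<phi>\<rbrakk>
      \<Longrightarrow> esubst M a \<phi> (applic M z' z) x = applic M (esubst M a \<phi> z' x) (esubst M a \<phi> z x)"
    and esubst_abstr: "\<lbrakk>c \<noteq> a; tenv (insert (Atom c, \<chi>) (insert (Atom a, \<phi>) \<Gamma>));
        z \<in> carrier M (insert (Atom c, \<chi>) (insert (Atom a, \<phi>) \<Gamma>)) \<psi>; x \<in> carrier M \<Gamma> \<phi>; fresh M c x\<rbrakk>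
      \<Longrightarrow> esubst M a \<phi> (abstr M c \<chi> z) x = abstr M c \<chi> (esubst M a \<phi> z x)"

text \<open>
  Simultaneous substitution \<open>x[b\<^sub>i \<mapsto> y\<^sub>i]\<^sub>i\<close>, where \<open>m\<close> maps each \<open>b\<^sub>i\<close> to \<open>y\<^sub>i\<close> and \<open>\<tau> b\<^sub>i\<close> is the type
  of \<open>b\<^sub>i\<close>.  The \<open>b\<^sub>i\<close> are enumerated in an arbitrary order and the fresh \<open>c\<^sub>i\<close> are chosen
  arbitrarily.
\<close>

definition simsubst ::
  "('b, 'c, 'v, 'e) model \<Rightarrow> (atom \<Rightarrow> 'b ty) \<Rightarrow> 'e \<Rightarrow> (datom, 'e) fmap \<Rightarrow> 'e" where
  "simsubst M \<tau> x m = (let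
      bs = (SOME bs. distinct bs \<and> set bs = fmdom' m);
      cs = (SOME cs. length cs = length bs \<and> distinct cs \<and>
        (\<forall>c\<in>set cs. c \<notin> D ` set bs \<and> fresh M c x \<and> (\<forall>y\<in>fmran' m. fresh M c y)))
    in foldl (\<lambda>z (b, c). esubst M c (\<tau> (D b)) z (the (fmlookup m b)))
        (action M (prod_list (map (\<lambda>(b, c). Perm.swap c (D b)) (zip bs cs))) x) (zip bs cs))"

section \<open>Valuations and interpretation\<close>

definition valuation :: "('b, 'c, 'v, 'e) model \<Rightarrow> ('v \<Rightarrow> 'e) \<Rightarrow> bool" where
  "valuation M \<zeta> \<longleftrightarrow> (\<forall>X. supp (action M) (\<zeta> X) \<subseteq> range D)"

definition satisfies :: "('b, 'c, 'v, 'e) model \<Rightarrow> ('b, 'v) env \<Rightarrow> ('v \<Rightarrow> 'e) \<Rightarrow> bool" where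
  "satisfies M \<Gamma> \<zeta> \<longleftrightarrow> (\<forall>X \<phi>. (Unknown X, \<phi>) \<in> \<Gamma> \<longrightarrow> \<zeta> X \<in> carrier M \<Gamma> \<phi>)"

text \<open>
  \<open>interp M \<zeta> \<Gamma> t\<close> is meant for terms typed in \<open>\<Gamma>\<close> or an extension of \<open>\<Gamma>\<close> by unknowns.  An
  abstraction is interpreted by choosing an arbitrary bound atom that is not typed in \<open>\<Gamma>\<close>, see
  \<open>interp_Lam\<close>.
\<close>

function interp ::
  "('b, 'c, 'v, 'e) model \<Rightarrow> ('v \<Rightarrow> 'e) \<Rightarrow> ('b, 'v) env \<Rightarrow> ('b, 'c, 'v) trm \<Rightarrow> 'e" where
  "interp M \<zeta> \<Gamma> t = (case layer_of {c. Atom (U c) \<in> Domain \<Gamma>} t of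
      LAtm a \<Rightarrow> atom_elt M a (atom_type \<Gamma> a)
    | LCst C \<Rightarrow> const_elt M C
    | LUnk X m \<Rightarrow> simsubst M (atom_type \<Gamma>) (\<zeta> X) (fmmap (interp M \<zeta> \<Gamma>) m)
    | LLam c \<phi> r \<Rightarrow> abstr M (U c) \<phi> (interp M \<zeta> (insert (Atom (U c), \<phi>) \<Gamma>) r)
    | LApp r s \<Rightarrow> applic M (interp M \<zeta> \<Gamma> r) (interp M \<zeta> \<Gamma> s))"
  by auto
termination
  by (relation "measure (\<lambda>(M, \<zeta>, \<Gamma>, t). height t)") (auto simp: height_layer)

declare interp.simps [simp del]

lemma interp_simps [simp]:
  "interp M \<zeta> \<Gamma> (Atm a) = atom_elt M a (atom_type \<Gamma> a)"
  "interp M \<zeta> \<Gamma> (Cst C) = const_elt M C"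
  "interp M \<zeta> \<Gamma> (Unk X m) = simsubst M (atom_type \<Gamma>) (\<zeta> X) (fmmap (interp M \<zeta> \<Gamma>) m)"
  "interp M \<zeta> \<Gamma> (App r s) = applic M (interp M \<zeta> \<Gamma> r) (interp M \<zeta> \<Gamma> s)"
  by (subst interp.simps, simp)+

lemma interp_Lam:
  assumes "tenv \<Gamma>"
  obtains d s where "Lam c \<phi> r = Lam d \<phi> s" "Atom (U d) \<notin> Domain \<Gamma>"
    "interp M \<zeta> \<Gamma> (Lam c \<phi> r) = abstr M (U d) \<phi> (interp M \<zeta> (insert (Atom (U d), \<phi>) \<Gamma>) s)"
proof -
  have "finite (U -` {a. Atom a \<in> Domain \<Gamma>})"
    using assms by (intro finite_vimageI) (auto simp: tenv_def inj_def)
  then have "finite {c. Atom (U c) \<in> Domain \<Gamma>}" by (simp add: vimage_def)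
  then obtain d s where l: "layer_of {c. Atom (U c) \<in> Domain \<Gamma>} (Lam c \<phi> r) = LLam d \<phi> s"
    and eq: "Lam c \<phi> r = Lam d \<phi> s" and d: "Atom (U d) \<notin> Domain \<Gamma>"
    by (rule layer_of_Lam[where c = c and \<phi> = \<phi> and r = r]) simp
  have "interp M \<zeta> \<Gamma> (Lam c \<phi> r) = abstr M (U d) \<phi> (interp M \<zeta> (insert (Atom (U d), \<phi>) \<Gamma>) s)"
    by (subst interp.simps) (simp only: l layer.case)
  with eq d show thesis by (rule that)
qed

end

theory Submission
  imports Defs
begin

text \<open>
  An element of a model is supported by the atoms typed in any environment whose carrier contains
  it.  Hence choosing binders and fresh names outside the environment supplies all freshness side
  conditions, even where \<open>\<lbrakk>t\<rbrakk>\<close> has atoms of the second class in its support.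

  Since \<open>z[a \<mapsto> x]\<close> is an abstraction applied to \<open>x\<close>, the axioms for \<open>esubst\<close> on applications and
  abstractions give the substitution lemma \<open>z[a \<mapsto> x][c \<mapsto> y] = z[c \<mapsto> y][a \<mapsto> x[c \<mapsto> y]]\<close>.  It makes
  \<open>simsubst\<close> independent of the enumeration, equivariance makes it independent of the fresh names,
  and together they yield \<open>x[k][n] = x[n, (k b)[n]]\<close>, where the entries for the domain of \<open>k\<close> override
  those of \<open>n\<close>.  This is the semantic counterpart of the level 1 clause for unknowns, so level 1
  substitution is interpreted by \<open>simsubst\<close>; the theorem follows by induction on \<open>r\<close>.
\<close>

section \<open>Environments and typing\<close>

text \<open>Several independent choices shape the proof. \<open>simsubst\<close> picks names that
  are fresh for the elements only, and these may well be typed in \<Gamma>, whereas the proof reads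
  freshness off an environment. The gap is closed by shrinking the environment to one that does not
  type the picked names; this costs no element, by the intersection axiom and equivariance.
  \<open>interp\<close> and both substitutions each choose their own binder, so an induction must
  offer its hypothesis for all representatives with a fresh binder at once, and weakening has to be
  proved together with renaming.

  The axioms for \<open>esubst\<close> hold only for arguments in suitable carriers, so every
  sequence of substitutions carries the environment in which its intermediate elements live.

  In x[k][n] the delicate atoms are those in both domains: their occurrences in x are governed by k,
  those in the values of k by n. They get two separate families of fresh names, and the family for n
  then disappears from x.\<close>

lemma tenv_insert: "tenv (insert (Atom a, \<phi>) \<Gamma>)" if "tenv \<Gamma>" "Atom a \<notin> Domain \<Gamma>"
proof -
  have "{b. Atom b \<in> Domain (insert (Atom a, \<phi>) \<Gamma>)} = insert a {b. Atom b \<in> Domain \<Gamma>}" by auto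
  then show ?thesis using that by (auto simp: tenv_def single_valued_def)
qed

lemma tenv_subset: "tenv \<Gamma>' \<Longrightarrow> \<Gamma> \<subseteq> \<Gamma>' \<Longrightarrow> tenv \<Gamma>"
  unfolding tenv_def by (blast intro: single_valued_subset finite_subset[rotated])

lemma tenv_unique: "tenv \<Gamma> \<Longrightarrow> (x, \<phi>) \<in> \<Gamma> \<Longrightarrow> (x, \<psi>) \<in> \<Gamma> \<Longrightarrow> \<phi> = \<psi>"
  by (auto simp: tenv_def single_valued_def)

lemma finite_tenv: "tenv \<Gamma> \<Longrightarrow> finite {a. Atom a \<in> Domain \<Gamma>}"
  by (simp add: tenv_def)

lemma finite_tenv_U: "tenv \<Gamma> \<Longrightarrow> finite {c. Atom (U c) \<in> Domain \<Gamma>}"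
  using finite_vimageI[OF finite_tenv, of \<Gamma> U] by (auto simp: inj_def vimage_def)

lemma atom_type_eq: "tenv \<Gamma> \<Longrightarrow> (Atom a, \<phi>) \<in> \<Gamma> \<Longrightarrow> atom_type \<Gamma> a = \<phi>"
  unfolding atom_type_def by (blast intro: the_equality tenv_unique)

lemma typing_tenv: "typing ctype \<Gamma> r \<phi> \<Longrightarrow> tenv \<Gamma>"
  by (induction rule: typing.induct) (auto elim: tenv_subset)

lemma free_typing: "typing ctype \<Gamma> r \<phi> \<Longrightarrow> c \<in> free r \<Longrightarrow> Atom (U c) \<in> Domain \<Gamma>"
proof (induction arbitrary: c rule: typing.induct)
  case (typing_Unk \<Gamma> X \<phi> m)
  then obtain b s where "fmlookup m b = Some s" "c \<in> free s" by (auto simp: fmlookup_ran'_iff)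
  then show ?case using typing_Unk(3) by blast
qed auto

text \<open>Terms are acted on by permutations of \<open>uatom\<close>, since only these atoms can
  be bound, while models are acted on by permutations of all atoms. This extension links the two
  actions. It fixes every \<open>D b\<close> and hence the domain of every map attached to an
  unknown.\<close>

lift_definition atom_perm :: "uatom perm \<Rightarrow> atom perm" is
  "\<lambda>f a. case a of D b \<Rightarrow> D b | U c \<Rightarrow> U (f c)"
proof -
  fix f :: "uatom \<Rightarrow> uatom"
  assume f: "bij f \<and> finite {a. f a \<noteq> a}"
  let ?f = "\<lambda>a. case a of D b \<Rightarrow> D b | U c \<Rightarrow> U (f c)"
  have "bij ?f"
  proof (rule bijI)
    show "inj ?f" using f by (auto simp: inj_def bij_def split: atom.splits)
    have "\<exists>y. x = ?f y" for x
    proof (cases x)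
      case (D b)
      then show ?thesis by (intro exI[of _ "D b"]) simp
    next
      case (U c)
      obtain d where "c = f d" using f by (metis bij_pointE)
      then show ?thesis using U by (intro exI[of _ "U d"]) simp
    qed
    then show "surj ?f" by (auto simp: surj_def)
  qed
  moreover have "{a. ?f a \<noteq> a} \<subseteq> U ` {a. f a \<noteq> a}"
  proof
    show "a \<in> U ` {a. f a \<noteq> a}" if "a \<in> {a. ?f a \<noteq> a}" for a
      using that by (cases a) auto
  qed
  then have "finite {a. ?f a \<noteq> a}" using f by (blast intro: finite_subset)
  ultimately show "bij ?f \<and> finite {a. ?f a \<noteq> a}" by blast
qed

lemma apply_atom_perm: "apply (atom_perm \<pi>) = aperm \<pi>"
proof
  show "apply (atom_perm \<pi>) a = aperm \<pi> a" for a
    by (cases a) (simp_all add: atom_perm.rep_eq)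
qed

lemma atom_perm_simps [simp]:
  "apply (atom_perm \<pi>) (D b) = D b" "apply (atom_perm \<pi>) (U c) = U (apply \<pi> c)"
  by (simp_all add: apply_atom_perm)

lemma atom_perm_swap: "atom_perm (Perm.swap c d) = Perm.swap (U c) (U d)"
proof (rule perm_eqI)
  show "apply (atom_perm (Perm.swap c d)) a = apply (Perm.swap (U c) (U d)) a" for a
    by (cases a) (auto simp: Perm.swap.rep_eq transpose_def)
qed

section \<open>Permuted environments and change of binder\<close>

lemma env_permI: "(x, \<phi>) \<in> \<Gamma> \<Longrightarrow> (name_perm \<pi> x, \<phi>) \<in> env_perm \<pi> \<Gamma>"
  by (force simp: env_perm_def)

lemma env_perm_subsetI:
  "(\<And>x \<phi>. (x, \<phi>) \<in> \<Gamma> \<Longrightarrow> (name_perm \<pi> x, \<phi>) \<in> \<Gamma>') \<Longrightarrow> env_perm \<pi> \<Gamma> \<subseteq> \<Gamma>'"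
  by (auto simp: env_perm_def)

lemma name_perm_rebind:
  assumes "x \<noteq> Atom (U c)" "name_perm (atom_perm \<pi>) x \<noteq> Atom (U d)"
  shows "name_perm (atom_perm (Perm.swap d (apply \<pi> c) * \<pi>)) x = name_perm (atom_perm \<pi>) x"
proof (cases x)
  case (Atom a)
  then show ?thesis
    using assms by (cases a) (auto simp: Perm.swap.rep_eq transpose_def apply_times apply_inj)
qed simp

lemma env_perm_1 [simp]: "env_perm 1 \<Gamma> = \<Gamma>" for \<Gamma> :: "('b, 'v) env"
proof -
  have "name_perm 1 x = x" for x :: "'v name" by (cases x) simp_all
  then show ?thesis by (simp add: env_perm_def split_def)
qed

lemma atom_perm_1 [simp]: "atom_perm 1 = 1"
  by (rule perm_eqI) (simp add: apply_atom_perm)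

text \<open>This carries an inclusion of environments below a binder. The new permutation is \<pi>
  redirected to send \<open>c\<close> to \<open>d\<close>. As \<open>d\<close> is untyped in
  \<Gamma>', the swap disturbs no image of a name in \<Gamma> other than that of \<open>c\<close>.
  \<Gamma> itself may already type \<open>c\<close>; functionality then forces the type
  \<phi>.\<close>

lemma env_perm_rebind:
  assumes tenv: "tenv (insert (Atom (U c), \<phi>) \<Gamma>)" and sub: "env_perm (atom_perm \<pi>) \<Gamma> \<subseteq> \<Gamma>'"
    and d: "Atom (U d) \<notin> Domain \<Gamma>'"
  shows "env_perm (atom_perm (Perm.swap d (apply \<pi> c) * \<pi>)) (insert (Atom (U c), \<phi>) \<Gamma>)
    \<subseteq> insert (Atom (U d), \<phi>) \<Gamma>'"
proof (rule env_perm_subsetI)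
  fix x \<psi> assume x: "(x, \<psi>) \<in> insert (Atom (U c), \<phi>) \<Gamma>"
  show "(name_perm (atom_perm (Perm.swap d (apply \<pi> c) * \<pi>)) x, \<psi>) \<in> insert (Atom (U d), \<phi>) \<Gamma>'"
  proof (cases "x = Atom (U c)")
    case True
    then show ?thesis
      using tenv_unique[OF tenv, of x \<phi> \<psi>] x by (auto simp: apply_times Perm.swap.rep_eq)
  next
    case False
    then have x': "(name_perm (atom_perm \<pi>) x, \<psi>) \<in> \<Gamma>'"
      using x sub env_permI by fastforce
    have "name_perm (atom_perm \<pi>) x \<noteq> Atom (U d)" using x' d by auto
    with False show ?thesis using x' by (simp add: name_perm_rebind)
  qed
qed

text \<open>Weakening by itself is not inductive: the bound atom of a derivation may be typed
  differently in the larger environment and must then be renamed. So the induction carries an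
  arbitrary renaming; the identity gives \<open>typing_mono\<close>.\<close>

lemma typing_perm_mono:
  assumes "typing ctype \<Gamma> r \<phi>" "tenv \<Gamma>'" "env_perm (atom_perm \<pi>) \<Gamma> \<subseteq> \<Gamma>'"
  shows "typing ctype \<Gamma>' (tperm \<pi> r) \<phi>"
  using assms
proof (induction arbitrary: \<Gamma>' \<pi> rule: typing.induct)
  case (typing_Atm \<Gamma> a \<phi>)
  then have "(Atom (aperm \<pi> a), \<phi>) \<in> \<Gamma>'"
    by (force simp: env_perm_def apply_atom_perm)
  then show ?case using typing_Atm by (auto intro: typing.typing_Atm)
next
  case (typing_Cst \<Gamma> C)
  then show ?case by (auto intro: typing.typing_Cst)
next
  case (typing_Lam c \<phi> \<Gamma> r \<psi>)
  have "finite ({c. Atom (U c) \<in> Domain \<Gamma>'} \<union> free (tperm \<pi> r))"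
    using finite_tenv_U typing_Lam.prems(1) by simp
  then obtain d where d: "Atom (U d) \<notin> Domain \<Gamma>'" "d \<notin> free (tperm \<pi> r)"
    using ex_new_if_finite[OF infinite_UNIV_uatom] by blast
  let ?\<rho> = "Perm.swap d (apply \<pi> c) * \<pi>"
  have "env_perm (atom_perm ?\<rho>) (insert (Atom (U c), \<phi>) \<Gamma>) \<subseteq> insert (Atom (U d), \<phi>) \<Gamma>'"
    using typing_tenv[OF typing_Lam.hyps] typing_Lam.prems(2) d(1) by (rule env_perm_rebind)
  then have "typing ctype (insert (Atom (U d), \<phi>) \<Gamma>') (tperm ?\<rho> r) \<psi>"
    using typing_Lam.prems(1) d(1) by (intro typing_Lam.IH tenv_insert)
  then have "typing ctype \<Gamma>' (Lam d \<phi> (tperm ?\<rho> r)) (\<phi> \<rightarrow>\<^sub>t \<psi>)" by (rule typing.typing_Lam)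
  then show ?case using Lam_rename[OF d(2), of "apply \<pi> c" \<phi>] by (simp add: tperm_times)
next
  case (typing_App \<Gamma> r \<phi> \<psi> s)
  then show ?case unfolding tperm_simps by (blast intro: typing.typing_App)
next
  case (typing_Unk \<Gamma> X \<phi> m)
  have "(Unknown X, \<phi>) \<in> \<Gamma>'" using typing_Unk by (force simp: env_perm_def)
  moreover have "\<exists>\<psi>. (Atom (D b), \<psi>) \<in> \<Gamma>' \<and> typing ctype \<Gamma>' s \<psi>"
    if "fmlookup (fmmap (tperm \<pi>) m) b = Some s" for b s
  proof -
    obtain s' where s': "fmlookup m b = Some s'" "s = tperm \<pi> s'" using \<open>fmlookup _ b = Some s\<close> by auto
    then obtain \<psi> where \<psi>: "(Atom (D b), \<psi>) \<in> \<Gamma>" "typing ctype \<Gamma>' s \<psi>"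
      using typing_Unk by blast
    then have "(Atom (D b), \<psi>) \<in> \<Gamma>'" using typing_Unk.prems by (force simp: env_perm_def)
    then show ?thesis using \<psi> by blast
  qed
  ultimately show ?case using typing_Unk.prems by (auto intro: typing.typing_Unk)
qed

lemma typing_mono: "typing ctype \<Gamma> r \<phi> \<Longrightarrow> tenv \<Gamma>' \<Longrightarrow> \<Gamma> \<subseteq> \<Gamma>' \<Longrightarrow> typing ctype \<Gamma>' r \<phi>"
  using typing_perm_mono[of ctype \<Gamma> r \<phi> \<Gamma>' 1] by simp

lemma name_perm_swap:
  "x \<noteq> Atom a \<Longrightarrow> x \<noteq> Atom b \<Longrightarrow> name_perm (Perm.swap a b) x = x"
  by (cases x) (auto simp: Perm.swap.rep_eq transpose_def)

text \<open>The derivation may have used another representative of the abstraction, even one whose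
  binder is typed in \<Gamma>. By \<open>Lam_eqD\<close> its body differs from \<open>r\<close> by a
  swap of the two binders, and \<open>env_perm_rebind\<close> with the identity permutation accounts
  for that swap.\<close>

lemma typing_Lam_fresh:
  assumes "typing ctype \<Gamma> (Lam c \<phi> r) \<chi>" and c: "Atom (U c) \<notin> Domain \<Gamma>"
  obtains \<psi> where "\<chi> = \<phi> \<rightarrow>\<^sub>t \<psi>" "typing ctype (insert (Atom (U c), \<phi>) \<Gamma>) r \<psi>"
  using assms(1)
proof (cases rule: typing.cases)
  case (typing_Lam d \<phi>' s \<psi>)
  note eq = typing_Lam(1) and \<chi> = typing_Lam(2) and s = typing_Lam(3)
  have \<phi>: "\<phi>' = \<phi>" "r = tperm (Perm.swap c d) s"
    using Lam_eqD[OF eq] Lam_eqD(2)[OF eq[symmetric]] by simp_all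
  have tenv: "tenv (insert (Atom (U d), \<phi>) \<Gamma>)" "tenv \<Gamma>"
    using typing_tenv[OF s] typing_tenv[OF assms(1)] \<phi> by simp_all
  have "typing ctype (insert (Atom (U c), \<phi>) \<Gamma>) r \<psi>"
    unfolding \<phi>(2)
  proof (rule typing_perm_mono[OF s tenv_insert[OF tenv(2) c]])
    show "env_perm (atom_perm (Perm.swap c d)) (insert (Atom (U d), \<phi>') \<Gamma>)
        \<subseteq> insert (Atom (U c), \<phi>) \<Gamma>"
      using env_perm_rebind[OF tenv(1), of 1 \<Gamma> c] c \<phi>(1) by simp
  qed
  then show thesis using that \<chi> \<phi> by simp
qed simp_all

text \<open>Rule induction supplies a hypothesis only for the binder of the given derivation,
  whereas \<open>interp\<close> chooses its own. Here the abstraction case covers every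
  representative with a binder untyped in \<Gamma>. All their bodies have smaller height than the
  abstraction, so induction on the height provides these hypotheses.\<close>

lemma typing_fresh_induct [consumes 1, case_names Atm Cst Lam App Unk]:
  assumes "typing ctype \<Gamma> r \<phi>"
    and Atm: "\<And>\<Gamma> a \<phi>. tenv \<Gamma> \<Longrightarrow> (Atom a, \<phi>) \<in> \<Gamma> \<Longrightarrow> P \<Gamma> (Atm a) \<phi>"
    and Cst: "\<And>\<Gamma> C. tenv \<Gamma> \<Longrightarrow> P \<Gamma> (Cst C) (ctype C)"
    and Lam: "\<And>\<Gamma> c \<phi> r \<psi>. typing ctype \<Gamma> (Lam c \<phi> r) (\<phi> \<rightarrow>\<^sub>t \<psi>) \<Longrightarrow>
      (\<And>d s. Lam c \<phi> r = Lam d \<phi> s \<Longrightarrow> Atom (U d) \<notin> Domain \<Gamma> \<Longrightarrow>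
        typing ctype (insert (Atom (U d), \<phi>) \<Gamma>) s \<psi> \<and> P (insert (Atom (U d), \<phi>) \<Gamma>) s \<psi>) \<Longrightarrow>
      P \<Gamma> (Lam c \<phi> r) (\<phi> \<rightarrow>\<^sub>t \<psi>)"
    and App: "\<And>\<Gamma> r \<phi> \<psi> s. typing ctype \<Gamma> r (\<phi> \<rightarrow>\<^sub>t \<psi>) \<Longrightarrow> typing ctype \<Gamma> s \<phi> \<Longrightarrow>
      P \<Gamma> r (\<phi> \<rightarrow>\<^sub>t \<psi>) \<Longrightarrow> P \<Gamma> s \<phi> \<Longrightarrow> P \<Gamma> (App r s) \<psi>"
    and Unk: "\<And>\<Gamma> X \<phi> m. tenv \<Gamma> \<Longrightarrow> (Unknown X, \<phi>) \<in> \<Gamma> \<Longrightarrow>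
      (\<And>b s. fmlookup m b = Some s \<Longrightarrow> \<exists>\<psi>. (Atom (D b), \<psi>) \<in> \<Gamma> \<and> typing ctype \<Gamma> s \<psi> \<and> P \<Gamma> s \<psi>) \<Longrightarrow>
      P \<Gamma> (Unk X m) \<phi>"
  shows "P \<Gamma> r \<phi>"
  using assms(1)
proof (induction "height r" arbitrary: \<Gamma> r \<phi> rule: less_induct)
  case less
  from less.prems show ?case
  proof (cases rule: typing.cases)
    case (typing_Lam c \<phi>' r' \<psi>)
    have "typing ctype (insert (Atom (U d), \<phi>') \<Gamma>) s \<psi> \<and> P (insert (Atom (U d), \<phi>') \<Gamma>) s \<psi>"
      if eq: "Lam c \<phi>' r' = Lam d \<phi>' s" and d: "Atom (U d) \<notin> Domain \<Gamma>" for d s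
    proof -
      have "typing ctype (insert (Atom (U d), \<phi>') \<Gamma>) s \<psi>"
        using less.prems typing_Lam eq d by (auto elim: typing_Lam_fresh)
      moreover have "height s < height r" using typing_Lam eq by (simp add: height_simps)
      ultimately show ?thesis using less.hyps by blast
    qed
    then show ?thesis using Lam less.prems typing_Lam by blast
  next
    case (typing_Unk X m)
    show ?thesis unfolding typing_Unk(1)
    proof (rule Unk)
      fix b s assume s: "fmlookup m b = Some s"
      then have "height s < height r" using typing_Unk height_Unk fmran'I by metis
      then show "\<exists>\<psi>. (Atom (D b), \<psi>) \<in> \<Gamma> \<and> typing ctype \<Gamma> s \<psi> \<and> P \<Gamma> s \<psi>"
        using typing_Unk(4)[OF s] less.hyps by blast
    qed (use typing_Unk in auto)
  next
    case (typing_App r' \<psi> s)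
    then show ?thesis using App less.hyps by (simp add: height_simps)
  qed (use Atm Cst in auto)
qed

section \<open>Substitution preserves typing\<close>

lemma ex_fresh_Lam:
  assumes "tenv \<Gamma>"
  obtains d s where "Lam c \<phi> r = Lam d \<phi> s" "Atom (U d) \<notin> Domain \<Gamma>"
  using layer_of_Lam[OF finite_tenv_U[OF assms]] by (metis mem_Collect_eq)

lemma fmran'_demb [simp]: "fmran' (demb m) = fmran' m"
  by (force simp: fmlookup_ran'_iff split: atom.splits)

lemma subst1_demb_Lam:
  assumes "\<And>s. s \<in> fmran' n \<Longrightarrow> c \<notin> free s"
  shows "subst1 (demb n) (Lam c \<phi> r) = Lam c \<phi> (subst1 (demb n) r)"
  using assms by (intro subst1_Lam) (auto simp: fmlookup_dom'_iff)

lemma dpart_demb [simp]: "dpart (demb m) = m"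
  by (rule fmap_ext) simp

lemma typing_subst1:
  assumes "typing ctype \<Gamma> t \<phi>"
    and "\<And>b s. fmlookup n b = Some s \<Longrightarrow> \<exists>\<psi>. (Atom (D b), \<psi>) \<in> \<Gamma> \<and> typing ctype \<Gamma> s \<psi>"
  shows "typing ctype \<Gamma> (subst1 (demb n) t) \<phi>"
  using assms
proof (induction rule: typing_fresh_induct)
  case (Atm \<Gamma> a \<phi>)
  show ?case
  proof (cases "fmlookup (demb n) a")
    case None
    then show ?thesis using Atm by (auto intro: typing_Atm)
  next
    case (Some s)
    then obtain b where "a = D b" "fmlookup n b = Some s" by (cases a) auto
    then show ?thesis using Atm Some tenv_unique by fastforce
  qed
next
  case (Cst \<Gamma> C)
  then show ?case by (auto intro: typing_Cst)
next
  case (Lam \<Gamma> c \<phi> r \<psi>)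
  have \<Gamma>: "tenv \<Gamma>" using Lam typing_tenv by blast
  then obtain d s where eq: "Lam c \<phi> r = Lam d \<phi> s" and d: "Atom (U d) \<notin> Domain \<Gamma>"
    by (rule ex_fresh_Lam)
  have "typing ctype (insert (Atom (U d), \<phi>) \<Gamma>) (subst1 (demb n) s) \<psi>"
    using Lam.IH[OF eq d] Lam.prems typing_mono[OF _ tenv_insert[OF \<Gamma> d]] by blast
  moreover have "d \<notin> free u" if "u \<in> fmran' n" for u
    using Lam.prems free_typing d that by (fastforce simp: fmlookup_ran'_iff)
  ultimately show ?case unfolding eq by (simp add: subst1_demb_Lam typing_Lam)
next
  case (App \<Gamma> r \<phi> \<psi> s)
  then show ?case by (auto intro: typing_App)
next
  case (Unk \<Gamma> X \<phi> m)
  have "\<exists>\<psi>. (Atom (D b), \<psi>) \<in> \<Gamma> \<and> typing ctype \<Gamma> s \<psi>"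
    if "fmlookup (n ++\<^sub>f fmmap (subst1 (demb n)) m) b = Some s" for b s
    using that Unk(3)[of b] Unk.prems by (auto split: if_splits)
  then show ?case using Unk(1,2) by (auto intro: typing_Unk)
qed

lemma typing_subst2:
  assumes "typing ctype (insert (Unknown X, \<chi>) \<Gamma>) r \<phi>" and "typing ctype \<Gamma> t \<chi>"
  shows "typing ctype \<Gamma> (subst2 X t r) \<phi>"
  using assms
proof (induction "insert (Unknown X, \<chi>) \<Gamma>" r \<phi> arbitrary: \<Gamma> rule: typing_fresh_induct)
  case (Atm a \<phi>)
  then show ?case by (auto intro: typing_Atm typing_tenv)
next
  case (Cst C)
  then show ?case by (auto intro: typing_Cst typing_tenv)
next
  case (Lam c \<phi> r \<psi>)
  have \<Gamma>: "tenv \<Gamma>" using Lam typing_tenv by blast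
  then obtain d s where eq: "Lam c \<phi> r = Lam d \<phi> s" and d: "Atom (U d) \<notin> Domain \<Gamma>"
    by (rule ex_fresh_Lam)
  have "typing ctype (insert (Atom (U d), \<phi>) \<Gamma>) (subst2 X t s) \<psi>"
  proof -
    have "Atom (U d) \<notin> Domain (insert (Unknown X, \<chi>) \<Gamma>)" using d by auto
    \<comment> \<open>The hypothesis asks for an environment of the form
      \<open>insert (Unknown X, \<chi>) _\<close>; commuting the two insertions brings the extension
      by the binder into that form.\<close>
    from Lam(2)[OF eq this, THEN conjunct2, rule_format, OF insert_commute]
    show ?thesis using typing_mono[OF Lam.prems tenv_insert[OF \<Gamma> d]] by blast
  qed
  moreover have "d \<notin> free t" using Lam.prems free_typing d by blast
  ultimately show ?case unfolding eq by (simp add: subst2_Lam typing_Lam)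
next
  case (App r \<phi> \<psi> s)
  then show ?case by (auto intro: typing_App)
next
  case (Unk Y \<phi> m)
  have m: "\<exists>\<psi>. (Atom (D b), \<psi>) \<in> \<Gamma> \<and> typing ctype \<Gamma> s \<psi>"
    if "fmlookup (fmmap (subst2 X t) m) b = Some s" for b s
    using Unk(3) Unk.prems that by fastforce
  show ?case
  proof (cases "Y = X")
    case True
    then have "\<phi> = \<chi>" using Unk(1,2) tenv_unique by fastforce
    moreover have "typing ctype \<Gamma> (subst1 (demb (fmmap (subst2 X t) m)) t) \<chi>"
      using Unk.prems m by (rule typing_subst1)
    ultimately show ?thesis using True by simp
  next
    case False
    then show ?thesis using Unk(2) Unk.prems m by (auto intro!: typing_Unk typing_tenv)
  qed
qed

section \<open>Carriers of a model\<close>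

context nominal_model
begin

text \<open>Monotonicity is contained in the intersection axiom, because \<Gamma> \<inter> \<Gamma>'
  = \<Gamma>.\<close>

lemma carrier_mono: "tenv \<Gamma>' \<Longrightarrow> \<Gamma> \<subseteq> \<Gamma>' \<Longrightarrow> carrier M \<Gamma> \<phi> \<subseteq> carrier M \<Gamma>' \<phi>"
  using carrier_Int[of \<Gamma> \<Gamma>' \<phi>] tenv_subset[of \<Gamma>' \<Gamma>] by (auto simp: Int_absorb2)

lemma carrier_monoD:
  "x \<in> carrier M \<Gamma> \<phi> \<Longrightarrow> tenv \<Gamma>' \<Longrightarrow> \<Gamma> \<subseteq> \<Gamma>' \<Longrightarrow> x \<in> carrier M \<Gamma>' \<phi>"
  using carrier_mono by blast

lemma act_1 [simp]: "action M 1 x = x"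
  using action by (simp add: perm_action_def)

lemma act_times: "action M (\<pi> * \<pi>') x = action M \<pi> (action M \<pi>' x)"
  using action by (simp add: perm_action_def)

lemma supported_carrier:
  assumes "tenv \<Gamma>" "x \<in> carrier M \<Gamma> \<phi>"
  shows "finitely_supported (action M) x"
proof (rule ccontr)
  assume "\<not> ?thesis"
  then have "{A. finite A \<and> supports (action M) A x} = {}"
    unfolding finitely_supported_def by blast
  \<comment> \<open>The empty intersection makes \<open>supp\<close> the set of all atoms, which the
    finitely many typed atoms cannot contain.\<close>
  then have "supp (action M) x = UNIV" by (simp only: supp_def Inter_empty)
  then show False
    using supp_carrier[OF assms] finite_tenv[OF assms(1)] infinite_UNIV_atom
    by (metis finite_subset)
qed

lemma act_fixes:
  assumes "tenv \<Gamma>" "x \<in> carrier M \<Gamma> \<phi>" "\<And>a. Atom a \<in> Domain \<Gamma> \<Longrightarrow> apply \<pi> a = a"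
  shows "action M \<pi> x = x"
proof -
  have "supports (action M) (supp (action M) x) x"
    using supp_least(2)[OF action supported_carrier] assms by blast
  then show ?thesis using supp_carrier[OF assms(1,2)] assms(3) by (auto simp: supports_def)
qed

lemma act_agree:
  assumes "tenv \<Gamma>" "x \<in> carrier M \<Gamma> \<phi>" "\<And>a. Atom a \<in> Domain \<Gamma> \<Longrightarrow> apply \<pi> a = apply \<rho> a"
  shows "action M \<pi> x = action M \<rho> x"
proof -
  have "apply (inverse \<rho>) (apply \<rho> a) = a" for a
    by (simp add: apply_inverse inv_f_f[OF bij_is_inj[OF bij_apply]])
  then have "action M (inverse \<rho> * \<pi>) x = x"
    using assms(3) by (intro act_fixes[OF assms(1,2)]) (simp add: apply_times)
  then have "action M \<rho> (action M (inverse \<rho> * \<pi>) x) = action M \<rho> x" by simp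
  then show ?thesis by (simp add: act_times[symmetric] mult.assoc[symmetric])
qed

lemma act_carrier:
  assumes "x \<in> carrier M \<Gamma> \<phi>" "tenv \<Gamma>'" "env_perm \<pi> \<Gamma> \<subseteq> \<Gamma>'" "tenv \<Gamma>"
  shows "action M \<pi> x \<in> carrier M \<Gamma>' \<phi>"
  using carrier_eqvt[OF assms(4), of \<pi> \<phi>] carrier_mono[OF assms(2,3)] assms(1) by blast

lemma act_swap_fresh:
  assumes "tenv \<Gamma>" "x \<in> carrier M \<Gamma> \<phi>" "fresh M a x" "fresh M b x"
  shows "action M (Perm.swap a b) x = x"
proof -
  have "supports (action M) (supp (action M) x) x"
    using supp_least(2)[OF action supported_carrier] assms by blast
  moreover have "\<forall>c\<in>supp (action M) x. apply (Perm.swap a b) c = c"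
    using assms(3,4) by (auto simp: fresh_def Perm.swap.rep_eq transpose_def)
  ultimately show ?thesis by (simp add: supports_def)
qed

lemma fresh_carrier:
  "tenv \<Gamma> \<Longrightarrow> x \<in> carrier M \<Gamma> \<phi> \<Longrightarrow> Atom a \<notin> Domain \<Gamma> \<Longrightarrow> fresh M a x"
  using supp_carrier[of \<Gamma> x \<phi>] by (auto simp: fresh_def)

text \<open>Swapping \<open>a\<close> with an untyped atom \<open>b\<close> fixes \<open>x\<close>,
  as both are fresh for it. By equivariance \<open>x\<close> also lies in the carrier of \<Delta>,
  which is \<Gamma> with \<open>b\<close> in place of \<open>a\<close>, and intersecting the two
  environments removes the typing of \<open>a\<close>.\<close>

lemma carrier_remove_fresh:
  assumes \<Gamma>: "tenv \<Gamma>" and x: "x \<in> carrier M \<Gamma> \<phi>" and a: "fresh M a x"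
  shows "x \<in> carrier M {(n, \<psi>) \<in> \<Gamma>. n \<noteq> Atom a} \<phi>"
proof -
  obtain b where b: "Atom b \<notin> Domain \<Gamma>" "b \<noteq> a"
    using ex_new_if_finite[OF infinite_UNIV_atom, of "insert a {a. Atom a \<in> Domain \<Gamma>}"]
      finite_tenv[OF \<Gamma>] by auto
  let ?\<pi> = "Perm.swap a b" and ?\<Gamma> = "{(n, \<psi>) \<in> \<Gamma>. n \<noteq> Atom a}"
  define \<Delta> where "\<Delta> = (\<lambda>\<psi>. (Atom b, \<psi>)) ` {\<psi>. (Atom a, \<psi>) \<in> \<Gamma>} \<union> ?\<Gamma>"
  have "{c. Atom c \<in> Domain \<Delta>} \<subseteq> insert b {c. Atom c \<in> Domain \<Gamma>}" by (auto simp: \<Delta>_def)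
  then have \<Delta>: "tenv \<Delta>"
    using \<Gamma> b finite_tenv[OF \<Gamma>] unfolding tenv_def
    by (auto simp: \<Delta>_def single_valued_def intro: finite_subset)
  have "env_perm ?\<pi> \<Gamma> \<subseteq> \<Delta>"
  proof (rule env_perm_subsetI)
    fix n \<psi> assume "(n, \<psi>) \<in> \<Gamma>"
    moreover from this have "n \<noteq> Atom b" using b by auto
    ultimately show "(name_perm ?\<pi> n, \<psi>) \<in> \<Delta>"
      by (cases "n = Atom a") (auto simp: \<Delta>_def name_perm_swap Perm.swap.rep_eq)
  qed
  then have "action M ?\<pi> x \<in> carrier M \<Delta> \<phi>" using act_carrier x \<Delta> \<Gamma> by blast
  then have "x \<in> carrier M \<Delta> \<phi>"
    using act_swap_fresh[OF \<Gamma> x a fresh_carrier[OF \<Gamma> x b(1)]] by simp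
  then have "x \<in> carrier M (\<Gamma> \<inter> \<Delta>) \<phi>" using x carrier_Int[OF \<Gamma> \<Delta>] by blast
  moreover have "\<Gamma> \<inter> \<Delta> = ?\<Gamma>" using b by (auto simp: \<Delta>_def)
  ultimately show ?thesis by simp
qed

lemma carrier_remove_fresh_set:
  assumes "finite A" "tenv \<Gamma>" "x \<in> carrier M \<Gamma> \<phi>" "\<And>a. a \<in> A \<Longrightarrow> fresh M a x"
  shows "x \<in> carrier M {(n, \<psi>) \<in> \<Gamma>. n \<notin> Atom ` A} \<phi>"
  using assms
proof (induction A rule: finite_induct)
  case (insert a A)
  let ?\<Gamma> = "{(n, \<psi>) \<in> \<Gamma>. n \<notin> Atom ` A}"
  have "tenv ?\<Gamma>" using insert.prems(1) by (rule tenv_subset) auto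
  then have "x \<in> carrier M {(n, \<psi>) \<in> ?\<Gamma>. n \<noteq> Atom a} \<phi>"
    using insert by (intro carrier_remove_fresh) auto
  moreover have "{(n, \<psi>) \<in> ?\<Gamma>. n \<noteq> Atom a} = {(n, \<psi>) \<in> \<Gamma>. n \<notin> Atom ` insert a A}" by auto
  ultimately show ?case by simp
qed simp

section \<open>Single substitution on carriers\<close>

lemma esubst_in:
  assumes "tenv (insert (Atom a, \<phi>) \<Gamma>)" "z \<in> carrier M (insert (Atom a, \<phi>) \<Gamma>) \<psi>"
    "y \<in> carrier M \<Gamma> \<phi>"
  shows "esubst M a \<phi> z y \<in> carrier M \<Gamma> \<psi>"
  unfolding esubst_def
  by (rule applic_in[OF tenv_subset[OF assms(1) subset_insertI] abstr_in[OF assms(1,2)] assms(3)])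

lemma esubst_eqvt:
  assumes "tenv (insert (Atom a, \<phi>) \<Gamma>)" "z \<in> carrier M (insert (Atom a, \<phi>) \<Gamma>) \<psi>"
    "y \<in> carrier M \<Gamma> \<phi>"
  shows "action M \<pi> (esubst M a \<phi> z y) = esubst M (apply \<pi> a) \<phi> (action M \<pi> z) (action M \<pi> y)"
  unfolding esubst_def
  by (simp add: applic_eqvt[OF tenv_subset[OF assms(1) subset_insertI] abstr_in[OF assms(1,2)] assms(3)]
      abstr_eqvt[OF assms(1,2)])

lemma esubst_fresh_carrier:
  assumes "tenv \<Gamma>" "z \<in> carrier M \<Gamma> \<psi>" "Atom a \<notin> Domain \<Gamma>" "x \<in> carrier M \<Gamma> \<phi>"
  shows "esubst M a \<phi> z x = z"
proof -
  have \<Gamma>: "tenv (insert (Atom a, \<phi>) \<Gamma>)" using assms by (intro tenv_insert)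
  then have "z \<in> carrier M (insert (Atom a, \<phi>) \<Gamma>) \<psi>" using assms(2) by (auto intro: carrier_monoD)
  then show ?thesis using esubst_fresh[OF \<Gamma>] fresh_carrier assms by blast
qed

end

section \<open>Sequential substitution\<close>

definition subst_seq :: "('b, 'c, 'v, 'e) model \<Rightarrow> 'e \<Rightarrow> (atom \<times> 'b ty \<times> 'e) list \<Rightarrow> 'e" where
  "subst_seq M = foldl (\<lambda>z (c, \<phi>, y). esubst M c \<phi> z y)"

lemma subst_seq_simps [simp]:
  "subst_seq M z [] = z"
  "subst_seq M z ((c, \<phi>, y) # ts) = subst_seq M (esubst M c \<phi> z y) ts"
  "subst_seq M z (ts @ us) = subst_seq M (subst_seq M z ts) us"
  by (simp_all add: subst_seq_def)

text \<open>The environment of an element before \<open>ts\<close> acts on it. It forgets the order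
  of \<open>ts\<close>, so exchanging substitutions leaves it unchanged, and \<Gamma> may itself be
  such an extension.\<close>

definition seq_env :: "(atom \<times> 'b ty \<times> 'e) list \<Rightarrow> ('b, 'v) env \<Rightarrow> ('b, 'v) env" where
  "seq_env ts \<Gamma> = (\<lambda>t. (Atom (fst t), fst (snd t))) ` set ts \<union> \<Gamma>"

lemma seq_env_simps [simp]:
  "seq_env [] \<Gamma> = \<Gamma>"
  "seq_env ((c, \<phi>, y) # ts) \<Gamma> = insert (Atom c, \<phi>) (seq_env ts \<Gamma>)"
  "seq_env (ts @ us) \<Gamma> = seq_env ts (seq_env us \<Gamma>)"
  by (auto simp: seq_env_def)

lemma seq_env_insert [simp]:
  "seq_env ts (insert x \<Gamma>) = insert x (seq_env ts \<Gamma>)"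
  by (auto simp: seq_env_def)

lemma seq_env_commute: "seq_env ts (seq_env us \<Gamma>) = seq_env us (seq_env ts \<Gamma>)"
  by (auto simp: seq_env_def)

lemma Domain_seq_env: "Domain (seq_env ts \<Gamma>) = Atom ` fst ` set ts \<union> Domain \<Gamma>"
  by (force simp: seq_env_def)

lemma subset_seq_env: "\<Gamma> \<subseteq> seq_env ts \<Gamma>"
  by (simp add: seq_env_def)

context nominal_model
begin

text \<open>All values live in \<Gamma>, where none of the substituted names is typed. No
  substitution can then affect the value of another one, which is what makes the sequence behave
  like a simultaneous substitution.\<close>

definition seq_ok :: "('b, 'v) env \<Rightarrow> (atom \<times> 'b ty \<times> 'e) list \<Rightarrow> bool" where
  "seq_ok \<Gamma> ts \<longleftrightarrow> tenv \<Gamma> \<and> distinct (map fst ts) \<and>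
    (\<forall>t \<in> set ts. Atom (fst t) \<notin> Domain \<Gamma> \<and> snd (snd t) \<in> carrier M \<Gamma> (fst (snd t)))"

lemma seq_ok_Nil [simp]: "seq_ok \<Gamma> [] \<longleftrightarrow> tenv \<Gamma>"
  by (simp add: seq_ok_def)

lemma seq_ok_tenv: "seq_ok \<Gamma> ts \<Longrightarrow> tenv \<Gamma>"
  by (simp add: seq_ok_def)

lemma seq_ok_Cons [simp]:
  "seq_ok \<Gamma> ((c, \<phi>, y) # ts) \<longleftrightarrow>
    seq_ok \<Gamma> ts \<and> c \<notin> fst ` set ts \<and> Atom c \<notin> Domain \<Gamma> \<and> y \<in> carrier M \<Gamma> \<phi>"
  by (auto simp: seq_ok_def)

lemma seq_okD:
  "seq_ok \<Gamma> ts \<Longrightarrow> (c, \<phi>, y) \<in> set ts \<Longrightarrow> Atom c \<notin> Domain \<Gamma> \<and> y \<in> carrier M \<Gamma> \<phi>"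
  by (fastforce simp: seq_ok_def)

lemma seq_ok_append:
  "seq_ok \<Gamma> (ts @ us) \<longleftrightarrow> seq_ok \<Gamma> ts \<and> seq_ok \<Gamma> us \<and> fst ` set ts \<inter> fst ` set us = {}"
  by (auto simp: seq_ok_def)

lemma tenv_seq_env: "seq_ok \<Gamma> ts \<Longrightarrow> tenv (seq_env ts \<Gamma>)"
proof (induction ts)
  case (Cons t ts)
  obtain c \<phi> y where t: "t = (c, \<phi>, y)" by (cases t)
  then have "Atom c \<notin> Domain (seq_env ts \<Gamma>)" using Cons.prems by (auto simp: Domain_seq_env)
  then show ?case using Cons t by (auto intro: tenv_insert)
qed simp

lemma seq_ok_mono:
  assumes "seq_ok \<Gamma> ts" "tenv \<Gamma>'" "\<Gamma> \<subseteq> \<Gamma>'" "\<And>c. c \<in> fst ` set ts \<Longrightarrow> Atom c \<notin> Domain \<Gamma>'"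
  shows "seq_ok \<Gamma>' ts"
  using assms carrier_monoD unfolding seq_ok_def by fastforce

lemma seq_ok_seq_env:
  assumes "seq_ok \<Gamma> (ts @ us)"
  shows "seq_ok (seq_env ts \<Gamma>) us" "seq_ok (seq_env us \<Gamma>) ts"
proof -
  have ok: "seq_ok \<Gamma> ts" "seq_ok \<Gamma> us" "fst ` set ts \<inter> fst ` set us = {}"
    using assms by (simp_all add: seq_ok_append)
  have *: "Atom c \<notin> Domain \<Gamma>" if "c \<in> fst ` set ts \<or> c \<in> fst ` set us" for c
    using that ok(1,2) by (auto simp: seq_ok_def)
  show "seq_ok (seq_env ts \<Gamma>) us"
    using ok(3) * by (intro seq_ok_mono[OF ok(2) tenv_seq_env[OF ok(1)] subset_seq_env])
      (auto simp: Domain_seq_env)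
  show "seq_ok (seq_env us \<Gamma>) ts"
    using ok(3) * by (intro seq_ok_mono[OF ok(1) tenv_seq_env[OF ok(2)] subset_seq_env])
      (auto simp: Domain_seq_env)
qed

lemma seq_ok_ConsD:
  assumes "seq_ok \<Gamma> ((c, \<phi>, y) # ts)"
  shows "seq_ok \<Gamma> ts" "tenv (insert (Atom c, \<phi>) (seq_env ts \<Gamma>))" "y \<in> carrier M (seq_env ts \<Gamma>) \<phi>"
    "Atom c \<notin> Domain (seq_env ts \<Gamma>)"
proof -
  show ts: "seq_ok \<Gamma> ts" using assms by simp
  show "tenv (insert (Atom c, \<phi>) (seq_env ts \<Gamma>))" using tenv_seq_env[OF assms] by simp
  show "y \<in> carrier M (seq_env ts \<Gamma>) \<phi>"
    using assms carrier_mono[OF tenv_seq_env[OF ts] subset_seq_env] by auto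
  show "Atom c \<notin> Domain (seq_env ts \<Gamma>)"
    using assms by (auto simp: Domain_seq_env simp del: Domain_iff)
qed

section \<open>Laws of sequential substitution\<close>

lemma subst_seq_in:
  "seq_ok \<Gamma> ts \<Longrightarrow> z \<in> carrier M (seq_env ts \<Gamma>) \<psi> \<Longrightarrow> subst_seq M z ts \<in> carrier M \<Gamma> \<psi>"
proof (induction ts arbitrary: z)
  case (Cons t ts)
  obtain c \<phi> y where t: "t = (c, \<phi>, y)" by (cases t)
  note ok = seq_ok_ConsD[OF Cons.prems(1)[unfolded t]]
  have "esubst M c \<phi> z y \<in> carrier M (seq_env ts \<Gamma>) \<psi>"
    using Cons.prems(2) t ok by (intro esubst_in) simp_all
  then show ?case using Cons t by simp
qed simp

lemma subst_seq_fresh: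
  assumes "seq_ok \<Gamma> ts" "z \<in> carrier M \<Gamma> \<psi>"
  shows "subst_seq M z ts = z"
  using assms
proof (induction ts)
  case (Cons t ts)
  obtain c \<phi> y where t: "t = (c, \<phi>, y)" by (cases t)
  then have "esubst M c \<phi> z y = z" using Cons.prems by (intro esubst_fresh_carrier) (auto intro: seq_ok_tenv)
  then show ?case using Cons t by simp
qed simp

lemma subst_seq_atom:
  assumes "seq_ok \<Gamma> ts" "(c, \<phi>, y) \<in> set ts"
  shows "subst_seq M (atom_elt M c \<phi>) ts = y"
  using assms
proof (induction ts)
  case (Cons t ts)
  obtain d \<psi> x where t: "t = (d, \<psi>, x)" by (cases t)
  show ?case
  proof (cases "c = d")
    case True
    then have "t = (c, \<phi>, y)" using Cons.prems t by (force simp: seq_ok_def)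
    moreover from this have "esubst M c \<phi> (atom_elt M c \<phi>) y = y"
      using Cons.prems(1) by (intro esubst_atom[of c \<phi> \<Gamma>] tenv_insert) (auto intro: seq_ok_tenv)
    ultimately show ?thesis using Cons.prems(1) subst_seq_fresh[of \<Gamma> ts y \<phi>] by simp
  next
    case False
    let ?\<Gamma> = "insert (Atom c, \<phi>) \<Gamma>"
    have ts: "(c, \<phi>, y) \<in> set ts" using Cons.prems(2) t False by auto
    then have c: "Atom c \<notin> Domain \<Gamma>" using Cons.prems(1) t seq_okD by fastforce
    have \<Gamma>: "tenv ?\<Gamma>" using c Cons.prems(1) seq_ok_tenv by (blast intro: tenv_insert)
    have d: "Atom d \<notin> Domain ?\<Gamma>" using Cons.prems(1) t False by auto
    have "atom_elt M c \<phi> \<in> carrier M ?\<Gamma> \<phi>" by (rule atom_elt_in[OF \<Gamma>]) simp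
    moreover have "x \<in> carrier M ?\<Gamma> \<psi>" using Cons.prems(1) t \<Gamma> by (auto intro: carrier_monoD)
    ultimately have "esubst M d \<psi> (atom_elt M c \<phi>) x = atom_elt M c \<phi>"
      using \<Gamma> d by (intro esubst_fresh_carrier[of ?\<Gamma>])
    then show ?thesis using Cons t ts by simp
  qed
qed simp

lemma subst_seq_applic:
  assumes "seq_ok \<Gamma> ts" "z' \<in> carrier M (seq_env ts \<Gamma>) (\<psi> \<rightarrow>\<^sub>t \<psi>')" "z \<in> carrier M (seq_env ts \<Gamma>) \<psi>"
  shows "subst_seq M (applic M z' z) ts = applic M (subst_seq M z' ts) (subst_seq M z ts)"
  using assms
proof (induction ts arbitrary: z z')
  case (Cons t ts)
  obtain c \<phi> y where t: "t = (c, \<phi>, y)" by (cases t)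
  note ok = seq_ok_ConsD[OF Cons.prems(1)[unfolded t]]
  have "esubst M c \<phi> (applic M z' z) y = applic M (esubst M c \<phi> z' y) (esubst M c \<phi> z y)"
    using Cons.prems t ok by (intro esubst_applic[of _ _ "seq_env ts \<Gamma>"]) auto
  moreover have "esubst M c \<phi> z' y \<in> carrier M (seq_env ts \<Gamma>) (\<psi> \<rightarrow>\<^sub>t \<psi>')"
    "esubst M c \<phi> z y \<in> carrier M (seq_env ts \<Gamma>) \<psi>"
    using Cons.prems t ok by (auto intro: esubst_in)
  ultimately show ?case using Cons.IH ok t by simp
qed simp

lemma subst_seq_abstr:
  assumes "seq_ok \<Gamma> ts" "z \<in> carrier M (insert (Atom a, \<chi>) (seq_env ts \<Gamma>)) \<psi>"
    "Atom a \<notin> Domain (seq_env ts \<Gamma>)"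
  shows "subst_seq M (abstr M a \<chi> z) ts = abstr M a \<chi> (subst_seq M z ts)"
  using assms
proof (induction ts arbitrary: z)
  case (Cons t ts)
  obtain c \<phi> y where t: "t = (c, \<phi>, y)" by (cases t)
  note ok = seq_ok_ConsD[OF Cons.prems(1)[unfolded t]]
  have a: "Atom a \<notin> Domain (insert (Atom c, \<phi>) (seq_env ts \<Gamma>))" using Cons.prems(3) t by simp
  have a': "a \<noteq> c" "Atom a \<notin> Domain (seq_env ts \<Gamma>)" using a by auto
  have tenv: "tenv (seq_env ts \<Gamma>)" using ok(1) by (rule tenv_seq_env)
  have "esubst M c \<phi> (abstr M a \<chi> z) y = abstr M a \<chi> (esubst M c \<phi> z y)"
    using Cons.prems t ok a' tenv
    by (intro esubst_abstr[of a c \<chi> \<phi> "seq_env ts \<Gamma>" z \<psi>] tenv_insert fresh_carrier[of "seq_env ts \<Gamma>" y \<phi>])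
      auto
  moreover have "esubst M c \<phi> z y \<in> carrier M (insert (Atom a, \<chi>) (seq_env ts \<Gamma>)) \<psi>"
  proof (rule esubst_in)
    show "tenv (insert (Atom c, \<phi>) (insert (Atom a, \<chi>) (seq_env ts \<Gamma>)))"
      using tenv a' ok(4) by (intro tenv_insert) auto
    show "z \<in> carrier M (insert (Atom c, \<phi>) (insert (Atom a, \<chi>) (seq_env ts \<Gamma>))) \<psi>"
      using Cons.prems(2) t by (simp add: insert_commute)
    show "y \<in> carrier M (insert (Atom a, \<chi>) (seq_env ts \<Gamma>)) \<phi>"
      using ok(3) tenv a' by (auto intro: carrier_monoD tenv_insert)
  qed
  ultimately show ?case using Cons.IH ok t a' by simp
qed simp

lemma subst_seq_esubst:
  assumes ts: "seq_ok \<Gamma> ts" and a: "Atom a \<notin> Domain (seq_env ts \<Gamma>)"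
    and z: "z \<in> carrier M (insert (Atom a, \<chi>) (seq_env ts \<Gamma>)) \<psi>" and x: "x \<in> carrier M (seq_env ts \<Gamma>) \<chi>"
  shows "subst_seq M (esubst M a \<chi> z x) ts = esubst M a \<chi> (subst_seq M z ts) (subst_seq M x ts)"
proof -
  have "abstr M a \<chi> z \<in> carrier M (seq_env ts \<Gamma>) (\<chi> \<rightarrow>\<^sub>t \<psi>)"
    using z a tenv_seq_env[OF ts] by (intro abstr_in tenv_insert)
  then show ?thesis
    unfolding esubst_def using subst_seq_applic[OF ts _ x] subst_seq_abstr[OF ts z a] by simp
qed

text \<open>The values of \<open>us\<close> may mention the names of \<open>ts\<close>, so moving
  \<open>ts\<close> inwards rewrites them. Each induction step is \<open>subst_seq_esubst\<close>,
  used over \<Gamma> extended by the remaining names of \<open>us\<close>, since those still occur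
  in the element.\<close>

lemma subst_seq_subst_seq:
  assumes "seq_ok \<Gamma> ts" "seq_ok (seq_env ts \<Gamma>) us" "z \<in> carrier M (seq_env us (seq_env ts \<Gamma>)) \<psi>"
  shows "subst_seq M (subst_seq M z us) ts =
    subst_seq M (subst_seq M z ts) (map (\<lambda>(a, \<chi>, x). (a, \<chi>, subst_seq M x ts)) us)"
  using assms
proof (induction us arbitrary: z)
  case (Cons u us)
  obtain a \<chi> x where u: "u = (a, \<chi>, x)" by (cases u)
  note ok = seq_ok_ConsD[OF Cons.prems(2)[unfolded u]]
  have \<Gamma>: "\<Gamma> \<subseteq> seq_env us \<Gamma>" by (rule subset_seq_env)
  have eq: "seq_env us (seq_env ts \<Gamma>) = seq_env ts (seq_env us \<Gamma>)" by (rule seq_env_commute)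
  have "tenv (seq_env us \<Gamma>)"
    using tenv_seq_env[OF ok(1)] subset_seq_env unfolding eq by (rule tenv_subset)
  moreover have "Atom c \<notin> Domain (seq_env us \<Gamma>)" if c: "c \<in> fst ` set ts" for c
  proof -
    have "Atom c \<notin> Domain \<Gamma>" using c Cons.prems(1) by (force simp: seq_ok_def)
    moreover have "c \<notin> fst ` set us" using c ok(1) by (force simp: seq_ok_def Domain_seq_env)
    ultimately show ?thesis by (auto simp: Domain_seq_env)
  qed
  ultimately have ts: "seq_ok (seq_env us \<Gamma>) ts" using Cons.prems(1) \<Gamma> by (blast intro: seq_ok_mono)
  have "subst_seq M (esubst M a \<chi> z x) ts = esubst M a \<chi> (subst_seq M z ts) (subst_seq M x ts)"
    using ok Cons.prems u eq by (intro subst_seq_esubst[OF ts, of a z \<chi> \<psi> x]) auto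
  moreover have "esubst M a \<chi> z x \<in> carrier M (seq_env us (seq_env ts \<Gamma>)) \<psi>"
    using ok Cons.prems u by (intro esubst_in) auto
  ultimately show ?case using Cons.IH[OF Cons.prems(1) ok(1)] u by simp
qed simp

lemma subst_seq_commute:
  assumes ok: "seq_ok \<Gamma> (us @ ts)" and z: "z \<in> carrier M (seq_env (us @ ts) \<Gamma>) \<psi>"
  shows "subst_seq M z (us @ ts) = subst_seq M z (ts @ us)"
proof -
  have "map (\<lambda>(a, \<chi>, x). (a, \<chi>, subst_seq M x ts)) us = us"
  proof (rule map_idI)
    fix u assume "u \<in> set us"
    moreover obtain a \<chi> x where u: "u = (a, \<chi>, x)" by (cases u)
    ultimately have "x \<in> carrier M \<Gamma> \<chi>" using ok seq_okD[of \<Gamma> us] by (simp add: seq_ok_append)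
    then show "(case u of (a, \<chi>, x) \<Rightarrow> (a, \<chi>, subst_seq M x ts)) = u"
      using ok u subst_seq_fresh[of \<Gamma> ts] by (simp add: seq_ok_append)
  qed
  then show ?thesis
    using subst_seq_subst_seq[of \<Gamma> ts us z \<psi>] ok z seq_ok_seq_env(2)[of \<Gamma> us ts]
    by (simp add: seq_ok_append seq_ok_seq_env)
qed

text \<open>The head of \<open>ts'\<close> is moved to the front of \<open>ts\<close> by
  \<open>subst_seq_commute\<close>, over \<Gamma> extended by the names that follow it in
  \<open>ts\<close>; the induction then treats the rest.\<close>

lemma subst_seq_permute:
  assumes "seq_ok \<Gamma> ts" "set ts = set ts'" "distinct ts'" "z \<in> carrier M (seq_env ts \<Gamma>) \<psi>"
  shows "subst_seq M z ts = subst_seq M z ts'"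
  using assms
proof (induction ts' arbitrary: ts z)
  case (Cons t ts')
  then have "t \<in> set ts" by simp
  then obtain us vs where ts: "ts = us @ t # vs" by (meson split_list)
  obtain c \<phi> y where t: "t = (c, \<phi>, y)" by (cases t)
  have ok: "seq_ok \<Gamma> ((us @ [t]) @ vs)" using Cons.prems(1) ts by simp
  have ok': "seq_ok \<Gamma> ((c, \<phi>, y) # us @ vs)" using ok t by (auto simp: seq_ok_append)
  have "subst_seq M z (us @ [t]) = subst_seq M z ([t] @ us)"
    using Cons.prems(4) ts by (intro subst_seq_commute[OF seq_ok_seq_env(2)[OF ok]]) (simp add: t)
  then have "subst_seq M z ts = subst_seq M (esubst M c \<phi> z y) (us @ vs)"
    by (simp add: ts t)
  also have "\<dots> = subst_seq M (esubst M c \<phi> z y) ts'"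
  proof (rule Cons.IH)
    show "seq_ok \<Gamma> (us @ vs)" using ok' by simp
    have "t \<notin> set (us @ vs)" using ok' t by force
    then show "set (us @ vs) = set ts'" using Cons.prems(2,3) ts by auto
    show "distinct ts'" using Cons.prems(3) by simp
    have "z \<in> carrier M (insert (Atom c, \<phi>) (seq_env (us @ vs) \<Gamma>)) \<psi>"
      using Cons.prems(4) ts t by simp
    then show "esubst M c \<phi> z y \<in> carrier M (seq_env (us @ vs) \<Gamma>) \<psi>"
      using seq_ok_ConsD[OF ok'] by (intro esubst_in)
  qed
  finally show ?case using t by simp
qed simp

end

section \<open>Simultaneous substitution\<close>

definition renaming :: "(datom \<times> atom) list \<Rightarrow> atom perm" where
  "renaming ps = prod_list (map (\<lambda>(b, c). Perm.swap c (D b)) ps)"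

definition renamed_seq ::
  "(atom \<Rightarrow> 'b ty) \<Rightarrow> (datom, 'e) fmap \<Rightarrow> (datom \<times> atom) list \<Rightarrow> (atom \<times> 'b ty \<times> 'e) list" where
  "renamed_seq \<tau> m = map (\<lambda>(b, c). (c, \<tau> (D b), the (fmlookup m b)))"

text \<open>Freshness is demanded for an environment and not for individual elements. If
  \<open>subst_ok\<close> holds and the argument lies in a carrier of \<Gamma>, such names meet the
  demands made in \<open>simsubst\<close>. The converse fails, as names fresh for the elements may
  be typed in \<Gamma>.\<close>

definition fresh_names :: "('b, 'v) env \<Rightarrow> (datom, 'e) fmap \<Rightarrow> (datom \<times> atom) list \<Rightarrow> bool" where
  "fresh_names \<Gamma> m ps \<longleftrightarrow> distinct (map fst ps) \<and> distinct (map snd ps) \<and>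
    fst ` set ps = fmdom' m \<and> (\<forall>c\<in>snd ` set ps. Atom c \<notin> Domain \<Gamma>)"

lemma renamed_seq_append [simp]:
  "renamed_seq \<tau> m (ps @ qs) = renamed_seq \<tau> m ps @ renamed_seq \<tau> m qs"
  by (simp add: renamed_seq_def)

lemma fst_renamed_seq [simp]: "map fst (renamed_seq \<tau> m ps) = map snd ps"
  by (induction ps) (auto simp: renamed_seq_def)

lemma fst_set_renamed_seq [simp]: "fst ` set (renamed_seq \<tau> m ps) = snd ` set ps"
  by (force simp: renamed_seq_def)

lemma map_fst_map: "map fst (map (\<lambda>(c, \<phi>, y). (f c, \<phi>, g y)) ts) = map f (map fst ts)"
  by (induction ts) auto

lemma renaming_id:
  "a \<notin> D ` fst ` set ps \<Longrightarrow> a \<notin> snd ` set ps \<Longrightarrow> apply (renaming ps) a = a"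
  by (induction ps) (auto simp: renaming_def apply_times Perm.swap.rep_eq transpose_def)

text \<open>No atom occurs in two of the swaps, so \<open>D b\<close> and \<open>c\<close> are moved
  by their own swap alone.\<close>

lemma renaming_swaps:
  assumes "distinct (map fst ps)" "distinct (map snd ps)" "D ` fst ` set ps \<inter> snd ` set ps = {}"
    "(b, c) \<in> set ps"
  shows "apply (renaming ps) (D b) = c" "apply (renaming ps) c = D b"
proof -
  have "apply (renaming ps) (D b) = c \<and> apply (renaming ps) c = D b"
    using assms
  proof (induction ps)
    case (Cons p ps)
    obtain b' c' where p: "p = (b', c')" by (cases p)
    have app: "apply (renaming (p # ps)) a = apply (Perm.swap c' (D b')) (apply (renaming ps) a)" for a
      by (simp add: renaming_def p apply_times)
    show ?case
    proof (cases "(b, c) = p")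
      case True
      then have bc: "b' = b" "c' = c" using p by auto
      have "D b \<notin> D ` fst ` set ps" "D b \<notin> snd ` set ps" "c \<notin> D ` fst ` set ps" "c \<notin> snd ` set ps"
        using Cons.prems(1-3) p bc by auto
      then show ?thesis using bc by (simp add: app renaming_id Perm.swap.rep_eq)
    next
      case False
      then have bc: "(b, c) \<in> set ps" using Cons.prems(4) by auto
      then have "b \<in> fst ` set ps" "c \<in> snd ` set ps" by force+
      moreover have "b' \<notin> fst ` set ps" "c' \<notin> snd ` set ps" "D b' \<notin> snd ` set ps" "c' \<notin> D ` fst ` set ps"
        using Cons.prems(1-3) p by auto
      ultimately have "b \<noteq> b'" "c \<noteq> c'" "c \<noteq> D b'" "c' \<noteq> D b" by blast+
      moreover have "D ` fst ` set ps \<inter> snd ` set ps = {}" using Cons.prems(3) by auto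
      ultimately show ?thesis
        using Cons.IH bc Cons.prems(1,2) by (simp add: app Perm.swap.rep_eq transpose_def)
    qed
  qed simp
  then show "apply (renaming ps) (D b) = c" "apply (renaming ps) c = D b" by blast+
qed

lemma ex_fresh_list:
  assumes "finite (A :: atom set)"
  obtains cs where "length cs = n" "distinct cs" "set cs \<inter> A = {}"
proof -
  have "infinite (UNIV - A)" using assms infinite_UNIV_atom by (simp add: Diff_infinite_finite)
  then obtain C where "finite C" "card C = n" "C \<subseteq> UNIV - A"
    using infinite_arbitrarily_large by metis
  moreover then obtain cs where "set cs = C" "distinct cs" using finite_distinct_list by blast
  ultimately show thesis using that[of cs] distinct_card[of cs] by auto
qed

lemma fresh_names_zip:
  assumes "distinct bs" "set bs = fmdom' m" "length cs = length bs" "distinct cs"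
    "\<And>c. c \<in> set cs \<Longrightarrow> Atom c \<notin> Domain \<Gamma>"
  shows "fresh_names \<Gamma> m (zip bs cs)"
proof -
  have "map fst (zip bs cs) = bs" "map snd (zip bs cs) = cs" using assms(3) by simp_all
  moreover from this have "fst ` set (zip bs cs) = set bs" "snd ` set (zip bs cs) = set cs"
    by (metis list.set_map)+
  ultimately show ?thesis using assms unfolding fresh_names_def by simp
qed

lemma ex_fresh_names:
  assumes "tenv \<Gamma>" "finite A"
  obtains ps where "fresh_names \<Gamma> m ps" "snd ` set ps \<inter> A = {}"
proof -
  obtain bs where bs: "set bs = fmdom' m" "distinct bs"
    using finite_distinct_list[of "fmdom' m"] by auto
  have "finite (A \<union> {a. Atom a \<in> Domain \<Gamma>})" using assms finite_tenv by blast
  then obtain cs where cs: "length cs = length bs" "distinct cs"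
    "set cs \<inter> (A \<union> {a. Atom a \<in> Domain \<Gamma>}) = {}"
    by (rule ex_fresh_list)
  then have "fresh_names \<Gamma> m (zip bs cs)" using bs by (intro fresh_names_zip) auto
  moreover have "snd ` set (zip bs cs) \<inter> A = {}" using cs(3) by (auto dest: set_zip_rightD)
  ultimately show thesis by (rule that)
qed

lemma fresh_names_memD:
  assumes "fresh_names \<Gamma> m ps" "(b, c) \<in> set ps"
  shows "b \<in> fmdom' m" "Atom c \<notin> Domain \<Gamma>"
proof -
  have "b \<in> fst ` set ps" "c \<in> snd ` set ps" using assms(2) by force+
  then show "b \<in> fmdom' m" "Atom c \<notin> Domain \<Gamma>" using assms(1) unfolding fresh_names_def by blast+
qed

lemma fresh_names_ex:
  assumes "fresh_names \<Gamma> m ps" "b \<in> fmdom' m"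
  obtains c where "(b, c) \<in> set ps"
proof -
  have "b \<in> fst ` set ps" using assms unfolding fresh_names_def by blast
  then show thesis using that by auto
qed

lemma fresh_names_append:
  assumes "fresh_names \<Gamma> m ps" "fresh_names \<Gamma> n qs" "snd ` set ps \<inter> snd ` set qs = {}"
    "fmdom' m \<inter> fmdom' n = {}" "fmdom' k = fmdom' m \<union> fmdom' n"
  shows "fresh_names \<Gamma> k (ps @ qs)"
  using assms unfolding fresh_names_def by (simp add: image_Un) blast

lemma fresh_names_subset: "fresh_names \<Gamma> m ps \<Longrightarrow> \<Delta> \<subseteq> \<Gamma> \<Longrightarrow> fresh_names \<Delta> m ps"
  by (auto simp: fresh_names_def)

context nominal_model
begin

definition subst_ok ::
  "('b, 'v) env \<Rightarrow> (atom \<Rightarrow> 'b ty) \<Rightarrow> (datom, 'e) fmap \<Rightarrow> bool" where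
  "subst_ok \<Gamma> \<tau> m \<longleftrightarrow> tenv \<Gamma> \<and>
    (\<forall>b y. fmlookup m b = Some y \<longrightarrow> (Atom (D b), \<tau> (D b)) \<in> \<Gamma> \<and> y \<in> carrier M \<Gamma> (\<tau> (D b)))"

lemma subst_okD:
  assumes "subst_ok \<Gamma> \<tau> m" "fmlookup m b = Some y"
  shows "(Atom (D b), \<tau> (D b)) \<in> \<Gamma>" "y \<in> carrier M \<Gamma> (\<tau> (D b))"
  using assms by (simp_all add: subst_ok_def)

lemma subst_ok_tenv: "subst_ok \<Gamma> \<tau> m \<Longrightarrow> tenv \<Gamma>"
  by (simp add: subst_ok_def)

lemma fresh_names_lookup:
  assumes "fresh_names \<Gamma> m ps" "(b, c) \<in> set ps"
  obtains y where "fmlookup m b = Some y"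
proof -
  have "b \<in> fmdom' m" using assms by (rule fresh_names_memD)
  then show thesis using that by (auto simp: fmlookup_dom'_iff)
qed

lemma fresh_names_disjoint:
  assumes "subst_ok \<Gamma> \<tau> m" "fresh_names \<Gamma> m ps"
  shows "D ` fst ` set ps \<inter> snd ` set ps = {}"
proof -
  have "Atom (D b) \<in> Domain \<Gamma>" if "b \<in> fst ` set ps" for b
  proof -
    have "b \<in> fmdom' m" using that assms(2) by (simp add: fresh_names_def)
    then show ?thesis using subst_okD(1)[OF assms(1)] by (auto simp: fmlookup_dom'_iff)
  qed
  then show ?thesis using assms(2) unfolding fresh_names_def by blast
qed

lemma renaming_names:
  assumes "subst_ok \<Gamma> \<tau> m" "fresh_names \<Gamma> m ps" "(b, c) \<in> set ps"
  shows "apply (renaming ps) (D b) = c" "apply (renaming ps) c = D b"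
  using renaming_swaps[OF _ _ fresh_names_disjoint[OF assms(1,2)] assms(3)] assms(2)
  by (simp_all add: fresh_names_def)

lemma renaming_env:
  assumes "fresh_names \<Gamma> m ps" "Atom a \<in> Domain \<Gamma>" "a \<notin> D ` fmdom' m"
  shows "apply (renaming ps) a = a"
  using assms by (intro renaming_id) (auto simp: fresh_names_def)

lemma seq_ok_renamed:
  assumes "subst_ok \<Gamma> \<tau> m" "fresh_names \<Gamma> m ps"
  shows "seq_ok \<Gamma> (renamed_seq \<tau> m ps)"
  unfolding seq_ok_def
proof (intro conjI ballI)
  fix t assume "t \<in> set (renamed_seq \<tau> m ps)"
  then obtain b c where t: "t = (c, \<tau> (D b), the (fmlookup m b))" "(b, c) \<in> set ps"
    by (auto simp: renamed_seq_def)
  show "Atom (fst t) \<notin> Domain \<Gamma>" using t fresh_names_memD[OF assms(2)] by simp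
  obtain y where "fmlookup m b = Some y" using fresh_names_lookup[OF assms(2) t(2)] .
  then show "snd (snd t) \<in> carrier M \<Gamma> (fst (snd t))" using subst_okD(2)[OF assms(1)] t(1) by simp
qed (use assms in \<open>auto simp: subst_ok_def fresh_names_def\<close>)

text \<open>Every \<open>D b\<close> of the domain moves to a name of the same type, and the other
  typed atoms stay put. The target keeps the typings of the \<open>D b\<close>, because the values
  substituted afterwards may mention these atoms.\<close>

lemma act_renaming_in:
  assumes ok: "subst_ok \<Gamma> \<tau> m" "fresh_names \<Gamma> m ps" and x: "x \<in> carrier M \<Gamma> \<phi>"
  shows "action M (renaming ps) x \<in> carrier M (seq_env (renamed_seq \<tau> m ps) \<Gamma>) \<phi>"
proof (rule act_carrier[OF x tenv_seq_env[OF seq_ok_renamed[OF ok]] _ subst_ok_tenv[OF ok(1)]])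
  show "env_perm (renaming ps) \<Gamma> \<subseteq> seq_env (renamed_seq \<tau> m ps) \<Gamma>"
  proof (rule env_perm_subsetI)
    fix n \<psi> assume n: "(n, \<psi>) \<in> \<Gamma>"
    show "(name_perm (renaming ps) n, \<psi>) \<in> seq_env (renamed_seq \<tau> m ps) \<Gamma>"
    proof (cases n)
      case (Unknown X)
      then show ?thesis using n by (simp add: seq_env_def)
    next
      case (Atom a)
      show ?thesis
      proof (cases "a \<in> D ` fmdom' m")
        case True
        then obtain b y where b: "a = D b" "fmlookup m b = Some y" by (auto simp: fmlookup_dom'_iff)
        then have "\<psi> = \<tau> (D b)"
          using tenv_unique[OF subst_ok_tenv[OF ok(1)]] subst_okD(1)[OF ok(1)] n Atom by blast
        moreover obtain c where c: "(b, c) \<in> set ps"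
          using fresh_names_ex[OF ok(2) fmdom'I[OF b(2)]] .
        then have "(c, \<tau> (D b), the (fmlookup m b)) \<in> set (renamed_seq \<tau> m ps)"
          by (force simp: renamed_seq_def)
        then have "(Atom c, \<tau> (D b)) \<in> seq_env (renamed_seq \<tau> m ps) \<Gamma>"
          by (force simp: seq_env_def)
        ultimately show ?thesis using renaming_names(1)[OF ok c] Atom b(1) by simp
      next
        case False
        have "Atom a \<in> Domain \<Gamma>" using Atom n by auto
        then have "apply (renaming ps) a = a" using False by (rule renaming_env[OF ok(2)])
        then show ?thesis using Atom n by (simp add: seq_env_def)
      qed
    qed
  qed
qed

lemma subst_seq_eqvt:
  assumes "seq_ok \<Gamma> ts" "z \<in> carrier M (seq_env ts \<Gamma>) \<psi>"
  shows "action M \<pi> (subst_seq M z ts) =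
    subst_seq M (action M \<pi> z) (map (\<lambda>(c, \<phi>, y). (apply \<pi> c, \<phi>, action M \<pi> y)) ts)"
  using assms
proof (induction ts arbitrary: z)
  case (Cons t ts)
  obtain c \<phi> y where t: "t = (c, \<phi>, y)" by (cases t)
  note ok = seq_ok_ConsD[OF Cons.prems(1)[unfolded t]]
  have z: "z \<in> carrier M (insert (Atom c, \<phi>) (seq_env ts \<Gamma>)) \<psi>" using Cons.prems(2) t by simp
  show ?case
    using Cons.IH[OF ok(1) esubst_in[OF ok(2) z ok(3)]] esubst_eqvt[OF ok(2) z ok(3)] t by simp
qed simp

text \<open>This is an equivariance argument. The permutation \<rho> carries each fresh name of
  \<open>ps\<close> to its counterpart in \<open>qs\<close> but fixes all atoms typed in \<Gamma>.
  So it fixes the values of \<open>m\<close> and also the result, which lies in a carrier of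
  \<Gamma>; applying it rewrites one side into the other.\<close>

lemma renamed_seq_cong:
  assumes ok: "subst_ok \<Gamma> \<tau> m" and x: "x \<in> carrier M \<Gamma> \<phi>"
    and ps: "fresh_names \<Gamma> m ps" and qs: "fresh_names \<Gamma> m qs" and disj: "snd ` set ps \<inter> snd ` set qs = {}"
  shows "subst_seq M (action M (renaming ps) x) (renamed_seq \<tau> m ps) =
    subst_seq M (action M (renaming qs) x) (renamed_seq \<tau> m qs)"
proof -
  \<comment> \<open>The conjugation exchanges the two families of fresh names but, unlike \<open>renaming qs * renaming ps\<close>,
    fixes the atoms being substituted for, which may occur in the values of \<open>m\<close>.\<close>
  define \<rho> where "\<rho> = renaming ps * (renaming qs * renaming ps)"
  note tenv = subst_ok_tenv[OF ok]
  have nin: "Atom c \<notin> Domain \<Gamma>" if "c \<in> snd ` set ps \<or> c \<in> snd ` set qs" for c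
    using that ps qs by (auto simp: fresh_names_def)
  have names: "apply \<rho> c = c'" "apply \<rho> (D b) = D b" "apply (renaming ps) (D b) = c"
    "apply (renaming qs) (D b) = c'"
    if "(b, c) \<in> set ps" "(b, c') \<in> set qs" for b c c'
  proof -
    have env: "Atom (D b') \<in> Domain \<Gamma>" if "b' \<in> fmdom' m" for b'
      using that subst_okD(1)[OF ok] by (auto simp: fmlookup_dom'_iff)
    have c: "c \<in> snd ` set ps" "c' \<in> snd ` set qs" using that by force+
    have "fst ` set ps = fmdom' m" "fst ` set qs = fmdom' m" using ps qs by (simp_all add: fresh_names_def)
    then have "c \<notin> D ` fst ` set qs" "c' \<notin> D ` fst ` set ps" using env nin c by blast+
    moreover have "c \<notin> snd ` set qs" "c' \<notin> snd ` set ps" using c disj by blast+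
    ultimately have "apply (renaming qs) c = c" "apply (renaming ps) c' = c'"
      by (blast intro: renaming_id)+
    then show "apply \<rho> c = c'" "apply \<rho> (D b) = D b" "apply (renaming ps) (D b) = c"
      "apply (renaming qs) (D b) = c'"
      using renaming_names[OF ok ps that(1)] renaming_names[OF ok qs that(2)]
      by (simp_all add: \<rho>_def apply_times)
  qed
  have cs: "\<exists>c c'. (b, c) \<in> set ps \<and> (b, c') \<in> set qs" if "b \<in> fmdom' m" for b
    using that fresh_names_ex[OF ps] fresh_names_ex[OF qs] by metis
  have \<rho>: "apply \<rho> a = a" "apply (\<rho> * renaming ps) a = apply (renaming qs) a"
    if a: "Atom a \<in> Domain \<Gamma>" for a
  proof -
    show "apply \<rho> a = a"
      using cs names(2) renaming_env[OF ps a] renaming_env[OF qs a]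
      by (cases "a \<in> D ` fmdom' m") (auto simp: \<rho>_def apply_times)
    show "apply (\<rho> * renaming ps) a = apply (renaming qs) a"
    proof (cases "a \<in> D ` fmdom' m")
      case True
      then obtain b c c' where "a = D b" "(b, c) \<in> set ps" "(b, c') \<in> set qs" using cs by blast
      then show ?thesis using names by (simp add: apply_times)
    next
      case False
      then show ?thesis using renaming_env[OF ps a] renaming_env[OF qs a] \<open>apply \<rho> a = a\<close>
        by (simp add: apply_times)
    qed
  qed
  let ?ts = "map (\<lambda>(c, \<phi>, y). (apply \<rho> c, \<phi>, action M \<rho> y)) (renamed_seq \<tau> m ps)"
  note in_ps = seq_ok_renamed[OF ok ps] act_renaming_in[OF ok ps x]
  have y: "action M \<rho> y = y" if "fmlookup m b = Some y" for b y
    using act_fixes[OF tenv subst_okD(2)[OF ok that]] \<rho>(1) by blast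
  have "subst_seq M (action M (renaming ps) x) (renamed_seq \<tau> m ps) =
      action M \<rho> (subst_seq M (action M (renaming ps) x) (renamed_seq \<tau> m ps))"
    using act_fixes[OF tenv subst_seq_in[OF in_ps]] \<rho>(1) by simp
  also have "\<dots> = subst_seq M (action M (\<rho> * renaming ps) x) ?ts"
    by (simp add: subst_seq_eqvt[OF in_ps] act_times)
  also have "action M (\<rho> * renaming ps) x = action M (renaming qs) x"
    using \<rho>(2) by (rule act_agree[OF tenv x])
  also have "subst_seq M (action M (renaming qs) x) ?ts =
      subst_seq M (action M (renaming qs) x) (renamed_seq \<tau> m qs)"
  \<comment> \<open>The two families may enumerate the domain of \<open>m\<close> in different
    orders.\<close>
  proof (rule subst_seq_permute[symmetric, OF seq_ok_renamed[OF ok qs] _ _ act_renaming_in[OF ok qs x]])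
    have "map fst ?ts = map (apply \<rho>) (map fst (renamed_seq \<tau> m ps))" by (rule map_fst_map)
    also have "\<dots> = map (apply \<rho>) (map snd ps)" by (simp only: fst_renamed_seq)
    finally have "distinct (map fst ?ts)"
      using ps by (simp add: fresh_names_def distinct_map comp_inj_on inj_on_def apply_inj)
    then show "distinct ?ts" by (simp only: distinct_map)
    have "(apply \<rho> c, \<tau> (D b), action M \<rho> (the (fmlookup m b))) = (c', \<tau> (D b), the (fmlookup m b))"
      if bc: "(b, c) \<in> set ps" "(b, c') \<in> set qs" for b c c'
    proof -
      obtain y where "fmlookup m b = Some y" using fresh_names_lookup[OF ps bc(1)] .
      then show ?thesis using y names(1)[OF bc] by simp
    qed
    moreover have "\<exists>c'. (b, c') \<in> set qs" if "(b, c) \<in> set ps" for b c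
      using fresh_names_memD(1)[OF ps that] fresh_names_ex[OF qs] by metis
    moreover have "\<exists>c. (b, c) \<in> set ps" if "(b, c') \<in> set qs" for b c'
      using fresh_names_memD(1)[OF qs that] fresh_names_ex[OF ps] by metis
    ultimately have "(\<lambda>(b, c). (c, \<tau> (D b), the (fmlookup m b))) ` set qs =
        (\<lambda>(b, c). (apply \<rho> c, \<tau> (D b), action M \<rho> (the (fmlookup m b)))) ` set ps"
      by (intro equalityI subsetI) (clarsimp, metis (mono_tags, lifting) case_prod_conv image_eqI)+
    then show "set (renamed_seq \<tau> m qs) = set ?ts"
      by (simp add: renamed_seq_def image_image case_prod_unfold)
  qed
  finally show ?thesis .
qed

text \<open>From here on an argument may use fresh names of its own choice, for instance common ones
  for several elements, in place of those picked inside \<open>simsubst\<close>.\<close>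

lemma simsubst_eq:
  assumes ok: "subst_ok \<Gamma> \<tau> m" and x: "x \<in> carrier M \<Gamma> \<phi>" and ps: "fresh_names \<Gamma> m ps"
  shows "simsubst M \<tau> x m = subst_seq M (action M (renaming ps) x) (renamed_seq \<tau> m ps)"
proof -
  note tenv = subst_ok_tenv[OF ok]
  define bs where "bs = (SOME bs. distinct bs \<and> set bs = fmdom' m)"
  let ?P = "\<lambda>cs. length cs = length bs \<and> distinct cs \<and>
    (\<forall>c\<in>set cs. c \<notin> D ` set bs \<and> fresh M c x \<and> (\<forall>y\<in>fmran' m. fresh M c y))"
  define cs where "cs = (SOME cs. ?P cs)"
  have bs: "distinct bs" "set bs = fmdom' m"
    using someI_ex[of "\<lambda>bs. distinct bs \<and> set bs = fmdom' m"] finite_distinct_list[of "fmdom' m"]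
    by (auto simp: bs_def)
  have "\<exists>cs. ?P cs"
  proof -
    have "finite (D ` set bs \<union> {a. Atom a \<in> Domain \<Gamma>})" using finite_tenv[OF tenv] by simp
    then obtain cs where "length cs = length bs" "distinct cs"
      "set cs \<inter> (D ` set bs \<union> {a. Atom a \<in> Domain \<Gamma>}) = {}"
      by (rule ex_fresh_list)
    moreover have "fresh M c y" if "y \<in> fmran' m" "Atom c \<notin> Domain \<Gamma>" for c y
    proof -
      obtain b where "fmlookup m b = Some y" using \<open>y \<in> fmran' m\<close> by (auto simp: fmlookup_ran'_iff)
      then show ?thesis using subst_okD(2)[OF ok] fresh_carrier[OF tenv] that(2) by blast
    qed
    ultimately show ?thesis using fresh_carrier[OF tenv x] by (intro exI[of _ cs]) blast
  qed
  then have cs: "length cs = length bs" "distinct cs"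
    "\<And>c. c \<in> set cs \<Longrightarrow> c \<notin> D ` set bs \<and> fresh M c x \<and> (\<forall>y\<in>fmran' m. fresh M c y)"
    using someI_ex[of ?P] unfolding cs_def by blast+
  have "simsubst M \<tau> x m = subst_seq M (action M (renaming (zip bs cs)) x) (renamed_seq \<tau> m (zip bs cs))"
    unfolding simsubst_def Let_def bs_def[symmetric] cs_def[symmetric]
    by (simp add: renaming_def renamed_seq_def subst_seq_def foldl_map case_prod_unfold)
  \<comment> \<open>The names \<open>cs\<close> are fresh for the elements but possibly typed in
    \<Gamma>. Dropping their typings keeps \<open>x\<close>, the values and the atoms
    \<open>D b\<close> in place and makes \<open>cs\<close> fresh for the environment.\<close>
  moreover define \<Delta> where "\<Delta> = {(n, \<psi>) \<in> \<Gamma>. n \<notin> Atom ` set cs}"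
  have sub: "\<Delta> \<subseteq> \<Gamma>" by (auto simp: \<Delta>_def)
  have ok': "subst_ok \<Delta> \<tau> m"
    unfolding subst_ok_def
  proof (intro conjI allI impI)
    fix b y assume b: "fmlookup m b = Some y"
    then have "y \<in> fmran' m" "b \<in> set bs" using bs(2) by (auto simp: fmran'I fmdom'I)
    then show "y \<in> carrier M \<Delta> (\<tau> (D b))" "(Atom (D b), \<tau> (D b)) \<in> \<Delta>"
      using cs(3) subst_okD[OF ok b] tenv unfolding \<Delta>_def by (auto intro!: carrier_remove_fresh_set)
  qed (rule tenv_subset[OF tenv sub])
  have x': "x \<in> carrier M \<Delta> \<phi>"
    unfolding \<Delta>_def using cs(3) x tenv by (intro carrier_remove_fresh_set) auto
  have names: "fresh_names \<Delta> m (zip bs cs)"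
    using bs cs by (intro fresh_names_zip) (auto simp: \<Delta>_def)
  \<comment> \<open>\<open>renamed_seq_cong\<close> compares only families without common names;
    \<open>qs\<close> avoids both families and serves as an intermediary.\<close>
  obtain qs where qs: "fresh_names \<Gamma> m qs" "snd ` set qs \<inter> (snd ` set ps \<union> set cs) = {}"
    by (rule ex_fresh_names[OF tenv, of "snd ` set ps \<union> set cs"]) auto
  have "subst_seq M (action M (renaming (zip bs cs)) x) (renamed_seq \<tau> m (zip bs cs)) =
      subst_seq M (action M (renaming qs) x) (renamed_seq \<tau> m qs)"
  proof (rule renamed_seq_cong[OF ok' x' names fresh_names_subset[OF qs(1) sub]])
    have "snd ` set (zip bs cs) \<subseteq> set cs" by (auto dest: set_zip_rightD)
    then show "snd ` set (zip bs cs) \<inter> snd ` set qs = {}" using qs(2) by blast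
  qed
  moreover have "subst_seq M (action M (renaming qs) x) (renamed_seq \<tau> m qs) =
      subst_seq M (action M (renaming ps) x) (renamed_seq \<tau> m ps)"
    using qs by (intro renamed_seq_cong[OF ok x _ ps]) auto
  ultimately show ?thesis by simp
qed

section \<open>Laws of simultaneous substitution\<close>

lemma simsubst_in:
  assumes ok: "subst_ok \<Gamma> \<tau> m" and x: "x \<in> carrier M \<Gamma> \<phi>"
  shows "simsubst M \<tau> x m \<in> carrier M \<Gamma> \<phi>"
proof -
  obtain ps where ps: "fresh_names \<Gamma> m ps"
    by (rule ex_fresh_names[OF subst_ok_tenv[OF ok] finite.emptyI])
  then show ?thesis
    using subst_seq_in[OF seq_ok_renamed[OF ok ps] act_renaming_in[OF ok ps x]] simsubst_eq[OF ok x ps]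
    by simp
qed

lemma simsubst_atom:
  assumes ok: "subst_ok \<Gamma> \<tau> m" and a: "(Atom a, \<phi>) \<in> \<Gamma>"
  shows "simsubst M \<tau> (atom_elt M a \<phi>) m =
    (case fmlookup (demb m) a of Some y \<Rightarrow> y | None \<Rightarrow> atom_elt M a \<phi>)"
proof -
  note tenv = subst_ok_tenv[OF ok]
  obtain ps where ps: "fresh_names \<Gamma> m ps"
    by (rule ex_fresh_names[OF tenv finite.emptyI])
  have elt: "atom_elt M a \<phi> \<in> carrier M \<Gamma> \<phi>" using atom_elt_in[OF tenv a] .
  note eq = simsubst_eq[OF ok elt ps] and seq = seq_ok_renamed[OF ok ps]
  show ?thesis
  proof (cases "fmlookup (demb m) a")
    case None
    then have "a \<notin> D ` fmdom' m" by (auto simp: fmlookup_dom'_iff)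
    then have "apply (renaming ps) a = a" using renaming_env[OF ps] a by blast
    then show ?thesis using None eq subst_seq_fresh[OF seq elt] by (simp add: atom_elt_eqvt)
  next
    case (Some y)
    then obtain b where b: "a = D b" "fmlookup m b = Some y" by (cases a) auto
    have "\<phi> = \<tau> (D b)" using tenv_unique[OF tenv a] subst_okD(1)[OF ok b(2)] b(1) by simp
    moreover obtain c where c: "(b, c) \<in> set ps"
      using fresh_names_ex[OF ps fmdom'I[OF b(2)]] .
    then have "(c, \<tau> (D b), y) \<in> set (renamed_seq \<tau> m ps)"
      using b(2) by (force simp: renamed_seq_def)
    ultimately show ?thesis
      using Some eq b subst_seq_atom[OF seq] renaming_names(1)[OF ok ps c] by (simp add: atom_elt_eqvt)
  qed
qed

lemma simsubst_const:
  assumes ok: "subst_ok \<Gamma> \<tau> m"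
  shows "simsubst M \<tau> (const_elt M C) m = const_elt M C"
proof -
  note tenv = subst_ok_tenv[OF ok]
  obtain ps where ps: "fresh_names \<Gamma> m ps"
    by (rule ex_fresh_names[OF tenv finite.emptyI])
  show ?thesis
    using simsubst_eq[OF ok const_elt_in[OF tenv] ps]
      subst_seq_fresh[OF seq_ok_renamed[OF ok ps] const_elt_in[OF tenv]]
    by (simp add: const_elt_eqvt)
qed

lemma simsubst_applic:
  assumes ok: "subst_ok \<Gamma> \<tau> m" and x: "x \<in> carrier M \<Gamma> (\<phi> \<rightarrow>\<^sub>t \<psi>)" and y: "y \<in> carrier M \<Gamma> \<phi>"
  shows "simsubst M \<tau> (applic M x y) m = applic M (simsubst M \<tau> x m) (simsubst M \<tau> y m)"
proof -
  note tenv = subst_ok_tenv[OF ok]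
  obtain ps where ps: "fresh_names \<Gamma> m ps"
    by (rule ex_fresh_names[OF tenv finite.emptyI])
  show ?thesis
    using subst_seq_applic[OF seq_ok_renamed[OF ok ps] act_renaming_in[OF ok ps x] act_renaming_in[OF ok ps y]]
    by (simp add: simsubst_eq[OF ok x ps] simsubst_eq[OF ok y ps]
        simsubst_eq[OF ok applic_in[OF tenv x y] ps] applic_eqvt[OF tenv x y])
qed

lemma subst_ok_mono: "subst_ok \<Gamma> \<tau> m \<Longrightarrow> tenv \<Gamma>' \<Longrightarrow> \<Gamma> \<subseteq> \<Gamma>' \<Longrightarrow> subst_ok \<Gamma>' \<tau> m"
  using carrier_monoD unfolding subst_ok_def by blast

lemma simsubst_abstr:
  assumes ok: "subst_ok \<Gamma> \<tau> m" and c: "Atom (U c) \<notin> Domain \<Gamma>"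
    and z: "z \<in> carrier M (insert (Atom (U c), \<chi>) \<Gamma>) \<psi>"
  shows "simsubst M \<tau> (abstr M (U c) \<chi> z) m = abstr M (U c) \<chi> (simsubst M \<tau> z m)"
proof -
  let ?\<Gamma> = "insert (Atom (U c), \<chi>) \<Gamma>"
  have tenv: "tenv ?\<Gamma>" using subst_ok_tenv[OF ok] c by (rule tenv_insert)
  have ok': "subst_ok ?\<Gamma> \<tau> m" using ok tenv by (rule subst_ok_mono) auto
  \<comment> \<open>Names fresh for the larger environment avoid the bound atom. Being no
    \<open>D b\<close>, it is then fixed by the renaming and is not among the substituted
    names.\<close>
  obtain ps where ps: "fresh_names ?\<Gamma> m ps"
    by (rule ex_fresh_names[OF tenv finite.emptyI])
  then have ps': "fresh_names \<Gamma> m ps" by (rule fresh_names_subset) auto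
  have "apply (renaming ps) (U c) = U c" using ps by (intro renaming_env[of ?\<Gamma> m]) auto
  moreover have "Atom (U c) \<notin> Domain (seq_env (renamed_seq \<tau> m ps) \<Gamma>)"
  proof -
    have "Atom (U c) \<in> Domain ?\<Gamma>" by simp
    then have "U c \<notin> snd ` set ps" using ps unfolding fresh_names_def by blast
    then show ?thesis using c unfolding Domain_seq_env fst_set_renamed_seq by blast
  qed
  moreover have "action M (renaming ps) z \<in> carrier M (insert (Atom (U c), \<chi>) (seq_env (renamed_seq \<tau> m ps) \<Gamma>)) \<psi>"
    using act_renaming_in[OF ok' ps z] by simp
  ultimately show ?thesis
    using subst_seq_abstr[OF seq_ok_renamed[OF ok ps']]
    by (simp add: simsubst_eq[OF ok' z ps] simsubst_eq[OF ok abstr_in[OF tenv z] ps'] abstr_eqvt[OF tenv z])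
qed

text \<open>Only permutations of the form \<open>atom_perm \<pi>\<close> are considered. They fix
  every \<open>D b\<close>, so the domain of the map is unchanged and only the argument, the values
  and the fresh names move. A second type assignment \<tau>' is allowed so that each side can take
  its types from its own environment.\<close>

lemma simsubst_eqvt:
  assumes ok: "subst_ok \<Gamma> \<tau> m" and x: "x \<in> carrier M \<Gamma> \<phi>"
    and \<Gamma>': "tenv \<Gamma>'" "env_perm (atom_perm \<pi>) \<Gamma> \<subseteq> \<Gamma>'"
    and \<tau>: "\<And>b. b \<in> fmdom' m \<Longrightarrow> \<tau>' (D b) = \<tau> (D b)"
  shows "action M (atom_perm \<pi>) (simsubst M \<tau> x m) =
    simsubst M \<tau>' (action M (atom_perm \<pi>) x) (fmmap (action M (atom_perm \<pi>)) m)"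
proof -
  let ?\<pi> = "atom_perm \<pi>"
  note tenv = subst_ok_tenv[OF ok]
  \<comment> \<open>The images of the fresh names have to be untyped in \<Gamma>', so the preimage
    of its typed atoms is avoided.\<close>
  have "finite (apply ?\<pi> -` {a. Atom a \<in> Domain \<Gamma>'})"
    using finite_tenv[OF \<Gamma>'(1)] by (rule finite_vimageI) (simp add: inj_def apply_inj)
  then obtain ps where ps: "fresh_names \<Gamma> m ps"
    and ps': "snd ` set ps \<inter> apply ?\<pi> -` {a. Atom a \<in> Domain \<Gamma>'} = {}"
    by (rule ex_fresh_names[OF tenv])
  define qs where "qs = map (\<lambda>(b, c). (b, apply ?\<pi> c)) ps"
  have fst_snd: "map fst qs = map fst ps" "map snd qs = map (apply ?\<pi>) (map snd ps)"
    by (simp_all add: qs_def case_prod_unfold)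
  then have fst_snd': "fst ` set qs = fst ` set ps" "snd ` set qs = apply ?\<pi> ` snd ` set ps"
    by (metis list.set_map)+
  have "distinct (map snd qs)"
    using ps unfolding fst_snd by (simp add: distinct_map fresh_names_def comp_inj_on inj_on_def apply_inj)
  then have qs: "fresh_names \<Gamma>' (fmmap (action M ?\<pi>) m) qs"
    using ps ps' unfolding fresh_names_def fst_snd' fst_snd(1) by auto
  have ok': "subst_ok \<Gamma>' \<tau>' (fmmap (action M ?\<pi>) m)"
    unfolding subst_ok_def
  proof (intro conjI allI impI \<Gamma>'(1))
    fix b y assume "fmlookup (fmmap (action M ?\<pi>) m) b = Some y"
    then obtain y' where y: "fmlookup m b = Some y'" "y = action M ?\<pi> y'" by auto
    have "(name_perm ?\<pi> (Atom (D b)), \<tau> (D b)) \<in> env_perm ?\<pi> \<Gamma>"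
      using subst_okD(1)[OF ok y(1)] by (rule env_permI)
    then show "(Atom (D b), \<tau>' (D b)) \<in> \<Gamma>'" using \<Gamma>'(2) \<tau>[OF fmdom'I[OF y(1)]] by auto
    show "y \<in> carrier M \<Gamma>' (\<tau>' (D b))"
      using act_carrier[OF subst_okD(2)[OF ok y(1)] \<Gamma>' tenv] \<tau>[OF fmdom'I[OF y(1)]] y(2) by simp
  qed
  have x': "action M ?\<pi> x \<in> carrier M \<Gamma>' \<phi>" using act_carrier[OF x \<Gamma>' tenv] .
  have seq: "map (\<lambda>(c, \<phi>, y). (apply ?\<pi> c, \<phi>, action M ?\<pi> y)) (renamed_seq \<tau> m ps)
      = renamed_seq \<tau>' (fmmap (action M ?\<pi>) m) qs"
    unfolding renamed_seq_def qs_def map_map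
  proof (rule map_cong[OF refl], clarsimp)
    fix b c assume bc: "(b, c) \<in> set ps"
    obtain y where "fmlookup m b = Some y" using fresh_names_lookup[OF ps bc] .
    then show "\<tau> (D b) = \<tau>' (D b) \<and>
        action M ?\<pi> (the (fmlookup m b)) = the (map_option (action M ?\<pi>) (fmlookup m b))"
      using \<tau>[OF fmdom'I] by simp
  qed
  have "action M (?\<pi> * renaming ps) x = action M (renaming qs * ?\<pi>) x"
  proof (rule act_agree[OF tenv x])
    fix a assume a: "Atom a \<in> Domain \<Gamma>"
    show "apply (?\<pi> * renaming ps) a = apply (renaming qs * ?\<pi>) a"
    proof (cases "a \<in> D ` fmdom' m")
      case True
      then obtain b c where bc: "a = D b" "(b, c) \<in> set ps"
        using fresh_names_ex[OF ps] by blast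
      then have "(b, apply ?\<pi> c) \<in> set qs" by (force simp: qs_def)
      then show ?thesis
        using renaming_names(1)[OF ok ps bc(2)] renaming_names(1)[OF ok' qs] bc(1)
        by (simp add: apply_times)
    next
      case False
      obtain \<psi> where "(Atom a, \<psi>) \<in> \<Gamma>" using a by auto
      then have "Atom (apply ?\<pi> a) \<in> Domain \<Gamma>'" using env_permI[of "Atom a" \<psi> \<Gamma> ?\<pi>] \<Gamma>'(2) by auto
      moreover have "apply ?\<pi> a \<notin> D ` fmdom' m" using False by (cases a) auto
      ultimately show ?thesis
        using renaming_env[OF qs] renaming_env[OF ps a False] by (simp add: apply_times)
    qed
  qed
  then show ?thesis
    using subst_seq_eqvt[OF seq_ok_renamed[OF ok ps] act_renaming_in[OF ok ps x], of ?\<pi>]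
    by (simp add: simsubst_eq[OF ok x ps] simsubst_eq[OF ok' x' qs] seq act_times)
qed

text \<open>The domain of \<open>n\<close> is split: \<open>bs\<close> names its part outside the
  domain of \<open>k\<close>, and \<open>es\<close> the part inside. Then \<open>n\<close> is
  computed with \<open>bs @ es\<close>, \<open>k\<close> with \<open>ks\<close>, and the combined
  map with \<open>bs @ ks\<close>. In \<open>x\<close> the atoms common to both domains are renamed
  by \<open>ks\<close> before \<open>n\<close> can see them, so \<open>es\<close> matters only for
  the values of \<open>k\<close>.\<close>

lemma simsubst_simsubst:
  assumes k: "subst_ok \<Gamma> \<tau> k" and n: "subst_ok \<Gamma> \<tau> n" and x: "x \<in> carrier M \<Gamma> \<phi>"
  shows "simsubst M \<tau> (simsubst M \<tau> x k) n =
    simsubst M \<tau> x (n ++\<^sub>f fmmap (\<lambda>y. simsubst M \<tau> y n) k)"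
proof -
  note tenv = subst_ok_tenv[OF k]
  let ?k = "fmmap (\<lambda>y. simsubst M \<tau> y n) k"
  obtain ks where ks: "fresh_names \<Gamma> k ks"
    by (rule ex_fresh_names[OF tenv finite.emptyI])
  obtain bs where bs: "fresh_names \<Gamma> (fmdrop_set (fmdom' k) n) bs" "snd ` set bs \<inter> snd ` set ks = {}"
    by (rule ex_fresh_names[OF tenv, of "snd ` set ks"]) auto
  obtain es where es: "fresh_names \<Gamma> (fmrestrict_set (fmdom' k) n) es"
    "snd ` set es \<inter> (snd ` set bs \<union> snd ` set ks) = {}"
    by (rule ex_fresh_names[OF tenv, of "snd ` set bs \<union> snd ` set ks"]) auto
  have restr: "fmdom' (fmrestrict_set (fmdom' k) n) = fmdom' n \<inter> fmdom' k"
    by (rule set_eqI) (auto simp: fmlookup_dom'_iff split: if_splits)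
  have dom: "fst ` set ks = fmdom' k" "fst ` set bs = fmdom' n - fmdom' k"
    "fst ` set es = fmdom' n \<inter> fmdom' k"
    using ks bs(1) es(1) restr by (simp_all add: fresh_names_def)
  have be: "fresh_names \<Gamma> n (bs @ es)"
    using es(2) restr by (intro fresh_names_append[OF bs(1) es(1)]) auto
  have bk: "fresh_names \<Gamma> (n ++\<^sub>f ?k) (bs @ ks)"
    using bs(2) by (intro fresh_names_append[OF bs(1) ks]) auto
  have ok: "subst_ok \<Gamma> \<tau> (n ++\<^sub>f ?k)"
    using k n simsubst_in[OF n] by (auto simp: subst_ok_def split: if_splits)
  let ?P = "renaming (bs @ es)" and ?z = "action M (renaming (bs @ ks)) x"
  define K where "K = renamed_seq \<tau> k ks"
  define K' where "K' = renamed_seq \<tau> (n ++\<^sub>f ?k) ks"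
  define B where "B = renamed_seq \<tau> n bs"
  define E where "E = renamed_seq \<tau> n es"
  define K1 where "K1 = map (\<lambda>(c, \<phi>, y). (apply ?P c, \<phi>, action M ?P y)) K"
  have "renamed_seq \<tau> (n ++\<^sub>f ?k) bs = B"
    unfolding B_def renamed_seq_def using dom(2) by (intro map_cong) (force simp: fmlookup_dom'_iff)+
  then have BK': "renamed_seq \<tau> (n ++\<^sub>f ?k) (bs @ ks) = B @ K'" by (simp add: K'_def)
  have P_ks: "apply ?P c = c" if "c \<in> snd ` set ks" for c
  proof (rule renaming_id)
    show "c \<notin> snd ` set (bs @ es)" using that bs(2) es(2) by auto
    have "Atom c \<notin> Domain \<Gamma>" using that ks unfolding fresh_names_def by blast
    moreover have "Atom (D b) \<in> Domain \<Gamma>" if "b \<in> fst ` set (bs @ es)" for b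
    proof -
      have "b \<in> fmdom' n" using that be unfolding fresh_names_def by blast
      then show ?thesis using subst_okD(1)[OF n] by (auto simp: fmlookup_dom'_iff)
    qed
    ultimately show "c \<notin> D ` fst ` set (bs @ es)" by blast
  qed
  \<comment> \<open>An atom in the domain of \<open>k\<close> has already become its name in
    \<open>ks\<close>, which \<open>?P\<close> leaves alone. So on \<Gamma> the \<open>es\<close>
    part of \<open>?P\<close> does nothing after the renaming by \<open>ks\<close>.\<close>
  have Pz: "action M (?P * renaming ks) x = ?z"
  proof (rule act_agree[OF tenv x])
    fix a assume a: "Atom a \<in> Domain \<Gamma>"
    consider b c where "a = D b" "(b, c) \<in> set ks" | b c where "a = D b" "(b, c) \<in> set bs" "b \<notin> fmdom' k"
      | "a \<notin> D ` (fmdom' n \<union> fmdom' k)"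
    proof (cases "a \<in> D ` (fmdom' n \<union> fmdom' k)")
      case True
      then obtain b where b: "a = D b" "b \<in> fmdom' n \<union> fmdom' k" by blast
      show ?thesis
      proof (cases "b \<in> fmdom' k")
        case True
        then show ?thesis using fresh_names_ex[OF ks] that(1) b(1) by blast
      next
        case False
        then have "b \<in> fst ` set bs" using dom(2) b(2) by blast
        then show ?thesis using False that(2) b(1) by auto
      qed
    qed (rule that(3))
    then show "apply (?P * renaming ks) a = apply (renaming (bs @ ks)) a"
    proof cases
      case (1 b c)
      then show ?thesis
        using P_ks[of c] renaming_names(1)[OF k ks] renaming_names(1)[OF ok bk, of b c]
        by (force simp: apply_times)
    next
      case (2 b c)
      then have "apply (renaming ks) a = a" using renaming_env[OF ks a] by blast
      then show ?thesis
        using 2 renaming_names(1)[OF n be, of b c] renaming_names(1)[OF ok bk, of b c]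
        by (simp add: apply_times)
    next
      case 3
      then show ?thesis
        using renaming_env[OF ks a] renaming_env[OF be a] renaming_env[OF bk a]
        by (simp add: apply_times image_Un)
    qed
  qed
  have act_P: "subst_seq M (action M ?P y) (B @ E) = simsubst M \<tau> y n" if "y \<in> carrier M \<Gamma> \<psi>" for y \<psi>
    using simsubst_eq[OF n that be] by (simp add: B_def E_def)
  have elt: "apply ?P (snd p) = snd p \<and>
      subst_seq M (action M ?P (the (fmlookup k (fst p)))) (B @ E) = the (fmlookup (n ++\<^sub>f ?k) (fst p))"
    if "p \<in> set ks" for p
  proof -
    have p: "(fst p, snd p) \<in> set ks" using that by simp
    obtain y where y: "fmlookup k (fst p) = Some y" using fresh_names_lookup[OF ks p] .
    moreover have "snd p \<in> snd ` set ks" using that by simp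
    ultimately show ?thesis
      using P_ks subst_okD(2)[OF k y] act_P fmdomI[OF y]
      by (simp del: subst_seq_simps)
  qed
  have K'_eq: "map (\<lambda>(a, \<chi>, x). (a, \<chi>, subst_seq M x (B @ E))) K1 = K'"
    using elt by (simp add: K1_def K_def K'_def renamed_seq_def case_prod_unfold del: subst_seq_simps)
  have seq_be: "seq_ok \<Gamma> (B @ E)" using seq_ok_renamed[OF n be] by (simp add: B_def E_def)
  have seq_bk: "seq_ok \<Gamma> (B @ K')" using seq_ok_renamed[OF ok bk] by (simp only: BK')
  have fsts: "fst ` set K' = snd ` set ks" "fst ` set E = snd ` set es" "fst ` set B = snd ` set bs"
    "fst ` set K = snd ` set ks"
    by (simp_all add: K'_def E_def B_def K_def)
  have seq_ke: "seq_ok \<Gamma> (K' @ E)"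
    using seq_be seq_bk es(2) by (auto simp: seq_ok_append fsts)
  have map_K1: "map fst K1 = map snd ks"
  proof -
    have "map fst K1 = map (apply ?P) (map fst K)" unfolding K1_def by (rule map_fst_map)
    also have "\<dots> = map (apply ?P) (map snd ks)" by (simp only: K_def fst_renamed_seq)
    also have "\<dots> = map snd ks" using P_ks by (intro map_idI) auto
    finally show ?thesis .
  qed
  then have fst_K1: "fst ` set K1 = snd ` set ks" by (metis list.set_map)
  \<comment> \<open>The values in \<open>K1\<close> are those of \<open>k\<close> renamed by
    \<open>?P\<close>, so they may mention the names of both \<open>B\<close> and \<open>E\<close>;
    applying \<open>B @ E\<close> to them yields the values in \<open>K'\<close>.\<close>
  have K1: "seq_ok (seq_env (B @ E) \<Gamma>) K1"
    unfolding seq_ok_def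
  proof (intro conjI ballI tenv_seq_env seq_be)
    show "distinct (map fst K1)" using ks map_K1 by (simp add: fresh_names_def)
    fix t assume t: "t \<in> set K1"
    then have "fst t \<in> snd ` set ks" using fst_K1 by blast
    then have "fst t \<notin> fst ` set B" "fst t \<notin> fst ` set E" "Atom (fst t) \<notin> Domain \<Gamma>"
      using bs(2) es(2) ks unfolding fresh_names_def fsts by blast+
    then show "Atom (fst t) \<notin> Domain (seq_env (B @ E) \<Gamma>)"
      unfolding seq_env_simps Domain_seq_env by blast
    obtain c \<psi> y where y: "(c, \<psi>, y) \<in> set K" "t = (apply ?P c, \<psi>, action M ?P y)"
      using t by (auto simp: K1_def)
    have "y \<in> carrier M \<Gamma> \<psi>" using seq_okD[OF seq_ok_renamed[OF k ks]] y(1) unfolding K_def by blast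
    then show "snd (snd t) \<in> carrier M (seq_env (B @ E) \<Gamma>) (fst (snd t))"
      using act_renaming_in[OF n be] y(2) by (simp add: B_def E_def)
  qed
  have env_K1: "seq_env K1 (seq_env (B @ E) \<Gamma>) = seq_env E (seq_env (B @ K') \<Gamma>)"
    unfolding K'_eq[symmetric] by (simp add: seq_env_def image_Un image_image case_prod_unfold Un_ac)
  have z: "?z \<in> carrier M (seq_env (B @ K') \<Gamma>) \<phi>"
    using act_renaming_in[OF ok bk x] by (simp only: BK')
  have z': "?z \<in> carrier M (seq_env K1 (seq_env (B @ E) \<Gamma>)) \<phi>"
    using tenv_seq_env[OF K1] by (rule carrier_monoD[OF z]) (simp only: env_K1 subset_seq_env)
  have "simsubst M \<tau> (simsubst M \<tau> x k) n = subst_seq M (action M ?P (simsubst M \<tau> x k)) (B @ E)"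
    using simsubst_eq[OF n simsubst_in[OF k x] be] by (simp add: B_def E_def)
  also have "action M ?P (simsubst M \<tau> x k) = subst_seq M ?z K1"
    using subst_seq_eqvt[OF seq_ok_renamed[OF k ks] act_renaming_in[OF k ks x], of ?P]
      simsubst_eq[OF k x ks] Pz by (simp add: K1_def K_def act_times)
  also have "subst_seq M \<dots> (B @ E) = subst_seq M (subst_seq M ?z (B @ E)) K'"
    using subst_seq_subst_seq[OF seq_be K1 z'] K'_eq by simp
  \<comment> \<open>Once \<open>B\<close> has acted, only the names of \<open>K'\<close> remain
    beyond \<Gamma>, and those of \<open>E\<close> are not among them.\<close>
  also have "subst_seq M ?z (B @ E) = subst_seq M ?z B"
  proof -
    have "subst_seq M ?z B \<in> carrier M (seq_env K' \<Gamma>) \<phi>"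
      using z by (intro subst_seq_in seq_ok_seq_env(2)[OF seq_bk]) simp
    then show ?thesis using subst_seq_fresh[OF seq_ok_seq_env(1)[OF seq_ke]] by simp
  qed
  also have "subst_seq M \<dots> K' = simsubst M \<tau> x (n ++\<^sub>f ?k)"
    using simsubst_eq[OF ok x bk] by (simp only: BK' subst_seq_simps)
  finally show ?thesis .
qed

end

section \<open>Interpretation\<close>

lemma atom_type_cong:
  "(\<And>\<phi>. (Atom a, \<phi>) \<in> \<Gamma> \<longleftrightarrow> (Atom a, \<phi>) \<in> \<Gamma>') \<Longrightarrow> atom_type \<Gamma> a = atom_type \<Gamma>' a"
  by (simp add: atom_type_def)

text \<open>The sets of typed atoms coincide, so both sides choose the same binders and neither
  renaming nor typing enters. This lets the typing of an unknown be dropped from the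
  environment.\<close>

lemma interp_atoms_cong:
  assumes "\<And>a \<phi>. (Atom a, \<phi>) \<in> \<Gamma> \<longleftrightarrow> (Atom a, \<phi>) \<in> \<Gamma>'"
  shows "interp M \<zeta> \<Gamma> t = interp M \<zeta> \<Gamma>' t"
  using assms
proof (induction "height t" arbitrary: t \<Gamma> \<Gamma>' rule: less_induct)
  case less
  have atoms: "{c. Atom (U c) \<in> Domain \<Gamma>} = {c. Atom (U c) \<in> Domain \<Gamma>'}"
    using less.prems by auto
  have types: "atom_type \<Gamma> = atom_type \<Gamma>'" using less.prems by (intro ext atom_type_cong)
  let ?l = "layer_of {c. Atom (U c) \<in> Domain \<Gamma>'} t"
  show ?case
  proof (cases ?l)
    case (LUnk X m)
    have "fmmap (interp M \<zeta> \<Gamma>) m = fmmap (interp M \<zeta> \<Gamma>') m"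
      using less.hyps less.prems height_layer(1)[OF LUnk] by (intro fmap.map_cong0) blast
    then show ?thesis by (subst (1 2) interp.simps) (simp add: atoms types LUnk)
  next
    case (LLam c \<phi> r)
    have "interp M \<zeta> (insert (Atom (U c), \<phi>) \<Gamma>) r = interp M \<zeta> (insert (Atom (U c), \<phi>) \<Gamma>') r"
      using less.prems by (intro less.hyps height_layer(2)[OF LLam]) auto
    then show ?thesis by (subst (1 2) interp.simps) (simp add: atoms LLam)
  next
    case (LApp r s)
    have "interp M \<zeta> \<Gamma> r = interp M \<zeta> \<Gamma>' r" "interp M \<zeta> \<Gamma> s = interp M \<zeta> \<Gamma>' s"
      using less.hyps less.prems height_layer(3,4)[OF LApp] by blast+
    then show ?thesis by (subst (1 2) interp.simps) (simp add: atoms LApp)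
  qed (subst (1 2) interp.simps, simp add: atoms types)+
qed

context nominal_model
begin

lemma satisfies_insert_atom:
  assumes "satisfies M \<Gamma> \<zeta>" "tenv (insert (Atom a, \<phi>) \<Gamma>)"
  shows "satisfies M (insert (Atom a, \<phi>) \<Gamma>) \<zeta>"
  using assms(1) carrier_mono[OF assms(2) subset_insertI] unfolding satisfies_def by auto

lemma subst_ok_interp:
  assumes "tenv \<Gamma>"
    and "\<And>b s. fmlookup m b = Some s \<Longrightarrow> \<exists>\<psi>. (Atom (D b), \<psi>) \<in> \<Gamma> \<and> f s \<in> carrier M \<Gamma> \<psi>"
  shows "subst_ok \<Gamma> (atom_type \<Gamma>) (fmmap f m)"
  using assms by (fastforce simp: subst_ok_def atom_type_eq)

lemma interp_in:
  assumes "typing ctype \<Gamma> r \<phi>" "satisfies M \<Gamma> \<zeta>"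
  shows "interp M \<zeta> \<Gamma> r \<in> carrier M \<Gamma> \<phi>"
  using assms
proof (induction rule: typing_fresh_induct)
  case (Atm \<Gamma> a \<phi>)
  then show ?case by (simp add: atom_type_eq atom_elt_in)
next
  case (Cst \<Gamma> C)
  then show ?case by (simp add: const_elt_in)
next
  case (Lam \<Gamma> c \<phi> r \<psi>)
  obtain d s where eq: "Lam c \<phi> r = Lam d \<phi> s" and d: "Atom (U d) \<notin> Domain \<Gamma>"
    and int: "interp M \<zeta> \<Gamma> (Lam c \<phi> r) = abstr M (U d) \<phi> (interp M \<zeta> (insert (Atom (U d), \<phi>) \<Gamma>) s)"
    by (rule interp_Lam[OF typing_tenv[OF Lam.hyps(1)]])
  have tenv: "tenv (insert (Atom (U d), \<phi>) \<Gamma>)" using typing_tenv[OF Lam.hyps(1)] d by (rule tenv_insert)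
  then show ?case
    unfolding int using Lam.IH[OF eq d] satisfies_insert_atom[OF Lam.prems] by (blast intro: abstr_in)
next
  case (App \<Gamma> r \<phi> \<psi> s)
  then show ?case by (auto intro: applic_in typing_tenv)
next
  case (Unk \<Gamma> X \<phi> m)
  have "subst_ok \<Gamma> (atom_type \<Gamma>) (fmmap (interp M \<zeta> \<Gamma>) m)"
    using Unk by (intro subst_ok_interp) blast+
  moreover have "\<zeta> X \<in> carrier M \<Gamma> \<phi>" using Unk by (simp add: satisfies_def)
  ultimately show ?case by (simp add: simsubst_in)
qed

text \<open>Equivariance and weakening are proved together, since going below an abstraction renames its
  bound atom differently in the two environments.\<close>

lemma interp_perm_mono:
  assumes "typing ctype \<Gamma> r \<phi>" "satisfies M \<Gamma> \<zeta>" "tenv \<Gamma>'" "env_perm (atom_perm \<pi>) \<Gamma> \<subseteq> \<Gamma>'"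
    and "\<And>X \<phi>. (Unknown X, \<phi>) \<in> \<Gamma> \<Longrightarrow> \<zeta>' X = action M (atom_perm \<pi>) (\<zeta> X)"
  shows "interp M \<zeta>' \<Gamma>' (tperm \<pi> r) = action M (atom_perm \<pi>) (interp M \<zeta> \<Gamma> r)"
  using assms
proof (induction arbitrary: \<pi> \<Gamma>' rule: typing_fresh_induct)
  case (Atm \<Gamma> a \<phi>)
  have "(Atom (apply (atom_perm \<pi>) a), \<phi>) \<in> \<Gamma>'"
    using env_permI[OF Atm(2), of "atom_perm \<pi>"] Atm.prems(3) by auto
  then show ?case
    using Atm by (simp add: atom_type_eq atom_elt_eqvt apply_atom_perm)
next
  case (Cst \<Gamma> C)
  then show ?case by (simp add: const_elt_eqvt)
next
  case (Lam \<Gamma> c \<phi> r \<psi>)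
  have \<Gamma>: "tenv \<Gamma>" using typing_tenv[OF Lam.hyps(1)] .
  obtain d s where eq: "Lam c \<phi> r = Lam d \<phi> s" and d: "Atom (U d) \<notin> Domain \<Gamma>"
    and int: "interp M \<zeta> \<Gamma> (Lam c \<phi> r) = abstr M (U d) \<phi> (interp M \<zeta> (insert (Atom (U d), \<phi>) \<Gamma>) s)"
    by (rule interp_Lam[OF \<Gamma>])
  obtain d' s' where eq': "Lam (apply \<pi> c) \<phi> (tperm \<pi> r) = Lam d' \<phi> s'" and d': "Atom (U d') \<notin> Domain \<Gamma>'"
    and int': "interp M \<zeta>' \<Gamma>' (Lam (apply \<pi> c) \<phi> (tperm \<pi> r)) =
      abstr M (U d') \<phi> (interp M \<zeta>' (insert (Atom (U d'), \<phi>) \<Gamma>') s')"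
    by (rule interp_Lam[OF Lam.prems(2)])
  define \<rho> where "\<rho> = Perm.swap d' (apply \<pi> d) * \<pi>"
  have "Lam (apply \<pi> d) \<phi> (tperm \<pi> s) = Lam d' \<phi> s'"
    using eq' arg_cong[OF eq, of "tperm \<pi>"] by simp
  then have s': "s' = tperm \<rho> s" by (simp add: Lam_eqD(2) \<rho>_def tperm_times)
  have tenv: "tenv (insert (Atom (U d), \<phi>) \<Gamma>)" using \<Gamma> d by (rule tenv_insert)
  have env: "env_perm (atom_perm \<rho>) (insert (Atom (U d), \<phi>) \<Gamma>) \<subseteq> insert (Atom (U d'), \<phi>) \<Gamma>'"
    unfolding \<rho>_def using tenv Lam.prems(3) d' by (rule env_perm_rebind)
  \<comment> \<open>\<rho> redirects \<pi> at the binder but agrees with it on \<Gamma>. Hence both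
    act alike on the values of the typed unknowns and, at the end, on the completed abstraction,
    which lies in a carrier of \<Gamma>.\<close>
  have agree: "apply (atom_perm \<rho>) a = apply (atom_perm \<pi>) a" if a: "Atom a \<in> Domain \<Gamma>" for a
  proof -
    have "Atom (apply (atom_perm \<pi>) a) \<in> Domain \<Gamma>'"
      using a env_permI[of "Atom a" _ \<Gamma> "atom_perm \<pi>"] Lam.prems(3) by fastforce
    then have "Atom a \<noteq> Atom (U d)" "name_perm (atom_perm \<pi>) (Atom a) \<noteq> Atom (U d')"
      using a d d' by auto
    from name_perm_rebind[OF this] show ?thesis by (simp add: \<rho>_def)
  qed
  have sat: "satisfies M (insert (Atom (U d), \<phi>) \<Gamma>) \<zeta>" using Lam.prems(1) tenv by (rule satisfies_insert_atom)
  note s = Lam.IH[OF eq d]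
  let ?i = "interp M \<zeta> (insert (Atom (U d), \<phi>) \<Gamma>) s"
  have i: "?i \<in> carrier M (insert (Atom (U d), \<phi>) \<Gamma>) \<psi>" using s sat interp_in by blast
  have "\<zeta>' X = action M (atom_perm \<rho>) (\<zeta> X)" if "(Unknown X, \<theta>) \<in> insert (Atom (U d), \<phi>) \<Gamma>" for X \<theta>
    using that Lam.prems(1,4) act_agree[OF \<Gamma> _ agree, of "\<zeta> X" \<theta>] by (auto simp: satisfies_def)
  then have "interp M \<zeta>' (insert (Atom (U d'), \<phi>) \<Gamma>') s' = action M (atom_perm \<rho>) ?i"
    unfolding s' using s sat env Lam.prems(2) d' by (blast intro: tenv_insert)
  then have "interp M \<zeta>' \<Gamma>' (tperm \<pi> (Lam c \<phi> r)) = action M (atom_perm \<rho>) (abstr M (U d) \<phi> ?i)"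
    using int' abstr_eqvt[OF tenv i, of "atom_perm \<rho>"]
    by (simp add: \<rho>_def apply_times Perm.swap.rep_eq)
  also have "\<dots> = action M (atom_perm \<pi>) (abstr M (U d) \<phi> ?i)"
    using agree by (rule act_agree[OF \<Gamma> abstr_in[OF tenv i]])
  finally show ?case by (simp only: int)
next
  case (App \<Gamma> r \<phi> \<psi> s)
  then have "interp M \<zeta>' \<Gamma>' (tperm \<pi> r) = action M (atom_perm \<pi>) (interp M \<zeta> \<Gamma> r)"
    "interp M \<zeta>' \<Gamma>' (tperm \<pi> s) = action M (atom_perm \<pi>) (interp M \<zeta> \<Gamma> s)"
    by blast+
  then show ?case
    using applic_eqvt[OF typing_tenv[OF App.hyps(1)] interp_in[OF App.hyps(1) App.prems(1)]
        interp_in[OF App.hyps(2) App.prems(1)]] by simp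
next
  case (Unk \<Gamma> X \<phi> m)
  have ok: "subst_ok \<Gamma> (atom_type \<Gamma>) (fmmap (interp M \<zeta> \<Gamma>) m)"
    using Unk(1,3) interp_in Unk.prems(1) by (intro subst_ok_interp) blast+
  have x: "\<zeta> X \<in> carrier M \<Gamma> \<phi>" using Unk by (simp add: satisfies_def)
  have "atom_type \<Gamma>' (D b) = atom_type \<Gamma> (D b)" if b: "b \<in> fmdom' (fmmap (interp M \<zeta> \<Gamma>) m)" for b
  proof -
    obtain s where "fmlookup m b = Some s" using b by (auto simp: fmlookup_dom'_iff)
    then obtain \<psi> where \<psi>: "(Atom (D b), \<psi>) \<in> \<Gamma>" using Unk(3) by blast
    then have "(Atom (D b), \<psi>) \<in> \<Gamma>'" using env_permI[OF \<psi>, of "atom_perm \<pi>"] Unk.prems(3) by auto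
    then show ?thesis using \<psi> Unk(1) Unk.prems(2) by (simp add: atom_type_eq)
  qed
  note eqvt = simsubst_eqvt[OF ok x Unk.prems(2,3) this]
  have "fmmap (interp M \<zeta>' \<Gamma>' \<circ> tperm \<pi>) m = fmmap (action M (atom_perm \<pi>) \<circ> interp M \<zeta> \<Gamma>) m"
  proof (rule fmap.map_cong0)
    fix s assume "s \<in> fmran' m"
    then obtain b where b: "fmlookup m b = Some s" by (auto simp: fmlookup_ran'_iff)
    show "(interp M \<zeta>' \<Gamma>' \<circ> tperm \<pi>) s = (action M (atom_perm \<pi>) \<circ> interp M \<zeta> \<Gamma>) s"
      using Unk(3)[OF b] Unk.prems unfolding comp_def by blast
  qed
  then show ?case
    using eqvt Unk.prems(4)[OF Unk(2)] by (simp add: fmap.map_comp)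
qed

lemma interp_mono:
  assumes "typing ctype \<Gamma> r \<phi>" "satisfies M \<Gamma> \<zeta>" "tenv \<Gamma>'" "\<Gamma> \<subseteq> \<Gamma>'"
  shows "interp M \<zeta> \<Gamma>' r = interp M \<zeta> \<Gamma> r"
  using interp_perm_mono[of \<Gamma> r \<phi> \<zeta> \<Gamma>' 1 \<zeta>] assms by simp

text \<open>By \<open>interp_perm_mono\<close> the bodies for \<open>c\<close> and for the binder
  chosen by \<open>interp\<close> differ by a swap of the two atoms. Neither is typed in \<Gamma>,
  so the swap fixes the abstraction, whose carrier is that of \<Gamma>.\<close>

lemma interp_Lam_fresh:
  assumes r: "typing ctype \<Gamma> (Lam c \<phi> r) \<chi>" and sat: "satisfies M \<Gamma> \<zeta>" and c: "Atom (U c) \<notin> Domain \<Gamma>"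
  shows "interp M \<zeta> \<Gamma> (Lam c \<phi> r) = abstr M (U c) \<phi> (interp M \<zeta> (insert (Atom (U c), \<phi>) \<Gamma>) r)"
proof -
  have \<Gamma>: "tenv \<Gamma>" using typing_tenv[OF r] .
  obtain \<psi> where \<psi>: "typing ctype (insert (Atom (U c), \<phi>) \<Gamma>) r \<psi>"
    using typing_Lam_fresh[OF r c] by blast
  obtain d s where eq: "Lam c \<phi> r = Lam d \<phi> s" and d: "Atom (U d) \<notin> Domain \<Gamma>"
    and int: "interp M \<zeta> \<Gamma> (Lam c \<phi> r) = abstr M (U d) \<phi> (interp M \<zeta> (insert (Atom (U d), \<phi>) \<Gamma>) s)"
    by (rule interp_Lam[OF \<Gamma>])
  let ?\<pi> = "atom_perm (Perm.swap d c)" and ?\<Gamma> = "insert (Atom (U c), \<phi>) \<Gamma>"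
  have tenv: "tenv ?\<Gamma>" "tenv (insert (Atom (U d), \<phi>) \<Gamma>)" using \<Gamma> c d by (simp_all add: tenv_insert)
  have id: "apply ?\<pi> a = a" if "Atom a \<in> Domain \<Gamma>" for a
    using that c d by (auto simp: atom_perm_swap Perm.swap.rep_eq transpose_def)
  have i: "interp M \<zeta> ?\<Gamma> r \<in> carrier M ?\<Gamma> \<psi>" using interp_in[OF \<psi> satisfies_insert_atom[OF sat tenv(1)]] .
  have "interp M \<zeta> (insert (Atom (U d), \<phi>) \<Gamma>) (tperm (Perm.swap d c) r) = action M ?\<pi> (interp M \<zeta> ?\<Gamma> r)"
  proof (rule interp_perm_mono[OF \<psi> satisfies_insert_atom[OF sat tenv(1)] tenv(2)])
    show "env_perm ?\<pi> ?\<Gamma> \<subseteq> insert (Atom (U d), \<phi>) \<Gamma>"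
      using env_perm_rebind[OF tenv(1), of 1 \<Gamma> d] d by simp
    show "\<zeta> X = action M ?\<pi> (\<zeta> X)" if "(Unknown X, \<theta>) \<in> ?\<Gamma>" for X \<theta>
      using that sat act_fixes[OF \<Gamma> _ id, of "\<zeta> X" \<theta>] by (simp add: satisfies_def)
  qed
  then have "interp M \<zeta> \<Gamma> (Lam c \<phi> r) = action M ?\<pi> (abstr M (U c) \<phi> (interp M \<zeta> ?\<Gamma> r))"
    using int abstr_eqvt[OF tenv(1) i, of ?\<pi>] Lam_eqD(2)[OF eq] by (simp add: Perm.swap.rep_eq)
  also have "\<dots> = abstr M (U c) \<phi> (interp M \<zeta> ?\<Gamma> r)"
    using id by (rule act_fixes[OF \<Gamma> abstr_in[OF tenv(1) i]])
  finally show ?thesis .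
qed

section \<open>Interpreting the two levels of substitution\<close>

lemma simsubst_type_cong:
  assumes ok: "subst_ok \<Gamma> \<tau> m" and x: "x \<in> carrier M \<Gamma> \<phi>"
    and "\<And>b. b \<in> fmdom' m \<Longrightarrow> \<tau>' (D b) = \<tau> (D b)"
  shows "simsubst M \<tau>' x m = simsubst M \<tau> x m"
proof -
  have "action M 1 = (\<lambda>y. y)" by (rule ext) simp
  then show ?thesis
    using simsubst_eqvt[OF ok x subst_ok_tenv[OF ok], of 1 \<tau>'] assms(3) by (simp add: fmap.map_ident)
qed

lemma interp_subst1:
  assumes "typing ctype \<Gamma> t \<phi>" "satisfies M \<Gamma> \<zeta>"
    and "\<And>b s. fmlookup n b = Some s \<Longrightarrow> \<exists>\<psi>. (Atom (D b), \<psi>) \<in> \<Gamma> \<and> typing ctype \<Gamma> s \<psi>"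
  shows "interp M \<zeta> \<Gamma> (subst1 (demb n) t) =
    simsubst M (atom_type \<Gamma>) (interp M \<zeta> \<Gamma> t) (fmmap (interp M \<zeta> \<Gamma>) n)"
  using assms
proof (induction rule: typing_fresh_induct)
  case (Atm \<Gamma> a \<phi>)
  have "subst_ok \<Gamma> (atom_type \<Gamma>) (fmmap (interp M \<zeta> \<Gamma>) n)"
    using Atm interp_in by (intro subst_ok_interp) blast+
  from simsubst_atom[OF this Atm(2)] show ?case
    using Atm(1,2) by (cases a) (auto simp: atom_type_eq split: option.splits)
next
  case (Cst \<Gamma> C)
  have "subst_ok \<Gamma> (atom_type \<Gamma>) (fmmap (interp M \<zeta> \<Gamma>) n)"
    using Cst interp_in by (intro subst_ok_interp) blast+
  then show ?case by (simp add: simsubst_const)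
next
  case (Lam \<Gamma> c \<phi> r \<psi>)
  have \<Gamma>: "tenv \<Gamma>" using typing_tenv[OF Lam.hyps(1)] .
  then obtain d s where eq: "Lam c \<phi> r = Lam d \<phi> s" and d: "Atom (U d) \<notin> Domain \<Gamma>"
    by (rule ex_fresh_Lam)
  let ?\<Gamma> = "insert (Atom (U d), \<phi>) \<Gamma>"
  have tenv: "tenv ?\<Gamma>" using \<Gamma> d by (rule tenv_insert)
  have sat: "satisfies M ?\<Gamma> \<zeta>" using Lam.prems(1) tenv by (rule satisfies_insert_atom)
  have n: "\<exists>\<psi>. (Atom (D b), \<psi>) \<in> ?\<Gamma> \<and> typing ctype ?\<Gamma> u \<psi>" if "fmlookup n b = Some u" for b u
    using Lam.prems(2)[OF that] typing_mono[OF _ tenv subset_insertI] by blast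
  have s: "typing ctype ?\<Gamma> s \<psi>" using Lam.IH[OF eq d] by blast
  have i: "interp M \<zeta> ?\<Gamma> s \<in> carrier M ?\<Gamma> \<psi>" using interp_in[OF s sat] .
  have ok: "subst_ok \<Gamma> (atom_type \<Gamma>) (fmmap (interp M \<zeta> \<Gamma>) n)"
    using \<Gamma> Lam.prems interp_in by (intro subst_ok_interp) blast+
  have free: "d \<notin> free u" if "u \<in> fmran' n" for u
    using Lam.prems(2) free_typing d that by (fastforce simp: fmlookup_ran'_iff)
  have "fmmap (interp M \<zeta> ?\<Gamma>) n = fmmap (interp M \<zeta> \<Gamma>) n"
  proof (rule fmap.map_cong0)
    fix u assume "u \<in> fmran' n"
    then obtain b where "fmlookup n b = Some u" by (auto simp: fmlookup_ran'_iff)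
    then show "interp M \<zeta> ?\<Gamma> u = interp M \<zeta> \<Gamma> u"
      using Lam.prems interp_mono[OF _ _ tenv subset_insertI] by blast
  qed
  then have "interp M \<zeta> ?\<Gamma> (subst1 (demb n) s) =
      simsubst M (atom_type ?\<Gamma>) (interp M \<zeta> ?\<Gamma> s) (fmmap (interp M \<zeta> \<Gamma>) n)"
    using Lam.IH[OF eq d] sat n by metis
  \<comment> \<open>Typing the binder changes \<open>atom_type\<close> at most at
    \<open>U d\<close>, while \<open>simsubst\<close> consults it only at atoms of the form
    \<open>D b\<close>.\<close>
  also have "\<dots> = simsubst M (atom_type \<Gamma>) (interp M \<zeta> ?\<Gamma> s) (fmmap (interp M \<zeta> \<Gamma>) n)"
    using subst_ok_mono[OF ok tenv subset_insertI] i
    by (rule simsubst_type_cong) (auto intro: atom_type_cong)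
  finally have subst: "interp M \<zeta> ?\<Gamma> (subst1 (demb n) s) =
      simsubst M (atom_type \<Gamma>) (interp M \<zeta> ?\<Gamma> s) (fmmap (interp M \<zeta> \<Gamma>) n)" .
  have "typing ctype \<Gamma> (Lam d \<phi> (subst1 (demb n) s)) (\<phi> \<rightarrow>\<^sub>t \<psi>)"
  proof -
    have "typing ctype \<Gamma> (subst1 (demb n) (Lam c \<phi> r)) (\<phi> \<rightarrow>\<^sub>t \<psi>)"
      using Lam.hyps(1) Lam.prems(2) by (rule typing_subst1)
    then show ?thesis by (simp add: eq subst1_demb_Lam free)
  qed
  from interp_Lam_fresh[OF this Lam.prems(1) d]
  have "interp M \<zeta> \<Gamma> (subst1 (demb n) (Lam c \<phi> r)) =
      abstr M (U d) \<phi> (interp M \<zeta> ?\<Gamma> (subst1 (demb n) s))"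
    by (simp add: eq subst1_demb_Lam free)
  also have "\<dots> = simsubst M (atom_type \<Gamma>) (abstr M (U d) \<phi> (interp M \<zeta> ?\<Gamma> s)) (fmmap (interp M \<zeta> \<Gamma>) n)"
    by (simp add: subst simsubst_abstr[OF ok d i])
  also have "abstr M (U d) \<phi> (interp M \<zeta> ?\<Gamma> s) = interp M \<zeta> \<Gamma> (Lam c \<phi> r)"
    unfolding eq using interp_Lam_fresh[OF Lam.hyps(1)[unfolded eq] Lam.prems(1) d] by simp
  finally show ?case .
next
  case (App \<Gamma> r \<phi> \<psi> s)
  have "subst_ok \<Gamma> (atom_type \<Gamma>) (fmmap (interp M \<zeta> \<Gamma>) n)"
    using App.prems typing_tenv[OF App.hyps(1)] interp_in by (intro subst_ok_interp) blast+
  from simsubst_applic[OF this interp_in[OF App.hyps(1) App.prems(1)] interp_in[OF App.hyps(2) App.prems(1)]]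
  show ?case using App.IH App.prems by simp
next
  case (Unk \<Gamma> X \<phi> m)
  have n: "subst_ok \<Gamma> (atom_type \<Gamma>) (fmmap (interp M \<zeta> \<Gamma>) n)"
    using Unk(1) Unk.prems interp_in by (intro subst_ok_interp) blast+
  have m: "subst_ok \<Gamma> (atom_type \<Gamma>) (fmmap (interp M \<zeta> \<Gamma>) m)"
    using Unk(1,3) interp_in Unk.prems(1) by (intro subst_ok_interp) blast+
  have x: "\<zeta> X \<in> carrier M \<Gamma> \<phi>" using Unk by (simp add: satisfies_def)
  have "fmmap (\<lambda>s. interp M \<zeta> \<Gamma> (subst1 (demb n) s)) m =
      fmmap (\<lambda>s. simsubst M (atom_type \<Gamma>) (interp M \<zeta> \<Gamma> s) (fmmap (interp M \<zeta> \<Gamma>) n)) m"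
  proof (rule fmap.map_cong0)
    fix s assume "s \<in> fmran' m"
    then obtain b where "fmlookup m b = Some s" by (auto simp: fmlookup_ran'_iff)
    then show "interp M \<zeta> \<Gamma> (subst1 (demb n) s) =
        simsubst M (atom_type \<Gamma>) (interp M \<zeta> \<Gamma> s) (fmmap (interp M \<zeta> \<Gamma>) n)"
      using Unk(3) Unk.prems by metis
  qed
  \<comment> \<open>The level 1 clause attaches \<open>n\<close> overridden by the substituted
    \<open>m\<close>; its interpretation is the map on the right of
    \<open>simsubst_simsubst\<close>.\<close>
  then show ?case
    using simsubst_simsubst[OF m n x] by (simp add: fmap.map_comp comp_def)
qed

lemma atom_type_insert_Unknown: "atom_type (insert (Unknown X, \<chi>) \<Gamma>) = atom_type \<Gamma>"
  by (intro ext atom_type_cong) simp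

text \<open>The value \<open>y\<close> is fixed while the environment grows below binders; the
  equation for \<open>t\<close> is therefore a premise, restored after each extension by
  \<open>interp_mono\<close>. The right side keeps the typing of \<open>X\<close>, so that
  \<open>r\<close> is interpreted in the environment that types it and
  \<open>interp_Lam_fresh\<close> applies.\<close>

lemma interp_subst2:
  assumes "typing ctype (insert (Unknown X, \<chi>) \<Gamma>) r \<phi>" "typing ctype \<Gamma> t \<chi>" "satisfies M \<Gamma> \<zeta>"
    "interp M \<zeta> \<Gamma> t = y"
  shows "interp M \<zeta> \<Gamma> (subst2 X t r) = interp M (\<zeta>(X := y)) (insert (Unknown X, \<chi>) \<Gamma>) r"
  using assms
proof (induction "insert (Unknown X, \<chi>) \<Gamma>" r \<phi> arbitrary: \<Gamma> rule: typing_fresh_induct)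
  case (Atm a \<phi>)
  then show ?case by (simp add: atom_type_insert_Unknown)
next
  case (Cst C)
  then show ?case by simp
next
  case (Lam c \<phi> r \<psi>)
  let ?\<Gamma>' = "insert (Unknown X, \<chi>) \<Gamma>" and ?\<zeta> = "\<zeta>(X := y)"
  have \<Gamma>: "tenv \<Gamma>" using typing_tenv[OF Lam.prems(1)] .
  then obtain d s where eq: "Lam c \<phi> r = Lam d \<phi> s" and d: "Atom (U d) \<notin> Domain \<Gamma>"
    by (rule ex_fresh_Lam)
  let ?\<Gamma> = "insert (Atom (U d), \<phi>) \<Gamma>"
  have d': "Atom (U d) \<notin> Domain ?\<Gamma>'" using d by auto
  have tenv: "tenv ?\<Gamma>" using \<Gamma> d by (rule tenv_insert)
  have free: "d \<notin> free t" using free_typing[OF Lam.prems(1)] d by blast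
  have "y \<in> carrier M ?\<Gamma>' \<chi>"
    using interp_in[OF Lam.prems(1,2)] typing_tenv[OF Lam(1)] Lam.prems(3)
    by (auto intro: carrier_monoD)
  \<comment> \<open>\<Gamma> may already type \<open>X\<close>; functionality then forces the type
    \<chi>, so that the new value suits every typing of \<open>X\<close>.\<close>
  moreover have "\<theta> = \<chi>" if "(Unknown X, \<theta>) \<in> ?\<Gamma>'" for \<theta>
    using tenv_unique[OF typing_tenv[OF Lam(1)] that] by simp
  ultimately have sat: "satisfies M ?\<Gamma>' ?\<zeta>"
    using Lam.prems(2) typing_tenv[OF Lam(1)] unfolding satisfies_def
    by (auto intro: carrier_monoD)
  have "typing ctype \<Gamma> (Lam d \<phi> (subst2 X t s)) (\<phi> \<rightarrow>\<^sub>t \<psi>)"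
    using typing_subst2[OF Lam(1) Lam.prems(1)] by (simp add: eq subst2_Lam free)
  from interp_Lam_fresh[OF this Lam.prems(2) d]
  have "interp M \<zeta> \<Gamma> (subst2 X t (Lam c \<phi> r)) = abstr M (U d) \<phi> (interp M \<zeta> ?\<Gamma> (subst2 X t s))"
    by (simp add: eq subst2_Lam free)
  also have "interp M \<zeta> ?\<Gamma> (subst2 X t s) = interp M ?\<zeta> (insert (Unknown X, \<chi>) ?\<Gamma>) s"
    using Lam(2)[OF eq d', THEN conjunct2, rule_format, OF insert_commute]
      typing_mono[OF Lam.prems(1) tenv] satisfies_insert_atom[OF Lam.prems(2) tenv]
      interp_mono[OF Lam.prems(1,2) tenv] Lam.prems(3) by blast
  also have "abstr M (U d) \<phi> (interp M ?\<zeta> (insert (Unknown X, \<chi>) ?\<Gamma>) s) = interp M ?\<zeta> ?\<Gamma>' (Lam c \<phi> r)"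
    unfolding eq using interp_Lam_fresh[OF Lam(1)[unfolded eq] sat d'] by (simp add: insert_commute)
  finally show ?case .
next
  case (App r \<phi> \<psi> s)
  then show ?case by simp
next
  case (Unk Y \<phi> m)
  let ?\<Gamma>' = "insert (Unknown X, \<chi>) \<Gamma>" and ?\<zeta> = "\<zeta>(X := y)"
  have m: "fmmap (\<lambda>s. interp M \<zeta> \<Gamma> (subst2 X t s)) m = fmmap (interp M ?\<zeta> ?\<Gamma>') m"
  proof (rule fmap.map_cong0)
    fix s assume "s \<in> fmran' m"
    then obtain b where "fmlookup m b = Some s" by (auto simp: fmlookup_ran'_iff)
    then show "interp M \<zeta> \<Gamma> (subst2 X t s) = interp M ?\<zeta> ?\<Gamma>' s" using Unk(3) Unk.prems by metis
  qed
  show ?case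
  proof (cases "Y = X")
    case True
    have "\<exists>\<psi>. (Atom (D b), \<psi>) \<in> \<Gamma> \<and> typing ctype \<Gamma> s \<psi>"
      if "fmlookup (fmmap (subst2 X t) m) b = Some s" for b s
      using that Unk(3) typing_subst2 Unk.prems(1) by fastforce
    then have "interp M \<zeta> \<Gamma> (subst1 (demb (fmmap (subst2 X t) m)) t) =
        simsubst M (atom_type \<Gamma>) (interp M \<zeta> \<Gamma> t) (fmmap (interp M \<zeta> \<Gamma>) (fmmap (subst2 X t) m))"
      by (rule interp_subst1[OF Unk.prems(1,2)])
    then show ?thesis
      using True m Unk.prems(3) by (simp add: fmap.map_comp comp_def atom_type_insert_Unknown)
  next
    case False
    then show ?thesis using m by (simp add: fmap.map_comp comp_def atom_type_insert_Unknown)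
  qed
qed

end

theorem theorem5p15:
  fixes ctype :: "'c \<Rightarrow> 'b ty"
    and M :: "('b, 'c, 'v, 'e) model"
    and \<Gamma> :: "('b, 'v) env"
    and \<zeta> :: "'v \<Rightarrow> 'e"
    and X :: 'v
    and r t :: "('b, 'c, 'v) trm"
    and \<phi> \<chi> :: "'b ty"
  assumes "nominal_model ctype M"
    and "typing ctype (insert (Unknown X, \<chi>) \<Gamma>) r \<phi>"
    and "typing ctype \<Gamma> t \<chi>"
    and "valuation M \<zeta>"
    and "satisfies M \<Gamma> \<zeta>"
  shows "interp M \<zeta> \<Gamma> (subst2 X t r) = interp M (\<zeta>(X := interp M \<zeta> \<Gamma> t)) \<Gamma> r"
proof -
  interpret nominal_model ctype M by (rule assms(1))
  have "interp M \<zeta> \<Gamma> (subst2 X t r) =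
      interp M (\<zeta>(X := interp M \<zeta> \<Gamma> t)) (insert (Unknown X, \<chi>) \<Gamma>) r"
    using assms(2,3,5) refl by (rule interp_subst2)
  \<comment> \<open>Both environments type the same atoms.\<close>
  also have "\<dots> = interp M (\<zeta>(X := interp M \<zeta> \<Gamma> t)) \<Gamma> r"
    by (rule interp_atoms_cong) simp
  finally show ?thesis .
qed

end
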